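(* Let $t\mapsto \mathrm{G}(t):=\mathrm{G}(\alpha_0(t),\dots,\alpha_{n-1}(t),\tau_n(t))$, $t\in\mathbb{R}$, be a differentiable matrix-valued function, where for all $t$, $\alpha_j(t)\in\mathbb{D}$ $(j=0,\dots,n-1)$ and $\tau_n(t)\in\mathbb{S}^1$. Let $S=S(t)$ be the set of eigenvalues of $\mathrm{G}(t)$, let $\zeta\in\mathbb{S}^1$ be independent of $t$, and let $U:=\{t\in\mathbb{R}:\zeta\notin S(t)\}$. For $t\in U$ let $p_j(z,\zeta)$, $\mathrm{H}$, $\mathrm{K}$ be the ($t$-dependent) objects defined in the context, let $\eta\in S$ (regarded as a differentiable function of $t$), and let $\mathrm{p}:=(p_0(\eta,\zeta),\dots,p_n(\eta,\zeta))^{\mathrm{T}}$. Then $\eta$ moves strictly counterclockwise along $\mathbb{S}^1$ as $t$ increases (that is, $\frac{\mathrm{d}}{\mathrm{d}t}\arg(\eta)>0$ at $t$) if and only if $$ \left(\mathrm{p},\ \mathrm{H}^{1/2}\,\frac{\mathrm{d}}{\mathrm{d}t}\big(\mathrm{H}^{-1/2}\mathrm{K}\mathrm{H}^{-1/2}\big)\,\mathrm{H}^{1/2}\mathrm{p}\right)<0 $$ (at $t$).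
   Context: Notation: $\mathbb{D}=\{z\in\mathbb{C}:|z|<1\}$, $\mathbb{S}^1=\{z\in\mathbb{C}:|z|=1\}$; $n\ge 1$ is an integer; $(\mathrm{x},\mathrm{y})$ is the standard Hermitian inner product on $\mathbb{C}^{n+1}$; for a positive definite Hermitian matrix $\mathrm{X}$, $\mathrm{X}^{1/2}$ is the positive definite square root. $\mathrm{I}_k$ is the $k\times k$ identity matrix. The matrix $\mathrm{G}(\alpha_0,\dots,\alpha_{n-1},\tau_n)$: for $\alpha_j\in\mathbb{D}$ $(j=0,\dots,n-1)$ and $\tau_n\in\mathbb{S}^1$, put $\rho_j=(1-|\alpha_j|^2)^{1/2}$, $\Theta_j=\begin{pmatrix}\overline{\alpha_j}&\rho_j\\ \rho_j&-\alpha_j\end{pmatrix}$, $\mathrm{G}_j=\mathrm{diag}(\mathrm{I}_j,\Theta_j,\mathrm{I}_{n-j-1})$ for $0\le j\le n-1$, $\mathrm{G}_n=\mathrm{diag}(\mathrm{I}_n,\overline{\tau_n})$, and $\mathrm{G}(\alpha_0,\dots,\alpha_{n-1},\tau_n)=\mathrm{G}_0\mathrm{G}_1\cdots\mathrm{G}_n$. It is an $(n+1)\times(n+1)$ unitary upper Hessenberg matrix with positive subdiagonal entries; its eigenvalues are simple and depend differentiably on $t$. Pseudoreflexion coefficients: $\tau_n(\zeta):=\tau_n$ and $\tau_j(\zeta):=\dfrac{\overline{\zeta}\,\alpha_j+\tau_{j+1}(\zeta)}{\overline{\alpha_j}\,\tau_{j+1}(\zeta)+\overline{\zeta}}$ for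 $j=n-1,\dots,0$. Fix one of the two square roots $\zeta^{1/2}$ of $\zeta$, with $\zeta^{-1/2}:=1/\zeta^{1/2}$, and put $\alpha_{-1}:=-1$. Define $$\beta_0(\zeta):=\frac{1}{\zeta^{-1/2}-\tau_0(\zeta)\zeta^{1/2}},\qquad \beta_j(\zeta):=\frac{1}{\beta_{j-1}(\zeta)}\,\frac{1}{\overline{\zeta}+\tau_{j-1}(\zeta)\overline{\alpha_{j-2}}}\,\frac{1}{1-\overline{\tau_{j-1}(\zeta)}\,\alpha_{j-1}}\quad(j=1,\dots,n).$$ Define polynomials in $z$ by $p_{-1}(z,\zeta):=0$, $p_0(z,\zeta):=p_0\in\mathbb{R}\setminus\{0\}$ (a constant), and $$p_{j+1}(z,\zeta):=\big(\beta_j(\zeta)+\overline{\beta_j(\zeta)}\,z\big)p_j(z,\zeta)-z\,p_{j-1}(z,\zeta)\quad(j=0,\dots,n).$$ Let $\mathrm{A}$ be the $(n+1)\times(n+1)$ lower bidiagonal matrix equal to $\zeta^{1/2}$ times the matrix with diagonal entries $\overline{\beta_0(\zeta)},\dots,\overline{\beta_n(\zeta)}$, all entries on the first subdiagonal equal to $-1$, and all other entries $0$. Its Toeplitz decomposition is $\mathrm{A}=\mathrm{H}+i\mathrm{K}$ with $\mathrm{H}=(\mathrm{A}+\mathrm{A}^* )/2$ and $\mathrm{K}=(\mathrm{A}-\mathrm{A}^* )/(2i)$. For $t\in U$ the matrix $\mathrm{H}$ is positive definite, so $\mathrm{H}^{\pm1/2}$ make sense. $\frac{\mathrm{d}}{\mathrm{d}t}\arg(\eta)$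 is the derivative of any locally differentiable branch of $\arg(\eta(t))$. *)

theory Defs
  imports "HOL-Analysis.Analysis" "HOL-Computational_Algebra.Polynomial"
    "Jordan_Normal_Form.Spectral_Radius" "Jordan_Normal_Form.Gauss_Jordan_Elimination"
begin

definition Theta_mat :: "complex \<Rightarrow> complex mat" where
  "Theta_mat a =
     (let r = complex_of_real (sqrt (1 - (cmod a)\<^sup>2))
      in mat_of_rows_list 2 [[cnj a, r], [r, - a]])"

definition G_factor :: "nat \<Rightarrow> (nat \<Rightarrow> complex) \<Rightarrow> nat \<Rightarrow> complex mat" where
  "G_factor n \<alpha> j = diag_block_mat [1\<^sub>m j, Theta_mat (\<alpha> j), 1\<^sub>m (n - j - 1)]"

definition G_last :: "nat \<Rightarrow> complex \<Rightarrow> complex mat" where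
  "G_last n \<tau>n = diag_block_mat [1\<^sub>m n, mat 1 1 (\<lambda>_. cnj \<tau>n)]"

definition G_mat :: "nat \<Rightarrow> (nat \<Rightarrow> complex) \<Rightarrow> complex \<Rightarrow> complex mat" where
  "G_mat n \<alpha> \<tau>n = foldr (*) (map (G_factor n \<alpha>) [0..<n]) (G_last n \<tau>n)"

function tau :: "nat \<Rightarrow> (nat \<Rightarrow> complex) \<Rightarrow> complex \<Rightarrow> complex \<Rightarrow> nat \<Rightarrow> complex" where
  "tau n \<alpha> \<tau>n \<zeta> j =
     (if n \<le> j then \<tau>n
      else (cnj \<zeta> * \<alpha> j + tau n \<alpha> \<tau>n \<zeta> (Suc j)) /
           (cnj (\<alpha> j) * tau n \<alpha> \<tau>n \<zeta> (Suc j) + cnj \<zeta>))"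
  by pat_completeness auto
termination
  by (relation "Wellfounded.measure (\<lambda>(n, \<alpha>, \<tau>n, \<zeta>, j). n - j)") auto

declare tau.simps [simp del]

text \<open>
  The argument \<^term>\<open>w\<close> is the chosen square root of \<^term>\<open>\<zeta>\<close>; the conditional implements
  the convention that the coefficient with index \<open>-1\<close> equals \<open>-1\<close>.
\<close>
primrec beta :: "nat \<Rightarrow> (nat \<Rightarrow> complex) \<Rightarrow> complex \<Rightarrow> complex \<Rightarrow> complex \<Rightarrow> nat \<Rightarrow> complex" where
  "beta n \<alpha> \<tau>n \<zeta> w 0 = 1 / (1 / w - tau n \<alpha> \<tau>n \<zeta> 0 * w)"
| "beta n \<alpha> \<tau>n \<zeta> w (Suc j) =
     1 / beta n \<alpha> \<tau>n \<zeta> w j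
     * (1 / (cnj \<zeta> + tau n \<alpha> \<tau>n \<zeta> j * cnj (if j = 0 then - 1 else \<alpha> (j - 1))))
     * (1 / (1 - cnj (tau n \<alpha> \<tau>n \<zeta> j) * \<alpha> j))"

fun p_poly :: "(nat \<Rightarrow> complex) \<Rightarrow> real \<Rightarrow> nat \<Rightarrow> complex poly" where
  "p_poly \<beta> c 0 = [:complex_of_real c:]"
| "p_poly \<beta> c (Suc j) =
     [:\<beta> j, cnj (\<beta> j):] * p_poly \<beta> c j
     - [:0, 1:] * (if j = 0 then 0 else p_poly \<beta> c (j - 1))"

definition A_mat :: "nat \<Rightarrow> (nat \<Rightarrow> complex) \<Rightarrow> complex \<Rightarrow> complex mat" where
  "A_mat n \<beta> w =
     w \<cdot>\<^sub>m mat (n + 1) (n + 1)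
       (\<lambda>(i, j). if i = j then cnj (\<beta> i) else if i = j + 1 then - 1 else 0)"

definition toeplitz_H :: "complex mat \<Rightarrow> complex mat" where
  "toeplitz_H A = (1 / 2) \<cdot>\<^sub>m (A + mat_adjoint A)"

definition toeplitz_K :: "complex mat \<Rightarrow> complex mat" where
  "toeplitz_K A = (1 / (2 * \<i>)) \<cdot>\<^sub>m (A - mat_adjoint A)"

text \<open>In the order on \<^typ>\<open>complex\<close>, \<open>0 < z\<close> means that \<open>z\<close> is real and positive.\<close>
definition pos_def :: "complex mat \<Rightarrow> bool" where
  "pos_def X \<longleftrightarrow>
     square_mat X \<and> mat_adjoint X = X \<and>
     (\<forall>v \<in> carrier_vec (dim_row X). v \<noteq> 0\<^sub>v (dim_row X) \<longrightarrow> 0 < (X *\<^sub>v v) \<bullet>c v)"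

definition pd_sqrt :: "complex mat \<Rightarrow> complex mat" where
  "pd_sqrt X = (THE Y. pos_def Y \<and> Y * Y = X)"

definition pd_inv_sqrt :: "complex mat \<Rightarrow> complex mat" where
  "pd_inv_sqrt X = the (mat_inverse (pd_sqrt X))"

definition mat_deriv :: "(real \<Rightarrow> complex mat) \<Rightarrow> real \<Rightarrow> complex mat" where
  "mat_deriv M t =
     mat (dim_row (M t)) (dim_col (M t)) (\<lambda>ij. vector_derivative (\<lambda>s. M s $$ ij) (at t))"

text \<open>
  The derivative of any branch of the argument of \<open>\<eta>\<close> near \<open>t\<close>; the value does not depend on the
  branch, since two branches that are continuous at \<open>t\<close> differ by a constant near \<open>t\<close>.
\<close>
definition arg_deriv :: "(real \<Rightarrow> complex) \<Rightarrow> real \<Rightarrow> real" where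
  "arg_deriv \<eta> t =
     (THE d. \<exists>\<theta>. (\<forall>\<^sub>F s in nhds t. is_Arg (\<eta> s) (\<theta> s)) \<and> (\<theta> has_real_derivative d) (at t))"

end

theory Submission
  imports Defs
begin

text \<open>
  Write \<open>A = H + i K\<close> for the bidiagonal matrix, and let \<open>p\<close> be the vector of the values
  \<open>p\<^sub>0(\<eta>), \<dots>, p\<^sub>n(\<eta>)\<close> at an eigenvalue \<open>\<eta>\<close> of \<open>G\<close>. Row by row, the three-term recurrence
  together with \<open>p\<^sub>n\<^sub>+\<^sub>1(\<eta>) = 0\<close> says that \<open>\<eta> A p + \<zeta> A\<^sup>* p = 0\<close>. In terms of \<open>H\<close> and \<open>K\<close> this is the
  generalized eigenvalue equation \<open>K p = \<mu> H p\<close> with \<open>\<mu> = i (\<eta> + \<zeta>) / (\<eta> - \<zeta>)\<close>. Both matrices are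
  Hermitian and \<open>H\<close> is positive definite, so \<open>\<mu>\<close> is real, and \<open>\<eta> = \<zeta> (\<mu> + i) / (\<mu> - i)\<close> has the
  argument \<open>Arg \<zeta> + \<pi> - 2 arctan \<mu>\<close>. Hence \<open>\<eta>\<close> moves counterclockwise exactly when \<open>\<mu>' < 0\<close>
  (lemma \<open>arg_deriv_cayley\<close>). The vector \<open>q = H\<^sup>1\<^sup>/\<^sup>2 p\<close> is an eigenvector of the Hermitian matrix
  \<open>M = H\<^sup>-\<^sup>1\<^sup>/\<^sup>2 K H\<^sup>-\<^sup>1\<^sup>/\<^sup>2\<close> with eigenvalue \<open>\<mu>\<close>, and first-order perturbation theory gives
  \<open>(q, M' q) = \<mu>' (q, q)\<close> (lemma \<open>pencil_derivative\<close>), whose left-hand side is the form in the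
  theorem.

  Three ingredients carry this argument.

  The polynomial \<open>p\<^sub>n\<^sub>+\<^sub>1\<close> vanishes at the eigenvalues of \<open>G\<close>. Multiplying a row vector by the factors
  \<open>G\<^sub>0, G\<^sub>1, \<dots>\<close> one after the other turns the equation \<open>x G = z x\<close> into the Szego recursion for a pair
  \<open>(x\<^sub>j, c\<^sub>j)\<close>, the values of a normalized orthogonal polynomial and of its reversed polynomial, with
  the boundary condition \<open>z x\<^sub>n = cnj \<tau>\<^sub>n c\<^sub>n\<close>
  (lemma \<open>eigenvalue_imp_left_recursion\<close>). The pseudoreflexion coefficient \<open>\<tau>\<^sub>j\<close> is the boundary condition
  pulled back from level \<open>n\<close> to level \<open>j\<close> at the point \<open>\<zeta>\<close>, and \<open>p\<^sub>j\<^sub>+\<^sub>1(z)\<close> is a multiple of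
  \<open>z x\<^sub>j - cnj \<tau>\<^sub>j c\<^sub>j\<close> (lemma \<open>three_term_from_szego\<close>). Pulling the condition back to level \<open>0\<close> also
  shows that \<open>\<beta>\<^sub>0\<close> has a nonzero denominator when \<open>\<zeta>\<close> is not an eigenvalue.

  The matrix \<open>H\<close> is positive definite. It is tridiagonal with off-diagonal entries of modulus
  \<open>1/2\<close>, and its diagonal entries are \<open>(r\<^sub>j + 1/r\<^sub>j\<^sub>-\<^sub>1) / 2\<close> for explicit positive numbers \<open>r\<^sub>j\<close>,
  with \<open>r\<^sub>0 / 2\<close> in the first place; this makes its quadratic form a sum of squares
  (lemma \<open>toeplitz_H_pos_def\<close>).

  The matrix \<open>H\<^sup>1\<^sup>/\<^sup>2\<close> depends differentiably on \<open>t\<close>. The difference \<open>D\<close> of two positive definite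
  matrices \<open>X\<close> and \<open>Z\<close> solves the Sylvester equation \<open>X D + D Z = X\<^sup>2 - Z\<^sup>2\<close>, and \<open>D\<close> is controlled by
  the right-hand side (lemma \<open>sylvester_bound\<close>). This yields uniqueness of the square root, its
  continuity, and then the convergence of its difference quotients (lemma \<open>pd_sqrt_differentiable\<close>).
\<close>

no_notation Finite_Cartesian_Product.vec_nth (infixl "$" 90)

section \<open>The spectral theorem for Hermitian matrices\<close>

lemma dim_adjoint [simp]:
  "dim_row (mat_adjoint A) = dim_col A" "dim_col (mat_adjoint A) = dim_row A"
  by (simp_all add: mat_adjoint_def)

lemma adjoint_carrier [simp, intro]: "A \<in> carrier_mat m k \<Longrightarrow> mat_adjoint A \<in> carrier_mat k m"
  by (auto simp: mat_adjoint_def)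

lemma index_adjoint [simp]:
  fixes A :: "complex mat"
  assumes "i < dim_col A" "j < dim_row A"
  shows "mat_adjoint A $$ (i, j) = cnj (A $$ (j, i))"
  using assms by (simp add: mat_adjoint_def mat_of_rows_index)

lemma adjoint_adjoint [simp]:
  fixes A :: "complex mat"
  shows "mat_adjoint (mat_adjoint A) = A"
  by (rule eq_matI) auto

lemma mult_vec_carrier [simp, intro]:
  fixes A :: "complex mat"
  shows "A \<in> carrier_mat a k \<Longrightarrow> A *\<^sub>v v \<in> carrier_vec a"
  by (metis carrier_matD(1) carrier_vecI dim_mult_mat_vec)

lemma mult_square_carrier [simp]:
  "A \<in> carrier_mat m m \<Longrightarrow> B \<in> carrier_mat m m \<Longrightarrow> A * B \<in> carrier_mat m m"
  by (rule mult_carrier_mat)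

lemma index_mult_sum:
  fixes A B :: "complex mat"
  assumes "A \<in> carrier_mat a k" "B \<in> carrier_mat k c" "i < a" "j < c"
  shows "(A * B) $$ (i, j) = (\<Sum>l<k. A $$ (i, l) * B $$ (l, j))"
  using assms by (auto simp: scalar_prod_def lessThan_atLeast0 intro!: sum.cong)

lemma index_mult_vec_sum:
  fixes A :: "complex mat"
  assumes "A \<in> carrier_mat a k" "v \<in> carrier_vec k" "i < a"
  shows "(A *\<^sub>v v) $ i = (\<Sum>l<k. A $$ (i, l) * v $ l)"
  using assms by (auto simp: scalar_prod_def lessThan_atLeast0 intro!: sum.cong)

lemma cscalar_sum:
  fixes u v :: "complex vec"
  assumes "u \<in> carrier_vec k" "v \<in> carrier_vec k"
  shows "u \<bullet>c v = (\<Sum>i<k. u $ i * cnj (v $ i))"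
  using assms by (auto simp: scalar_prod_def lessThan_atLeast0 intro!: sum.cong)

lemma adjoint_mult:
  fixes A B :: "complex mat"
  assumes "A \<in> carrier_mat a k" "B \<in> carrier_mat k c"
  shows "mat_adjoint (A * B) = mat_adjoint B * mat_adjoint A"
proof (rule eq_matI)
  fix i j assume "i < dim_row (mat_adjoint B * mat_adjoint A)"
    "j < dim_col (mat_adjoint B * mat_adjoint A)"
  hence ij: "i < c" "j < a" using assms by auto
  have "mat_adjoint (A * B) $$ (i, j) = cnj ((A * B) $$ (j, i))"
    using assms ij by simp
  also have "\<dots> = (\<Sum>l<k. cnj (A $$ (j, l)) * cnj (B $$ (l, i)))"
    using assms ij by (subst index_mult_sum[of _ a k _ c]) auto
  also have "\<dots> = (mat_adjoint B * mat_adjoint A) $$ (i, j)"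
    using assms ij by (subst index_mult_sum[of _ c k _ a]) (auto intro!: sum.cong)
  finally show "mat_adjoint (A * B) $$ (i, j) = (mat_adjoint B * mat_adjoint A) $$ (i, j)" .
qed (use assms in auto)

lemma adjoint_swap:
  fixes A :: "complex mat"
  assumes A: "A \<in> carrier_mat a k" and u: "u \<in> carrier_vec k" and v: "v \<in> carrier_vec a"
  shows "(A *\<^sub>v u) \<bullet>c v = u \<bullet>c (mat_adjoint A *\<^sub>v v)"
proof -
  have "(A *\<^sub>v u) \<bullet>c v = (\<Sum>i<a. \<Sum>l<k. A $$ (i, l) * u $ l * cnj (v $ i))"
    using assms by (subst cscalar_sum[of _ a])
      (auto simp: index_mult_vec_sum[of A a k] sum_distrib_right simp del: index_mult_mat_vec intro!: sum.cong)
  also have "\<dots> = (\<Sum>l<k. \<Sum>i<a. A $$ (i, l) * u $ l * cnj (v $ i))"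
    by (rule sum.swap)
  also have "\<dots> = u \<bullet>c (mat_adjoint A *\<^sub>v v)"
    using assms by (subst cscalar_sum[of _ k])
      (auto simp: index_mult_vec_sum[of "mat_adjoint A" k a] sum_distrib_left mult_ac simp del: index_mult_mat_vec intro!: sum.cong)
  finally show ?thesis .
qed

definition unitary_mat :: "nat \<Rightarrow> complex mat \<Rightarrow> bool" where
  "unitary_mat m U \<longleftrightarrow> U \<in> carrier_mat m m \<and> mat_adjoint U * U = 1\<^sub>m m \<and> U * mat_adjoint U = 1\<^sub>m m"

definition diag_real :: "nat \<Rightarrow> (nat \<Rightarrow> real) \<Rightarrow> complex mat" where
  "diag_real m d = mat m m (\<lambda>(i, j). if i = j then complex_of_real (d i) else 0)"

lemma diag_real_carrier [simp, intro]: "diag_real m d \<in> carrier_mat m m"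
  by (simp add: diag_real_def)

lemma unitary_mat_mult:
  assumes "unitary_mat m U" "unitary_mat m V"
  shows "unitary_mat m (U * V)"
proof -
  note c = assms[unfolded unitary_mat_def]
  have U: "U \<in> carrier_mat m m" "mat_adjoint U \<in> carrier_mat m m"
    and V: "V \<in> carrier_mat m m" "mat_adjoint V \<in> carrier_mat m m" using c by auto
  have ad: "mat_adjoint (U * V) = mat_adjoint V * mat_adjoint U"
    using U V by (simp add: adjoint_mult)
  have "mat_adjoint V * mat_adjoint U * (U * V) = mat_adjoint V * (mat_adjoint U * U) * V"
    using U V by (simp add: assoc_mult_mat[of _ m m _ m _ m])
  moreover have "U * V * (mat_adjoint V * mat_adjoint U) = U * (V * mat_adjoint V) * mat_adjoint U"
    using U V by (simp add: assoc_mult_mat[of _ m m _ m _ m])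
  ultimately show ?thesis using c U V by (simp add: unitary_mat_def ad)
qed

text \<open>
  Complete \<open>v\<close> to a basis, orthogonalize it by Gram-Schmidt, and normalize the resulting vectors.
\<close>
lemma exists_unitary_with_first_column:
  assumes v: "v \<in> carrier_vec m" "v \<noteq> 0\<^sub>v m" and m: "m \<noteq> 0"
  shows "\<exists>W a. unitary_mat m W \<and> col W 0 = a \<cdot>\<^sub>v v \<and> a \<noteq> 0"
proof -
  define b where "b = basis_completion v"
  define ws where "ws = gram_schmidt m b"
  interpret cof_vec_space m "TYPE(complex)" .
  from basis_completion[OF v, folded b_def]
  have "span (set b) = carrier_vec m" and dist_b: "distinct b"
    and indep: "\<not> lin_dep (set b)" and b: "set b \<subseteq> carrier_vec m" and hdb: "hd b = v"
    and len_b: "length b = m" by auto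
  from hdb len_b m obtain vs where bv: "b = v # vs" by (cases b, auto)
  from gram_schmidt_result[OF b dist_b indep refl, folded ws_def]
  have ws: "set ws \<subseteq> carrier_vec m" "corthogonal ws" "length ws = m"
    by (auto simp: len_b)
  from gram_schmidt_hd[OF v(1), of vs, folded bv] have hdws: "hd ws = v" unfolding ws_def .
  have wsc: "ws ! i \<in> carrier_vec m" if "i < m" for i using ws that by auto
  define c where "c i = (\<Sum>l<m. (cmod (ws ! i $ l))\<^sup>2)" for i
  have sp: "ws ! i \<bullet>c ws ! i = complex_of_real (c i)" if "i < m" for i
    using wsc[OF that] by (simp add: cscalar_sum[of _ m] c_def flip: complex_norm_square)
  have cpos: "c i > 0" if "i < m" for i
  proof -
    have "ws ! i \<bullet>c ws ! i \<noteq> 0" using corthogonalD[OF ws(2), of i i] ws(3) that by auto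
    hence "c i \<noteq> 0" using sp[OF that] by auto
    moreover have "c i \<ge> 0" by (auto simp: c_def intro: sum_nonneg)
    ultimately show ?thesis by simp
  qed
  define W where "W = mat m m (\<lambda>(i, j). ws ! j $ i / complex_of_real (sqrt (c j)))"
  have Wc: "W \<in> carrier_mat m m" by (simp add: W_def)
  have WW: "mat_adjoint W * W = 1\<^sub>m m"
  proof (rule eq_matI)
    fix i j assume "i < dim_row (1\<^sub>m m :: complex mat)" "j < dim_col (1\<^sub>m m :: complex mat)"
    hence ij: "i < m" "j < m" by auto
    have "(mat_adjoint W * W) $$ (i, j) = (\<Sum>l<m. cnj (W $$ (l, i)) * W $$ (l, j))"
      using Wc ij by (subst index_mult_sum[of _ m m _ m]) auto
    also have "\<dots> = (\<Sum>l<m. ws ! j $ l * cnj (ws ! i $ l)) / complex_of_real (sqrt (c i) * sqrt (c j))"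
      using ij by (simp add: W_def sum_divide_distrib mult.commute)
    also have "(\<Sum>l<m. ws ! j $ l * cnj (ws ! i $ l)) = ws ! j \<bullet>c ws ! i"
      using ij wsc by (simp add: cscalar_sum[of _ m])
    also have "ws ! j \<bullet>c ws ! i / complex_of_real (sqrt (c i) * sqrt (c j)) = (1\<^sub>m m) $$ (i, j)"
    proof (cases "i = j")
      case True
      have "sqrt (c j) * sqrt (c j) = c j" using cpos[OF ij(2)] by simp
      thus ?thesis using True sp[OF ij(2)] cpos[OF ij(2)] ij by simp
    next
      case False
      hence "ws ! j \<bullet>c ws ! i = 0" using corthogonalD[OF ws(2), of j i] ij ws(3) by auto
      thus ?thesis using False ij by simp
    qed
    finally show "(mat_adjoint W * W) $$ (i, j) = (1\<^sub>m m) $$ (i, j)" .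
  qed (use Wc in auto)
  have "W * mat_adjoint W = 1\<^sub>m m"
    using mat_mult_left_right_inverse[of "mat_adjoint W" m W] Wc WW by auto
  hence "unitary_mat m W" using Wc WW by (auto simp: unitary_mat_def)
  moreover have "ws ! 0 = v" using hdws ws(3) m by (metis hd_conv_nth list.size(3))
  hence "col W 0 = (1 / complex_of_real (sqrt (c 0))) \<cdot>\<^sub>v v"
    using m v(1) by (intro eq_vecI) (auto simp: W_def)
  moreover have "1 / complex_of_real (sqrt (c 0)) \<noteq> 0" using cpos[of 0] m by simp
  ultimately show ?thesis by blast
qed

text \<open>
  By induction on the dimension: in a unitary basis starting with an eigenvector, the first column of
  the matrix is a multiple of the first unit vector, by symmetry so is the first row, and the
  remaining block is again Hermitian.
\<close>
theorem hermitian_spectral: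
  fixes A :: "complex mat"
  assumes "A \<in> carrier_mat m m" "mat_adjoint A = A"
  shows "\<exists>U d. unitary_mat m U \<and> A = U * diag_real m d * mat_adjoint U"
  using assms
proof (induction m arbitrary: A)
  case 0
  have "unitary_mat 0 (1\<^sub>m 0)" by (auto simp: unitary_mat_def)
  moreover have "A = 1\<^sub>m 0 * diag_real 0 (\<lambda>_. 0) * mat_adjoint (1\<^sub>m 0)"
    using 0 by (intro eq_matI) (auto simp: diag_real_def)
  ultimately show ?case by blast
next
  case (Suc k)
  note A = Suc.prems(1)
  obtain e where "e \<in> spectrum A" using spectrum_non_empty[OF A] by auto
  then obtain v where "eigenvector A v e" by (auto simp: spectrum_def eigenvalue_def)
  hence v: "v \<in> carrier_vec (Suc k)" "v \<noteq> 0\<^sub>v (Suc k)" "A *\<^sub>v v = e \<cdot>\<^sub>v v"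
    using A by (auto simp: eigenvector_def)
  obtain W a where W: "unitary_mat (Suc k) W" and col: "col W 0 = a \<cdot>\<^sub>v v"
    using exists_unitary_with_first_column[OF v(1,2)] by auto
  have Wc: "W \<in> carrier_mat (Suc k) (Suc k)" "mat_adjoint W \<in> carrier_mat (Suc k) (Suc k)"
    and WW: "mat_adjoint W * W = 1\<^sub>m (Suc k)" "W * mat_adjoint W = 1\<^sub>m (Suc k)"
    using W by (auto simp: unitary_mat_def)
  note assoc = assoc_mult_mat[of _ "Suc k" "Suc k" _ "Suc k" _ "Suc k"]
  define B where "B = mat_adjoint W * A * W"
  have Bc: "B \<in> carrier_mat (Suc k) (Suc k)" using Wc A by (simp add: B_def)
  have Bh: "mat_adjoint B = B"
    using Wc A Suc.prems(2) by (simp add: B_def adjoint_mult[of _ "Suc k" "Suc k" _ "Suc k"] assoc)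
  have B0: "B $$ (i, 0) = (if i = 0 then e else 0)" if "i < Suc k" for i
  proof -
    have "col (A * W) 0 = A *\<^sub>v (a \<cdot>\<^sub>v v)" using col_mult2[OF A Wc(1), of 0] col by simp
    also have "\<dots> = e \<cdot>\<^sub>v col W 0" unfolding col
      using A v by (simp add: mult_mat_vec[of A "Suc k" "Suc k"] smult_smult_assoc mult.commute)
    finally have c: "col (A * W) 0 = e \<cdot>\<^sub>v col W 0" .
    have "B $$ (i, 0) = (mat_adjoint W * (A * W)) $$ (i, 0)"
      using Wc A by (simp add: B_def assoc)
    also have "\<dots> = row (mat_adjoint W) i \<bullet> (e \<cdot>\<^sub>v col W 0)"
      using Wc A that c by simp
    also have "\<dots> = e * (mat_adjoint W * W) $$ (i, 0)"
      using Wc that by simp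
    finally show ?thesis using WW that by simp
  qed
  have B0': "B $$ (0, j) = (if j = 0 then e else 0)" if "j < Suc k" for j
  proof -
    have "B $$ (0, j) = cnj (B $$ (j, 0))" using Bc Bh that by (metis carrier_matD index_adjoint zero_less_Suc)
    moreover have "B $$ (0, 0) = cnj (B $$ (0, 0))" using Bc Bh by (metis carrier_matD index_adjoint zero_less_Suc)
    ultimately show ?thesis using B0[of j] B0[of 0] that by auto
  qed
  have ereal: "e = complex_of_real (Re e)"
  proof -
    have "B $$ (0, 0) = cnj (B $$ (0, 0))" using Bc Bh by (metis carrier_matD index_adjoint zero_less_Suc)
    thus ?thesis using B0[of 0] by (simp add: complex_eq_iff)
  qed
  define C where "C = mat k k (\<lambda>(i, j). B $$ (Suc i, Suc j))"
  have Cc: "C \<in> carrier_mat k k" by (simp add: C_def)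
  have "mat_adjoint C = C"
  proof (rule eq_matI)
    fix i j assume "i < dim_row C" "j < dim_col C"
    hence ij: "i < k" "j < k" using Cc by auto
    have "cnj (B $$ (Suc j, Suc i)) = B $$ (Suc i, Suc j)" using Bc Bh ij
      by (metis carrier_matD index_adjoint Suc_less_eq)
    thus "mat_adjoint C $$ (i, j) = C $$ (i, j)" using ij Cc by (simp add: C_def)
  qed (use Cc in auto)
  from Suc.IH[OF Cc this] obtain V d where V: "unitary_mat k V"
    and CV: "C = V * diag_real k d * mat_adjoint V" by blast
  have Vc: "V \<in> carrier_mat k k" "mat_adjoint V \<in> carrier_mat k k"
    and VV: "mat_adjoint V * V = 1\<^sub>m k" "V * mat_adjoint V = 1\<^sub>m k"
    using V by (auto simp: unitary_mat_def)
  let ?F = "\<lambda>X. four_block_mat (1\<^sub>m 1) (0\<^sub>m 1 k) (0\<^sub>m k 1) X"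
  define d' where "d' i = (case i of 0 \<Rightarrow> Re e | Suc i \<Rightarrow> d i)" for i
  have Fad: "mat_adjoint (?F V) = ?F (mat_adjoint V)"
    using Vc by (intro eq_matI) auto
  have one: "?F (1\<^sub>m k) = 1\<^sub>m (Suc k)" by (intro eq_matI) auto
  have blk: "four_block_mat E (0\<^sub>m 1 k) (0\<^sub>m k 1) X * four_block_mat E' (0\<^sub>m 1 k) (0\<^sub>m k 1) Y =
      four_block_mat (E * E') (0\<^sub>m 1 k) (0\<^sub>m k 1) (X * Y)"
    if "E \<in> carrier_mat 1 1" "E' \<in> carrier_mat 1 1" "X \<in> carrier_mat k k" "Y \<in> carrier_mat k k"
    for E E' X Y :: "complex mat"
  proof -
    have "E * E' \<in> carrier_mat 1 1" "X * Y \<in> carrier_mat k k" using that by auto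
    thus ?thesis using that by (subst mult_four_block_mat[of _ 1 1 _ k _ k _ _ 1 _ k]) auto
  qed
  have mF: "?F X * ?F Y = ?F (X * Y)" if "X \<in> carrier_mat k k" "Y \<in> carrier_mat k k" for X Y :: "complex mat"
    using that by (subst blk) auto
  have FVu: "unitary_mat (Suc k) (?F V)"
  proof -
    have "?F V \<in> carrier_mat (Suc k) (Suc k)" using Vc by auto
    thus ?thesis using Vc VV by (simp add: unitary_mat_def Fad mF one del: One_nat_def) simp
  qed
  let ?E = "mat 1 1 (\<lambda>_. e)"
  have D: "diag_real (Suc k) d' = four_block_mat ?E (0\<^sub>m 1 k) (0\<^sub>m k 1) (diag_real k d)"
    using ereal by (intro eq_matI) (auto simp: diag_real_def d'_def split: nat.splits)
  have "?F V * diag_real (Suc k) d' * mat_adjoint (?F V) = four_block_mat ?E (0\<^sub>m 1 k) (0\<^sub>m k 1) C"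
  proof -
    have E: "?E \<in> carrier_mat 1 1" "(1\<^sub>m 1 :: complex mat) \<in> carrier_mat 1 1"
      "(1\<^sub>m 1 :: complex mat) * ?E \<in> carrier_mat 1 1" "V * diag_real k d \<in> carrier_mat k k" using Vc by auto
    show ?thesis unfolding D Fad CV
      by (simp only: blk[OF E(2,1) Vc(1) diag_real_carrier] blk[OF E(3,2,4) Vc(2)]) auto
  qed
  also have "\<dots> = B"
    using Bc B0 B0' by (intro eq_matI) (auto simp: C_def)
  finally have BF: "B = ?F V * diag_real (Suc k) d' * mat_adjoint (?F V)" ..
  have FVc: "?F V \<in> carrier_mat (Suc k) (Suc k)" "mat_adjoint (?F V) \<in> carrier_mat (Suc k) (Suc k)"
    using FVu by (auto simp: unitary_mat_def)
  have "A = (W * mat_adjoint W) * A * (W * mat_adjoint W)" using WW A by simp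
  also have "\<dots> = W * B * mat_adjoint W" using Wc A by (simp add: B_def assoc)
  also have "\<dots> = (W * ?F V) * diag_real (Suc k) d' * mat_adjoint (W * ?F V)"
    unfolding BF using Wc FVc diag_real_carrier[of "Suc k" d'] by (simp add: adjoint_mult assoc del: index_adjoint)
  finally show ?case using unitary_mat_mult[OF W FVu] by blast
qed

section \<open>Square roots of positive definite matrices\<close>

lemma mult_mat_zero_vec:
  fixes A :: "complex mat"
  assumes "A \<in> carrier_mat a k"
  shows "A *\<^sub>v 0\<^sub>v k = 0\<^sub>v a"
  using assms by (intro eq_vecI) auto

lemma quad_form_sum:
  fixes X :: "complex mat"
  assumes "X \<in> carrier_mat m m" "v \<in> carrier_vec m"
  shows "(X *\<^sub>v v) \<bullet>c v = (\<Sum>i<m. \<Sum>l<m. X $$ (i, l) * v $ l * cnj (v $ i))"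
  using assms by (subst cscalar_sum[of _ m])
    (auto simp: index_mult_vec_sum[of X m m] sum_distrib_right simp del: index_mult_mat_vec)

lemma cscalar_self:
  fixes v :: "complex vec"
  assumes "v \<in> carrier_vec m"
  shows "v \<bullet>c v = complex_of_real (\<Sum>i<m. (cmod (v $ i))\<^sup>2)"
  using assms by (simp add: cscalar_sum[of _ m] flip: complex_norm_square)

lemma quad_form_unitary_diag:
  assumes U: "unitary_mat m U" and v: "v \<in> carrier_vec m"
  shows "((U * diag_real m d * mat_adjoint U) *\<^sub>v v) \<bullet>c v =
    complex_of_real (\<Sum>i<m. d i * (cmod ((mat_adjoint U *\<^sub>v v) $ i))\<^sup>2)"
proof -
  have Uc: "U \<in> carrier_mat m m" "mat_adjoint U \<in> carrier_mat m m"
    using U by (auto simp: unitary_mat_def)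
  define u where "u = mat_adjoint U *\<^sub>v v"
  have u: "u \<in> carrier_vec m" using Uc by (auto simp: u_def)
  have "((U * diag_real m d * mat_adjoint U) *\<^sub>v v) \<bullet>c v = (U *\<^sub>v (diag_real m d *\<^sub>v u)) \<bullet>c v"
    using Uc v u diag_real_carrier[of m d]
    by (simp add: u_def assoc_mult_mat_vec[of _ m m _ m])
  also have "\<dots> = (diag_real m d *\<^sub>v u) \<bullet>c u"
    using Uc v u by (subst adjoint_swap[of U m m]) (auto simp: u_def)
  also have "\<dots> = (\<Sum>i<m. \<Sum>l<m. diag_real m d $$ (i, l) * u $ l * cnj (u $ i))"
    by (rule quad_form_sum) (use u in auto)
  also have "\<dots> = (\<Sum>i<m. complex_of_real (d i) * u $ i * cnj (u $ i))"
  proof (rule sum.cong[OF refl])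
    fix i assume i: "i \<in> {..<m}"
    have "(\<Sum>l<m. diag_real m d $$ (i, l) * u $ l * cnj (u $ i)) =
      (\<Sum>l<m. if l = i then complex_of_real (d i) * u $ i * cnj (u $ i) else 0)"
      using i by (intro sum.cong) (auto simp: diag_real_def)
    thus "(\<Sum>l<m. diag_real m d $$ (i, l) * u $ l * cnj (u $ i)) = complex_of_real (d i) * u $ i * cnj (u $ i)"
      using i by simp
  qed
  also have "\<dots> = complex_of_real (\<Sum>i<m. d i * (cmod (u $ i))\<^sup>2)"
    by (simp add: mult.assoc flip: complex_norm_square)
  finally show ?thesis by (simp add: u_def)
qed

lemma unitary_adjoint_cancel:
  assumes "unitary_mat m U" "v \<in> carrier_vec m"
  shows "U *\<^sub>v (mat_adjoint U *\<^sub>v v) = v" "mat_adjoint U *\<^sub>v (U *\<^sub>v v) = v"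
proof -
  have Uc: "U \<in> carrier_mat m m" "mat_adjoint U \<in> carrier_mat m m"
    using assms by (auto simp: unitary_mat_def)
  show "U *\<^sub>v (mat_adjoint U *\<^sub>v v) = v"
    using assms Uc assoc_mult_mat_vec[of U m m "mat_adjoint U" m v] by (simp add: unitary_mat_def)
  show "mat_adjoint U *\<^sub>v (U *\<^sub>v v) = v"
    using assms Uc assoc_mult_mat_vec[of "mat_adjoint U" m m U m v] by (simp add: unitary_mat_def)
qed

lemma unitary_norm_preserving:
  assumes U: "unitary_mat m U" and v: "v \<in> carrier_vec m"
  shows "(\<Sum>i<m. (cmod ((mat_adjoint U *\<^sub>v v) $ i))\<^sup>2) = (\<Sum>i<m. (cmod (v $ i))\<^sup>2)"
proof -
  have Uc: "U \<in> carrier_mat m m" "mat_adjoint U \<in> carrier_mat m m"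
    using U by (auto simp: unitary_mat_def)
  have "(mat_adjoint U *\<^sub>v v) \<bullet>c (mat_adjoint U *\<^sub>v v) = v \<bullet>c v"
    using adjoint_swap[of "mat_adjoint U" m m v "mat_adjoint U *\<^sub>v v"] Uc v
      unitary_adjoint_cancel[OF U v] by auto
  hence "complex_of_real (\<Sum>i<m. (cmod ((mat_adjoint U *\<^sub>v v) $ i))\<^sup>2) = complex_of_real (\<Sum>i<m. (cmod (v $ i))\<^sup>2)"
    using Uc v by (subst (asm) (1 2) cscalar_self[of _ m]) auto
  thus ?thesis by (simp only: of_real_eq_iff)
qed

lemma unitary_diag_adjoint:
  assumes "unitary_mat m U"
  shows "mat_adjoint (U * diag_real m d * mat_adjoint U) = U * diag_real m d * mat_adjoint U"
proof -
  have Uc: "U \<in> carrier_mat m m" "mat_adjoint U \<in> carrier_mat m m"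
    using assms by (auto simp: unitary_mat_def)
  have "mat_adjoint (diag_real m d) = diag_real m d"
    by (intro eq_matI) (auto simp: diag_real_def)
  thus ?thesis using Uc diag_real_carrier[of m d]
    by (simp add: adjoint_mult[of _ m m _ m] assoc_mult_mat[of _ m m _ m _ m])
qed

lemma unitary_diag_mult:
  assumes "unitary_mat m U"
  shows "(U * diag_real m d * mat_adjoint U) * (U * diag_real m e * mat_adjoint U) =
    U * diag_real m (\<lambda>i. d i * e i) * mat_adjoint U"
proof -
  have Uc: "U \<in> carrier_mat m m" "mat_adjoint U \<in> carrier_mat m m"
    and UU: "mat_adjoint U * U = 1\<^sub>m m"
    using assms by (auto simp: unitary_mat_def)
  have de: "diag_real m d * diag_real m e = diag_real m (\<lambda>i. d i * e i)"
  proof (rule eq_matI)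
    fix i j assume "i < dim_row (diag_real m (\<lambda>i. d i * e i))" "j < dim_col (diag_real m (\<lambda>i. d i * e i))"
    hence ij: "i < m" "j < m" by (auto simp: diag_real_def)
    have "(diag_real m d * diag_real m e) $$ (i, j) = (\<Sum>l<m. diag_real m d $$ (i, l) * diag_real m e $$ (l, j))"
      using ij by (intro index_mult_sum) auto
    also have "\<dots> = (\<Sum>l<m. if l = i then diag_real m d $$ (i, i) * diag_real m e $$ (i, j) else 0)"
      using ij by (intro sum.cong) (auto simp: diag_real_def)
    finally show "(diag_real m d * diag_real m e) $$ (i, j) = diag_real m (\<lambda>i. d i * e i) $$ (i, j)"
      using ij by (simp add: diag_real_def)
  qed (auto simp: diag_real_def)
  have "(U * diag_real m d * mat_adjoint U) * (U * diag_real m e * mat_adjoint U) =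
    U * diag_real m d * (mat_adjoint U * U) * diag_real m e * mat_adjoint U"
    using Uc diag_real_carrier[of m d] diag_real_carrier[of m e]
    by (simp add: assoc_mult_mat[of _ m m _ m _ m])
  also have "\<dots> = U * (diag_real m d * diag_real m e) * mat_adjoint U"
    unfolding UU using Uc diag_real_carrier[of m d] diag_real_carrier[of m e]
    by (subst right_mult_one_mat[of _ m m]) (simp_all add: assoc_mult_mat[of _ m m _ m _ m])
  finally show ?thesis by (simp add: de)
qed

lemma pos_def_unitary_diag:
  assumes U: "unitary_mat m U" and d: "\<And>i. i < m \<Longrightarrow> 0 < d i"
  shows "pos_def (U * diag_real m d * mat_adjoint U)" (is "pos_def ?X")
  unfolding pos_def_def
proof (intro conjI ballI impI)
  have Uc: "U \<in> carrier_mat m m" "mat_adjoint U \<in> carrier_mat m m"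
    using U by (auto simp: unitary_mat_def)
  have X: "?X \<in> carrier_mat m m" using Uc by simp
  show "square_mat ?X" using X by auto
  show "mat_adjoint ?X = ?X" by (rule unitary_diag_adjoint[OF U])
  fix v :: "complex vec" assume "v \<in> carrier_vec (dim_row ?X)" "v \<noteq> 0\<^sub>v (dim_row ?X)"
  hence v: "v \<in> carrier_vec m" "v \<noteq> 0\<^sub>v m" using X by auto
  have "\<exists>i<m. (mat_adjoint U *\<^sub>v v) $ i \<noteq> 0"
  proof (rule ccontr)
    assume "\<not> ?thesis"
    hence "\<And>i. i < m \<Longrightarrow> (mat_adjoint U *\<^sub>v v) $ i = 0" by blast
    hence "mat_adjoint U *\<^sub>v v = 0\<^sub>v m" using Uc by (intro eq_vecI) auto
    hence "v = 0\<^sub>v m" using unitary_adjoint_cancel(1)[OF U v(1)] mult_mat_zero_vec[OF Uc(1)] by simp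
    thus False using v by simp
  qed
  then obtain i where i: "i < m" "(mat_adjoint U *\<^sub>v v) $ i \<noteq> 0" by blast
  have "0 < d i * (cmod ((mat_adjoint U *\<^sub>v v) $ i))\<^sup>2" using i d by simp
  also have "\<dots> \<le> (\<Sum>i<m. d i * (cmod ((mat_adjoint U *\<^sub>v v) $ i))\<^sup>2)"
    using i d by (intro member_le_sum) (auto intro!: mult_nonneg_nonneg less_imp_le[OF d])
  finally show "0 < (?X *\<^sub>v v) \<bullet>c v"
    unfolding quad_form_unitary_diag[OF U v(1)] by (simp add: less_complex_def)
qed

lemma pos_def_spectral:
  assumes X: "X \<in> carrier_mat m m" "pos_def X"
  shows "\<exists>U d. unitary_mat m U \<and> X = U * diag_real m d * mat_adjoint U \<and> (\<forall>i<m. 0 < d i)"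
proof -
  obtain U d where U: "unitary_mat m U" and XU: "X = U * diag_real m d * mat_adjoint U"
    using hermitian_spectral[of X m] X by (auto simp: pos_def_def)
  have Uc: "U \<in> carrier_mat m m" using U by (auto simp: unitary_mat_def)
  have "0 < d i" if i: "i < m" for i
  proof -
    define v where "v = U *\<^sub>v unit_vec m i"
    have v: "v \<in> carrier_vec m" using Uc by (auto simp: v_def)
    have Uv: "mat_adjoint U *\<^sub>v v = unit_vec m i"
      using unitary_adjoint_cancel(2)[OF U] by (simp add: v_def)
    have "v \<noteq> 0\<^sub>v m"
    proof
      assume "v = 0\<^sub>v m"
      hence "unit_vec m i = (0\<^sub>v m :: complex vec)" using Uv mult_mat_zero_vec[of "mat_adjoint U" m m] Uc
        by simp
      thus False using i by (metis index_unit_vec(1) index_zero_vec(1) zero_neq_one)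
    qed
    hence "0 < (X *\<^sub>v v) \<bullet>c v" using X v by (auto simp: pos_def_def)
    also have "(X *\<^sub>v v) \<bullet>c v = complex_of_real (\<Sum>l<m. d l * (cmod (unit_vec m i $ l :: complex))\<^sup>2)"
      unfolding XU quad_form_unitary_diag[OF U v] Uv ..
    also have "(\<Sum>l<m. d l * (cmod (unit_vec m i $ l :: complex))\<^sup>2) = (\<Sum>l<m. if l = i then d l else 0)"
      using i by (intro sum.cong) auto
    finally show ?thesis using i by (simp add: less_complex_def)
  qed
  thus ?thesis using U XU by blast
qed

lemma pos_def_coercive:
  assumes X: "X \<in> carrier_mat m m" "pos_def X"
  shows "\<exists>c>0. \<forall>v\<in>carrier_vec m. c * (\<Sum>i<m. (cmod (v $ i))\<^sup>2) \<le> Re ((X *\<^sub>v v) \<bullet>c v)"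
proof -
  obtain U d where U: "unitary_mat m U" and XU: "X = U * diag_real m d * mat_adjoint U"
    and d: "\<forall>i<m. 0 < d i" using pos_def_spectral[OF X] by auto
  \<comment> \<open>The element \<open>1\<close> makes the set nonempty in dimension \<open>0\<close>.\<close>
  define c where "c = Min (insert 1 (d ` {..<m}))"
  have c: "c > 0" using d by (auto simp: c_def)
  have cd: "c \<le> d i" if "i < m" for i using that by (auto simp: c_def)
  have "c * (\<Sum>i<m. (cmod (v $ i))\<^sup>2) \<le> Re ((X *\<^sub>v v) \<bullet>c v)" if v: "v \<in> carrier_vec m" for v
  proof -
    have "c * (\<Sum>i<m. (cmod (v $ i))\<^sup>2) = (\<Sum>i<m. c * (cmod ((mat_adjoint U *\<^sub>v v) $ i))\<^sup>2)"
      by (simp only: sum_distrib_left[symmetric] unitary_norm_preserving[OF U v])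
    also have "\<dots> \<le> (\<Sum>i<m. d i * (cmod ((mat_adjoint U *\<^sub>v v) $ i))\<^sup>2)"
      using cd by (intro sum_mono mult_right_mono) auto
    finally show ?thesis unfolding XU quad_form_unitary_diag[OF U v] by simp
  qed
  thus ?thesis using c by blast
qed

definition frob :: "nat \<Rightarrow> (nat \<Rightarrow> nat \<Rightarrow> complex) \<Rightarrow> real" where
  "frob m D = L2_set (\<lambda>(i, j). cmod (D i j)) ({..<m} \<times> {..<m})"

lemma cmod_le_frob: "i < m \<Longrightarrow> j < m \<Longrightarrow> cmod (D i j) \<le> frob m D"
  unfolding frob_def
  by (rule order_trans[OF _ member_le_L2_set[of _ "(i, j)"]]) auto

text \<open>
  Pairing the equation with \<open>D\<close> in the Frobenius inner product, the term with \<open>X\<close> becomes a sum of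
  values of the form of \<open>X\<close> at the columns of \<open>D\<close>, which is nonnegative, and the term with \<open>Z\<close> becomes
  a sum of values of the form of \<open>Z\<close> at the conjugated rows of \<open>D\<close>, which is at least \<open>c\<close> times the
  squared norm of \<open>D\<close>. The Cauchy-Schwarz inequality bounds the sum from above. The constant depends
  on \<open>Z\<close> only, so the bound is uniform in \<open>X\<close>.
\<close>
lemma sylvester_bound:
  fixes D F :: "nat \<Rightarrow> nat \<Rightarrow> complex"
  assumes X: "X \<in> carrier_mat m m" "pos_def X" and Z: "Z \<in> carrier_mat m m"
    and c: "\<And>v. v \<in> carrier_vec m \<Longrightarrow> c * (\<Sum>i<m. (cmod (v $ i))\<^sup>2) \<le> Re ((Z *\<^sub>v v) \<bullet>c v)"
    and eq: "\<And>i j. i < m \<Longrightarrow> j < m \<Longrightarrow>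
      (\<Sum>l<m. X $$ (i, l) * D l j) + (\<Sum>l<m. D i l * Z $$ (l, j)) = F i j"
  shows "c * frob m D \<le> frob m F"
proof -
  have Xpos: "0 \<le> Re ((X *\<^sub>v v) \<bullet>c v)" if "v \<in> carrier_vec m" for v
  proof -
    obtain c' where c': "c' > 0" "c' * (\<Sum>i<m. (cmod (v $ i))\<^sup>2) \<le> Re ((X *\<^sub>v v) \<bullet>c v)"
      using pos_def_coercive[OF X] \<open>v \<in> carrier_vec m\<close> by blast
    have "0 \<le> c' * (\<Sum>i<m. (cmod (v $ i))\<^sup>2)" using c' by (simp add: sum_nonneg)
    thus ?thesis using c' by linarith
  qed
  define S where "S = (\<Sum>i<m. \<Sum>j<m. cnj (D i j) * F i j)"
  have "S = (\<Sum>i<m. \<Sum>j<m. \<Sum>l<m. cnj (D i j) * X $$ (i, l) * D l j)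
     + (\<Sum>i<m. \<Sum>j<m. \<Sum>l<m. cnj (D i j) * D i l * Z $$ (l, j))"
    unfolding S_def by (simp add: eq[symmetric] sum.distrib sum_distrib_left ring_distribs mult.assoc)
  also have "(\<Sum>i<m. \<Sum>j<m. \<Sum>l<m. cnj (D i j) * X $$ (i, l) * D l j) =
     (\<Sum>j<m. (X *\<^sub>v vec m (\<lambda>i. D i j)) \<bullet>c vec m (\<lambda>i. D i j))"
  proof (rule trans[OF sum.swap], rule sum.cong[OF refl])
    fix j assume "j \<in> {..<m}"
    show "(\<Sum>i<m. \<Sum>l<m. cnj (D i j) * X $$ (i, l) * D l j) =
      (X *\<^sub>v vec m (\<lambda>i. D i j)) \<bullet>c vec m (\<lambda>i. D i j)"
      by (subst quad_form_sum[OF X(1)]) (simp_all add: mult_ac)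
  qed
  also have "(\<Sum>i<m. \<Sum>j<m. \<Sum>l<m. cnj (D i j) * D i l * Z $$ (l, j)) =
     (\<Sum>i<m. (Z *\<^sub>v vec m (\<lambda>j. cnj (D i j))) \<bullet>c vec m (\<lambda>j. cnj (D i j)))"
  proof (rule sum.cong[OF refl])
    fix i assume "i \<in> {..<m}"
    show "(\<Sum>j<m. \<Sum>l<m. cnj (D i j) * D i l * Z $$ (l, j)) =
      (Z *\<^sub>v vec m (\<lambda>j. cnj (D i j))) \<bullet>c vec m (\<lambda>j. cnj (D i j))"
      by (rule trans[OF sum.swap], subst quad_form_sum[OF Z]) (simp_all add: mult_ac)
  qed
  finally have "Re S = (\<Sum>j<m. Re ((X *\<^sub>v vec m (\<lambda>i. D i j)) \<bullet>c vec m (\<lambda>i. D i j)))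
      + (\<Sum>i<m. Re ((Z *\<^sub>v vec m (\<lambda>j. cnj (D i j))) \<bullet>c vec m (\<lambda>j. cnj (D i j))))"
    by simp
  moreover have "(\<Sum>j<m. Re ((X *\<^sub>v vec m (\<lambda>i. D i j)) \<bullet>c vec m (\<lambda>i. D i j))) \<ge> 0"
    by (intro sum_nonneg Xpos) auto
  moreover have "(\<Sum>i<m. Re ((Z *\<^sub>v vec m (\<lambda>j. cnj (D i j))) \<bullet>c vec m (\<lambda>j. cnj (D i j))))
      \<ge> (\<Sum>i<m. c * (\<Sum>j<m. (cmod (D i j))\<^sup>2))"
    by (intro sum_mono order_trans[OF _ c]) auto
  moreover have "(\<Sum>i<m. c * (\<Sum>j<m. (cmod (D i j))\<^sup>2)) = c * (frob m D)\<^sup>2"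
    by (simp add: frob_def L2_set_def sum_nonneg sum.cartesian_product sum_distrib_left case_prod_unfold)
  ultimately have low: "c * (frob m D)\<^sup>2 \<le> Re S" by linarith
  have "S = (\<Sum>(i, j)\<in>{..<m} \<times> {..<m}. cnj (D i j) * F i j)"
    by (simp add: S_def sum.cartesian_product)
  hence "cmod S \<le> (\<Sum>(i, j)\<in>{..<m} \<times> {..<m}. \<bar>cmod (D i j)\<bar> * \<bar>cmod (F i j)\<bar>)"
    by (simp only:) (rule order_trans[OF norm_sum], auto simp: norm_mult intro!: sum_mono)
  also have "\<dots> \<le> frob m D * frob m F"
    unfolding frob_def case_prod_unfold by (rule L2_set_mult_ineq)
  finally have "Re S \<le> frob m D * frob m F"
    using complex_Re_le_cmod[of S] by linarith
  hence "(c * frob m D) * frob m D \<le> frob m F * frob m D"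
    using low by (simp add: power2_eq_square mult_ac)
  moreover have "frob m D \<ge> 0" "frob m F \<ge> 0" by (simp_all add: frob_def L2_set_nonneg)
  ultimately show ?thesis
    by (cases "frob m D = 0") (simp, metis mult_right_le_imp_le order_le_less)
qed

text \<open>
  If \<open>X\<^sup>2 = Z\<^sup>2\<close>, then \<open>X - Z\<close> solves the homogeneous Sylvester equation.
\<close>
lemma pos_def_sqrt_unique:
  assumes X: "X \<in> carrier_mat m m" "pos_def X" and Z: "Z \<in> carrier_mat m m" "pos_def Z"
    and eq: "X * X = Z * Z"
  shows "X = Z"
proof -
  obtain c where c: "c > 0" "\<And>v. v \<in> carrier_vec m \<Longrightarrow> c * (\<Sum>i<m. (cmod (v $ i))\<^sup>2) \<le> Re ((Z *\<^sub>v v) \<bullet>c v)"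
    using pos_def_coercive[OF Z] by blast
  define D where "D i j = X $$ (i, j) - Z $$ (i, j)" for i j
  have "c * frob m D \<le> frob m (\<lambda>i j. 0)"
  proof (rule sylvester_bound[OF X Z(1) c(2)])
    fix i j assume ij: "i < m" "j < m"
    have "(\<Sum>l<m. X $$ (i, l) * X $$ (l, j)) = (\<Sum>l<m. Z $$ (i, l) * Z $$ (l, j))"
      unfolding index_mult_sum[OF X(1) X(1) ij, symmetric] index_mult_sum[OF Z(1) Z(1) ij, symmetric] eq ..
    thus "(\<Sum>l<m. X $$ (i, l) * D l j) + (\<Sum>l<m. D i l * Z $$ (l, j)) = 0"
      by (simp add: D_def ring_distribs sum_subtractf)
  qed
  moreover have "frob m (\<lambda>i j. 0) = 0" by (simp add: frob_def L2_set_def case_prod_unfold)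
  ultimately have "frob m D \<le> 0" using c(1) by (simp add: mult_le_0_iff)
  have D0: "D i j = 0" if "i < m" "j < m" for i j
  proof -
    have "cmod (D i j) \<le> 0" using cmod_le_frob[OF that, of D] \<open>frob m D \<le> 0\<close> by linarith
    thus ?thesis by simp
  qed
  show ?thesis
  proof (rule eq_matI)
    fix i j assume "i < dim_row Z" "j < dim_col Z"
    thus "X $$ (i, j) = Z $$ (i, j)" using D0[of i j] Z by (simp add: D_def)
  qed (use X Z in auto)
qed

lemma pd_sqrt:
  assumes X: "X \<in> carrier_mat m m" "pos_def X"
  shows "pos_def (pd_sqrt X)" "pd_sqrt X * pd_sqrt X = X" "pd_sqrt X \<in> carrier_mat m m"
proof -
  obtain U d where U: "unitary_mat m U" and XU: "X = U * diag_real m d * mat_adjoint U"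
    and d: "\<forall>i<m. 0 < d i" using pos_def_spectral[OF X] by auto
  define Y where "Y = U * diag_real m (\<lambda>i. sqrt (d i)) * mat_adjoint U"
  have Y: "pos_def Y" unfolding Y_def by (rule pos_def_unitary_diag[OF U]) (use d in auto)
  have "diag_real m (\<lambda>i. sqrt (d i) * sqrt (d i)) = diag_real m d"
    using d by (intro eq_matI) (auto simp: diag_real_def less_imp_le)
  hence YY: "Y * Y = X" unfolding XU Y_def unitary_diag_mult[OF U] by (rule arg_cong)
  have carr: "Z \<in> carrier_mat m m" if "pos_def Z" "Z * Z = X" for Z
  proof -
    have "dim_row Z = m" using arg_cong[OF that(2), of dim_row] X(1) by simp
    moreover have "dim_col Z = m" using arg_cong[OF that(2), of dim_col] X(1) by simp
    ultimately show ?thesis by auto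
  qed
  have "\<exists>!Y. pos_def Y \<and> Y * Y = X"
  proof (rule ex1I[of _ Y])
    fix Z assume Z: "pos_def Z \<and> Z * Z = X"
    show "Z = Y"
      using pos_def_sqrt_unique[of Z m Y] Z Y YY carr[of Z] carr[of Y] by simp
  qed (use Y YY in simp)
  from theI'[OF this] show "pos_def (pd_sqrt X)" "pd_sqrt X * pd_sqrt X = X" by (simp_all add: pd_sqrt_def)
  thus "pd_sqrt X \<in> carrier_mat m m" by (rule carr)
qed

lemma pd_inv_sqrt:
  assumes X: "X \<in> carrier_mat m m" "pos_def X"
  shows "pd_inv_sqrt X \<in> carrier_mat m m" "pd_sqrt X * pd_inv_sqrt X = 1\<^sub>m m"
    "pd_inv_sqrt X * pd_sqrt X = 1\<^sub>m m" "mat_adjoint (pd_inv_sqrt X) = pd_inv_sqrt X"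
proof -
  note Y = pd_sqrt[OF X]
  obtain U d where U: "unitary_mat m U" and YU: "pd_sqrt X = U * diag_real m d * mat_adjoint U"
    and d: "\<forall>i<m. 0 < d i" using pos_def_spectral[OF Y(3,1)] by auto
  have Uc: "U \<in> carrier_mat m m" "mat_adjoint U \<in> carrier_mat m m" "U * mat_adjoint U = 1\<^sub>m m"
    using U by (auto simp: unitary_mat_def)
  \<comment> \<open>The inverse exists, so the Gauss-Jordan algorithm behind \<open>mat_inverse\<close> succeeds.\<close>
  define R where "R = U * diag_real m (\<lambda>i. 1 / d i) * mat_adjoint U"
  have R: "R \<in> carrier_mat m m" using Uc by (simp add: R_def)
  have one: "diag_real m f = 1\<^sub>m m" if "\<And>i. i < m \<Longrightarrow> f i = 1" for f
    using that by (intro eq_matI) (auto simp: diag_real_def)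
  have d1: "diag_real m (\<lambda>i. d i * (1 / d i)) = 1\<^sub>m m" "diag_real m (\<lambda>i. 1 / d i * d i) = 1\<^sub>m m"
    using d by (intro one; force)+
  have "pd_sqrt X * R = 1\<^sub>m m" "R * pd_sqrt X = 1\<^sub>m m"
    unfolding R_def YU unitary_diag_mult[OF U]
    using Uc by (simp_all only: d1) simp_all
  hence "pd_sqrt X \<in> Units (ring_mat TYPE(complex) m ())"
    using R Y(3) by (auto simp: Units_def ring_mat_def)
  then obtain B where "mat_inverse (pd_sqrt X) = Some B"
    using mat_inverse(1)[OF Y(3), of "()"] by (cases "mat_inverse (pd_sqrt X)") auto
  with mat_inverse(2)[OF Y(3) this] show
    c: "pd_inv_sqrt X \<in> carrier_mat m m" and i: "pd_sqrt X * pd_inv_sqrt X = 1\<^sub>m m"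
    "pd_inv_sqrt X * pd_sqrt X = 1\<^sub>m m" by (auto simp: pd_inv_sqrt_def)
  have ad1: "mat_adjoint (1\<^sub>m m) = (1\<^sub>m m :: complex mat)" by (intro eq_matI) auto
  have "mat_adjoint (pd_inv_sqrt X) * pd_sqrt X = mat_adjoint (pd_sqrt X * pd_inv_sqrt X)"
    using Y c by (simp add: adjoint_mult[of _ m m _ m] pos_def_def)
  hence "mat_adjoint (pd_inv_sqrt X) * pd_sqrt X = 1\<^sub>m m" using i ad1 by simp
  hence "mat_adjoint (pd_inv_sqrt X) * pd_sqrt X * pd_inv_sqrt X = pd_inv_sqrt X" using c by simp
  thus "mat_adjoint (pd_inv_sqrt X) = pd_inv_sqrt X"
    using c i Y by (simp add: assoc_mult_mat[of _ m m _ m _ m])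
qed

section \<open>Differentiability of square roots and inverses\<close>

lemma tendsto_frob_zero:
  assumes "\<And>i j. i < m \<Longrightarrow> j < m \<Longrightarrow> ((\<lambda>s. D s i j) \<longlongrightarrow> 0) F"
  shows "((\<lambda>s. frob m (D s)) \<longlongrightarrow> 0) F"
proof -
  have "((\<lambda>s. sqrt (\<Sum>p\<in>{..<m} \<times> {..<m}. (cmod (D s (fst p) (snd p)))\<^sup>2)) \<longlongrightarrow>
      sqrt (\<Sum>p\<in>{..<m} \<times> {..<m}. 0\<^sup>2)) F"
    by (intro tendsto_intros tendsto_norm_zero assms) auto
  thus ?thesis by (simp add: frob_def L2_set_def case_prod_unfold)
qed

lemma le_divide_of_mult_le:
  fixes a b c x :: real
  assumes "0 < c" "x \<le> a" "c * a \<le> b"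
  shows "x \<le> b / c"
proof -
  have "c * x \<le> b" using mult_left_mono[OF assms(2), of c] assms by linarith
  thus ?thesis by (simp add: pos_le_divide_eq[OF assms(1)] mult.commute)
qed

lemma has_vector_derivative_transform_nhds:
  fixes f g :: "real \<Rightarrow> complex"
  assumes "(f has_vector_derivative y) (at t)" "\<forall>\<^sub>F s in nhds t. f s = g s"
  shows "(g has_vector_derivative y) (at t)"
proof -
  have f: "(f has_derivative (\<lambda>h. h *\<^sub>R y)) (at t)" using assms(1) by (simp add: has_vector_derivative_def)
  have ev: "\<forall>\<^sub>F s in at t. f s = g s" using assms(2) by (auto simp: eventually_at_filter elim: eventually_mono)
  have "f t = g t" using assms(2) by (rule eventually_nhds_x_imp_x)
  hence "(g has_derivative (\<lambda>h. h *\<^sub>R y)) (at t)"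
    by (rule has_derivative_transform_eventually[OF f ev]) simp
  thus ?thesis by (simp add: has_vector_derivative_def)
qed

lemma differentiable_transform_nhds:
  fixes f g :: "real \<Rightarrow> complex"
  assumes "f differentiable (at t)" "\<forall>\<^sub>F s in nhds t. f s = g s"
  shows "g differentiable (at t)"
  using has_vector_derivative_transform_nhds[OF assms(1)[unfolded vector_derivative_works] assms(2)]
  by (rule differentiableI_vector)

text \<open>
  In an eigenbasis of \<open>X\<close> the equation decouples into the scalar equations
  \<open>(d\<^sub>i + d\<^sub>j) E\<^sub>i\<^sub>j = B\<^sub>i\<^sub>j\<close> with positive \<open>d\<^sub>i\<close>.
\<close>
lemma sylvester_solution:
  assumes X: "X \<in> carrier_mat m m" "pos_def X"
  shows "\<exists>Y. \<forall>i<m. \<forall>j<m. (\<Sum>l<m. X $$ (i, l) * Y l j) + (\<Sum>l<m. Y i l * X $$ (l, j)) = F i j"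
proof -
  obtain U d where U: "unitary_mat m U" and XU: "X = U * diag_real m d * mat_adjoint U"
    and d: "\<forall>i<m. 0 < d i" using pos_def_spectral[OF X] by auto
  have Uc: "U \<in> carrier_mat m m" "mat_adjoint U \<in> carrier_mat m m"
    and UU: "U * mat_adjoint U = 1\<^sub>m m" "mat_adjoint U * U = 1\<^sub>m m"
    using U by (auto simp: unitary_mat_def)
  define F' where "F' = mat m m (\<lambda>(i, j). F i j)"
  define B where "B = mat_adjoint U * F' * U"
  define E where "E = mat m m (\<lambda>(i, j). B $$ (i, j) / complex_of_real (d i + d j))"
  define Y where "Y = U * E * mat_adjoint U"
  let ?D = "diag_real m d"
  have F': "F' \<in> carrier_mat m m" by (simp add: F'_def)
  have c: "B \<in> carrier_mat m m" "E \<in> carrier_mat m m" "?D \<in> carrier_mat m m" "Y \<in> carrier_mat m m"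
    using Uc F' by (simp_all add: B_def E_def Y_def)
  note assoc = assoc_mult_mat[of _ m m _ m _ m]
  have DE: "?D * E + E * ?D = B"
  proof (rule eq_matI)
    fix i j assume "i < dim_row B" "j < dim_col B"
    hence ij: "i < m" "j < m" using c by auto
    have "(?D * E) $$ (i, j) = (\<Sum>l<m. ?D $$ (i, l) * E $$ (l, j))"
      using ij c by (intro index_mult_sum) auto
    also have "\<dots> = (\<Sum>l<m. if l = i then complex_of_real (d i) * E $$ (i, j) else 0)"
      using ij by (intro sum.cong) (auto simp: diag_real_def)
    finally have 1: "(?D * E) $$ (i, j) = complex_of_real (d i) * E $$ (i, j)" using ij by simp
    have "(E * ?D) $$ (i, j) = (\<Sum>l<m. E $$ (i, l) * ?D $$ (l, j))"
      using ij c by (intro index_mult_sum) auto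
    also have "\<dots> = (\<Sum>l<m. if l = j then E $$ (i, j) * complex_of_real (d j) else 0)"
      using ij by (intro sum.cong) (auto simp: diag_real_def)
    finally have 2: "(E * ?D) $$ (i, j) = E $$ (i, j) * complex_of_real (d j)" using ij by simp
    have "d i + d j > 0" using d ij by (simp add: add_pos_pos)
    hence nz: "complex_of_real (d i) + complex_of_real (d j) \<noteq> 0" by (metis of_real_add of_real_eq_0_iff less_irrefl)
    have "complex_of_real (d i) * E $$ (i, j) + E $$ (i, j) * complex_of_real (d j) = B $$ (i, j)"
    proof -
      have "E $$ (i, j) = B $$ (i, j) / (complex_of_real (d i) + complex_of_real (d j))"
        using ij by (simp add: E_def)
      hence "(complex_of_real (d i) + complex_of_real (d j)) * E $$ (i, j) = B $$ (i, j)" using nz by simp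
      thus ?thesis by (simp only: ring_distribs mult.commute[of "E $$ (i, j)"])
    qed
    thus "(?D * E + E * ?D) $$ (i, j) = B $$ (i, j)" using 1 2 ij c carrier_matD[OF c(3)] by simp
  qed (use c carrier_matD[OF c(3)] in auto)
  have "X * Y = U * ?D * (mat_adjoint U * U) * E * mat_adjoint U"
    unfolding XU Y_def using Uc c by (simp add: assoc del: UU)
  hence XY: "X * Y = U * (?D * E) * mat_adjoint U" using Uc c UU by (simp add: assoc)
  have "Y * X = U * E * (mat_adjoint U * U) * ?D * mat_adjoint U"
    unfolding XU Y_def using Uc c by (simp add: assoc del: UU)
  hence YX: "Y * X = U * (E * ?D) * mat_adjoint U" using Uc c UU by (simp add: assoc)
  have "X * Y + Y * X = U * (?D * E + E * ?D) * mat_adjoint U"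
    unfolding XY YX using Uc c
    by (simp add: mult_add_distrib_mat[of _ m m _ m] add_mult_distrib_mat[of _ m m _ _ m])
  also have "\<dots> = (U * mat_adjoint U) * F' * (U * mat_adjoint U)"
    unfolding DE B_def using Uc F' by (simp add: assoc del: UU)
  also have "\<dots> = F'" using F' UU by simp
  finally have sol: "X * Y + Y * X = F'" .
  have "(\<Sum>l<m. X $$ (i, l) * Y $$ (l, j)) + (\<Sum>l<m. Y $$ (i, l) * X $$ (l, j)) = F i j"
    if ij: "i < m" "j < m" for i j
  proof -
    have "(X * Y + Y * X) $$ (i, j) = (X * Y) $$ (i, j) + (Y * X) $$ (i, j)"
      using ij X c by simp
    thus ?thesis using ij X c
      by (simp add: sol index_mult_sum[of _ m m _ m] F'_def del: index_mult_mat)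
  qed
  thus ?thesis by (intro exI[of _ "\<lambda>i j. Y $$ (i, j)"]) auto
qed

lemma has_vector_derivative_iff_quotient:
  fixes f :: "real \<Rightarrow> complex"
  shows "(f has_vector_derivative y) (at t) \<longleftrightarrow>
    ((\<lambda>s. (f s - f t) / complex_of_real (s - t) - y) \<longlongrightarrow> 0) (at t)"
proof -
  have "\<forall>\<^sub>F s in at t. norm (f s - f t - (s - t) *\<^sub>R y) / norm (s - t) =
     norm ((f s - f t) / complex_of_real (s - t) - y)"
  proof (rule eventually_at_filter[THEN iffD2], rule always_eventually, intro allI impI)
    fix s :: real assume "s \<noteq> t"
    hence "(f s - f t) / complex_of_real (s - t) - y =
        (f s - f t - (s - t) *\<^sub>R y) / complex_of_real (s - t)"
      by (simp add: diff_divide_distrib scaleR_conv_of_real del: of_real_diff)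
    thus "norm (f s - f t - (s - t) *\<^sub>R y) / norm (s - t) =
        norm ((f s - f t) / complex_of_real (s - t) - y)"
      by (simp add: norm_divide del: of_real_diff)
  qed
  from tendsto_cong[OF this, of 0] show ?thesis
    unfolding has_vector_derivative_def has_derivative_iff_norm
    by (simp add: bounded_linear_scaleR_left tendsto_norm_zero_iff del: of_real_diff)
qed

text \<open>
  Put \<open>D = X(s) - X(t)\<close> for the square roots \<open>X\<close> of \<open>H\<close>. Since \<open>X(s) D + D X(t) = H(s) - H(t)\<close>, the
  Sylvester bound gives \<open>D \<rightarrow> 0\<close>. The candidate derivative \<open>Y\<close> is the solution of
  \<open>X(t) Y + Y X(t) = H'(t)\<close>; the error \<open>E = D / (s - t) - Y\<close> of the difference quotient solves a Sylvester
  equation with the right-hand side \<open>(H(s) - H(t)) / (s - t) - H'(t) - D Y\<close>, which tends to \<open>0\<close>, and the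
  same bound applies.
\<close>
lemma pd_sqrt_differentiable:
  fixes H :: "real \<Rightarrow> complex mat"
  assumes H: "\<And>s. H s \<in> carrier_mat m m" and pd: "\<forall>\<^sub>F s in nhds t. pos_def (H s)"
    and d: "\<And>i j. i < m \<Longrightarrow> j < m \<Longrightarrow> (\<lambda>s. H s $$ (i, j)) differentiable (at t)"
    and ij: "i < m" "j < m"
  shows "(\<lambda>s. pd_sqrt (H s) $$ (i, j)) differentiable (at t)"
proof -
  define X where "X s = pd_sqrt (H s)" for s
  have pdt: "pos_def (H t)" using pd by (rule eventually_nhds_x_imp_x)
  have pdat: "\<forall>\<^sub>F s in at t. pos_def (H s) \<and> s \<noteq> t"
    using pd by (auto simp: eventually_at_filter elim: eventually_mono)
  have X: "X s \<in> carrier_mat m m" "pos_def (X s)" "X s * X s = H s" if "pos_def (H s)" for s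
    using pd_sqrt[OF H that] by (simp_all add: X_def)
  have XX: "(\<Sum>l<m. X s $$ (i, l) * X s $$ (l, j)) = H s $$ (i, j)"
    if "pos_def (H s)" "i < m" "j < m" for s i j
    using X[OF that(1)] that(2,3) by (simp flip: index_mult_sum[of _ m m _ m])
  obtain c where c: "c > 0"
    "\<And>v. v \<in> carrier_vec m \<Longrightarrow> c * (\<Sum>i<m. (cmod (v $ i))\<^sup>2) \<le> Re ((X t *\<^sub>v v) \<bullet>c v)"
    using pos_def_coercive[OF X(1,2)[OF pdt]] by blast
  \<comment> \<open>The entries of \<open>Y\<close> are going to be the derivatives of the entries of \<open>X\<close>.\<close>
  define H' where "H' i j = vector_derivative (\<lambda>s. H s $$ (i, j)) (at t)" for i j
  obtain Y where Y: "\<And>i j. i < m \<Longrightarrow> j < m \<Longrightarrow>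
      (\<Sum>l<m. X t $$ (i, l) * Y l j) + (\<Sum>l<m. Y i l * X t $$ (l, j)) = H' i j"
    using sylvester_solution[OF X(1,2)[OF pdt], of H'] by blast
  define D where "D s i j = X s $$ (i, j) - X t $$ (i, j)" for s i j
  have D0: "((\<lambda>s. D s i j) \<longlongrightarrow> 0) (at t)" if ij: "i < m" "j < m" for i j
  proof (rule Lim_null_comparison)
    show "\<forall>\<^sub>F s in at t. norm (D s i j) \<le> frob m (\<lambda>i j. H s $$ (i, j) - H t $$ (i, j)) / c"
      using pdat
    proof eventually_elim
      case (elim s)
      have "c * frob m (D s) \<le> frob m (\<lambda>i j. H s $$ (i, j) - H t $$ (i, j))"
      proof (rule sylvester_bound[OF X(1,2) X(1)[OF pdt] c(2)])
        fix i j assume ij: "i < m" "j < m"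
        show "(\<Sum>l<m. X s $$ (i, l) * D s l j) + (\<Sum>l<m. D s i l * X t $$ (l, j)) = H s $$ (i, j) - H t $$ (i, j)"
          using XX[of s i j] XX[OF pdt, of i j] elim ij
          by (simp add: D_def ring_distribs sum_subtractf)
      qed (use elim in auto)
      thus ?case by (rule le_divide_of_mult_le[OF c(1) cmod_le_frob[OF ij, of "D s"]])
    qed
    have "((\<lambda>s. frob m (\<lambda>i j. H s $$ (i, j) - H t $$ (i, j))) \<longlongrightarrow> 0) (at t)"
    proof (rule tendsto_frob_zero)
      fix i j assume "i < m" "j < m"
      hence "isCont (\<lambda>s. H s $$ (i, j)) t" using d differentiable_imp_continuous_within by blast
      thus "((\<lambda>s. H s $$ (i, j) - H t $$ (i, j)) \<longlongrightarrow> 0) (at t)"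
        by (simp add: isCont_def LIM_zero)
    qed
    thus "((\<lambda>s. frob m (\<lambda>i j. H s $$ (i, j) - H t $$ (i, j)) / c) \<longlongrightarrow> 0) (at t)"
      by (rule tendsto_divide_zero)
  qed
  define E where "E s i j = D s i j / complex_of_real (s - t) - Y i j" for s i j
  define G where "G s i j = (H s $$ (i, j) - H t $$ (i, j)) / complex_of_real (s - t) - H' i j
      - (\<Sum>l<m. D s i l * Y l j)" for s i j
  have "((\<lambda>s. E s i j) \<longlongrightarrow> 0) (at t)"
  proof (rule Lim_null_comparison)
    show "\<forall>\<^sub>F s in at t. norm (E s i j) \<le> frob m (G s) / c"
      using pdat
    proof eventually_elim
      case (elim s)
      have "c * frob m (E s) \<le> frob m (G s)"
      proof (rule sylvester_bound[OF X(1,2) X(1)[OF pdt] c(2)])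
        fix i j assume ij: "i < m" "j < m"
        let ?h = "complex_of_real (s - t)"
        have "(\<Sum>l<m. X s $$ (i, l) * E s l j) + (\<Sum>l<m. E s i l * X t $$ (l, j)) =
          ((\<Sum>l<m. X s $$ (i, l) * D s l j) + (\<Sum>l<m. D s i l * X t $$ (l, j))) / ?h
          - ((\<Sum>l<m. X s $$ (i, l) * Y l j) + (\<Sum>l<m. Y i l * X t $$ (l, j)))"
          by (simp add: E_def ring_distribs sum_subtractf sum_divide_distrib add_divide_distrib)
        also have "(\<Sum>l<m. X s $$ (i, l) * D s l j) + (\<Sum>l<m. D s i l * X t $$ (l, j)) = H s $$ (i, j) - H t $$ (i, j)"
          using XX[of s i j] XX[OF pdt, of i j] elim ij
          by (simp add: D_def ring_distribs sum_subtractf)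
        also have "(\<Sum>l<m. X s $$ (i, l) * Y l j) + (\<Sum>l<m. Y i l * X t $$ (l, j)) =
          H' i j + (\<Sum>l<m. D s i l * Y l j)"
          unfolding Y[OF ij, symmetric] by (simp add: D_def ring_distribs sum_subtractf)
        finally show "(\<Sum>l<m. X s $$ (i, l) * E s l j) + (\<Sum>l<m. E s i l * X t $$ (l, j)) = G s i j"
          by (simp add: G_def)
      qed (use elim in auto)
      thus ?case by (rule le_divide_of_mult_le[OF c(1) cmod_le_frob[OF ij, of "E s"]])
    qed
    have "((\<lambda>s. frob m (G s)) \<longlongrightarrow> 0) (at t)"
    proof (rule tendsto_frob_zero)
      fix i j assume ij: "i < m" "j < m"
      have "((\<lambda>s. \<Sum>l<m. D s i l * Y l j) \<longlongrightarrow> (\<Sum>l<m. 0 * Y l j)) (at t)"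
        using ij by (intro tendsto_intros D0) auto
      from tendsto_diff[OF d[OF ij, unfolded vector_derivative_works has_vector_derivative_iff_quotient] this]
      show "((\<lambda>s. G s i j) \<longlongrightarrow> 0) (at t)" by (simp add: G_def H'_def)
    qed
    thus "((\<lambda>s. frob m (G s) / c) \<longlongrightarrow> 0) (at t)"
      by (rule tendsto_divide_zero)
  qed
  hence "((\<lambda>s. X s $$ (i, j)) has_vector_derivative Y i j) (at t)"
    unfolding has_vector_derivative_iff_quotient E_def D_def .
  thus ?thesis unfolding X_def by (rule differentiableI_vector)
qed

lemma differentiable_prod:
  fixes f :: "'i \<Rightarrow> real \<Rightarrow> complex"
  assumes "\<And>i. i \<in> I \<Longrightarrow> f i differentiable (at t)"
  shows "(\<lambda>s. \<Prod>i\<in>I. f i s) differentiable (at t)"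
  using assms by (induction I rule: infinite_finite_induct) auto

lemma det_differentiable:
  fixes M :: "real \<Rightarrow> complex mat"
  assumes "\<And>s. M s \<in> carrier_mat m m"
    and "\<And>i j. i < m \<Longrightarrow> j < m \<Longrightarrow> (\<lambda>s. M s $$ (i, j)) differentiable (at t)"
  shows "(\<lambda>s. det (M s)) differentiable (at t)"
proof -
  have "(\<lambda>s. det (M s)) = (\<lambda>s. \<Sum>p\<in>{p. p permutes {0..<m}}. signof p * (\<Prod>i=0..<m. M s $$ (i, p i)))"
    by (simp add: Determinant.det_def'[OF assms(1)])
  moreover have "(\<lambda>s. \<Prod>i=0..<m. M s $$ (i, p i)) differentiable (at t)" if "p permutes {0..<m}" for p
    using that permutes_in_image[OF that] by (intro differentiable_prod assms) auto
  ultimately show ?thesis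
    by (auto intro!: differentiable_sum differentiable_mult finite_permutations)
qed

text \<open>
  By Cramer's rule the entries of the inverse are quotients of determinants.
\<close>
lemma inverse_differentiable:
  fixes M R :: "real \<Rightarrow> complex mat"
  assumes M: "\<forall>\<^sub>F s in nhds t. M s \<in> carrier_mat m m \<and> R s \<in> carrier_mat m m \<and> M s * R s = 1\<^sub>m m"
    and d: "\<And>i j. i < m \<Longrightarrow> j < m \<Longrightarrow> (\<lambda>s. M s $$ (i, j)) differentiable (at t)"
    and ij: "i < m" "j < m"
  shows "(\<lambda>s. R s $$ (i, j)) differentiable (at t)"
proof -
  define N where "N s = mat m m (\<lambda>ij. M s $$ ij)" for s
  have N: "N s \<in> carrier_mat m m" for s by (simp add: N_def)
  have dN: "(\<lambda>s. N s $$ (i, j)) differentiable (at t)" if "i < m" "j < m" for i j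
    using d that by (simp add: N_def)
  have NM: "N s = M s" if "M s \<in> carrier_mat m m" for s
    using that by (intro eq_matI) (auto simp: N_def)
  have eq: "R s $$ (i, j) = cofactor (N s) j i / det (N s)"
    and nz: "det (N s) \<noteq> 0"
    if s: "M s \<in> carrier_mat m m" "R s \<in> carrier_mat m m" "M s * R s = 1\<^sub>m m" for s
  proof -
    have "det (M s) * det (R s) = 1" using s det_mult[of "M s" m "R s"] by simp
    thus nz: "det (N s) \<noteq> 0" using NM s by auto
    have "adj_mat (M s) = adj_mat (M s) * (M s * R s)" using s adj_mat(1)[OF s(1)] by simp
    also have "\<dots> = det (M s) \<cdot>\<^sub>m R s"
      using s adj_mat[OF s(1)] assoc_mult_mat[of "adj_mat (M s)" m m "M s" m "R s" m, symmetric] 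
        mult_smult_assoc_mat[of "1\<^sub>m m :: complex mat" m m "R s" m]
      by simp
    finally have "adj_mat (M s) $$ (i, j) = det (M s) * R s $$ (i, j)" using s ij by simp
    hence "cofactor (M s) j i = det (M s) * R s $$ (i, j)" using s ij by (simp add: adj_mat_def)
    thus "R s $$ (i, j) = cofactor (N s) j i / det (N s)" using nz NM s by simp
  qed
  have "(\<lambda>s. cofactor (N s) j i) differentiable (at t)"
  proof -
    have c: "mat_delete (N s) j i \<in> carrier_mat (m - 1) (m - 1)" for s
      using mat_delete_carrier[OF N] by simp
    have "(\<lambda>s. det (mat_delete (N s) j i)) differentiable (at t)"
    proof (rule det_differentiable[OF c])
      fix a b assume ab: "a < m - 1" "b < m - 1"
      have "(\<lambda>s. mat_delete (N s) j i $$ (a, b)) =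
        (\<lambda>s. N s $$ (if a < j then a else Suc a, if b < i then b else Suc b))"
        using ab carrier_matD[OF N] by (auto simp: mat_delete_def fun_eq_iff)
      thus "(\<lambda>s. mat_delete (N s) j i $$ (a, b)) differentiable (at t)"
        using ab by (auto intro!: dN)
    qed
    thus ?thesis by (simp add: cofactor_def)
  qed
  moreover have "(\<lambda>s. det (N s)) differentiable (at t)" by (rule det_differentiable[OF N dN])
  moreover have "det (N t) \<noteq> 0" using nz[of t] eventually_nhds_x_imp_x[OF M] by blast
  ultimately have "(\<lambda>s. cofactor (N s) j i / det (N s)) differentiable (at t)"
    by (intro differentiable_divide)
  thus ?thesis
    by (rule differentiable_transform_nhds) (rule eventually_mono[OF M], use eq in auto)
qed

section \<open>Pseudoreflexion coefficients and the three-term recurrence\<close>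

locale verblunsky =
  fixes n :: nat and \<alpha> :: "nat \<Rightarrow> complex" and \<tau>n \<zeta> w :: complex
  assumes norm_alpha: "j < n \<Longrightarrow> cmod (\<alpha> j) < 1"
    and norm_tau_n: "cmod \<tau>n = 1" and norm_zeta: "cmod \<zeta> = 1" and w_square: "w\<^sup>2 = \<zeta>"
begin

abbreviation T :: "nat \<Rightarrow> complex" where "T \<equiv> tau n \<alpha> \<tau>n \<zeta>"
abbreviation b :: "nat \<Rightarrow> complex" where "b \<equiv> beta n \<alpha> \<tau>n \<zeta> w"
text \<open>
  The rotated coefficients \<open>a\<^sub>j = cnj \<tau>\<^sub>j \<alpha>\<^sub>j\<close>: in terms of them \<open>\<beta>\<^sub>j\<close> and the numbers \<open>r\<^sub>j\<close> below have closed
  forms.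
\<close>
definition a :: "nat \<Rightarrow> complex" where "a j = cnj (T j) * \<alpha> j"

lemma norm_w: "cmod w = 1"
proof -
  have "(cmod w)\<^sup>2 = 1" using arg_cong[OF w_square, of cmod] norm_zeta by (simp add: norm_power)
  thus ?thesis by (simp add: abs_square_eq_1)
qed

lemma cnj_zeta_mult [simp]: "cnj \<zeta> * \<zeta> = 1" "\<zeta> * cnj \<zeta> = 1"
  using norm_zeta complex_norm_square[of \<zeta>] by (auto simp: mult.commute)

lemma cnj_w_mult [simp]: "cnj w * w = 1" "w * cnj w = 1"
  using norm_w complex_norm_square[of w] by (auto simp: mult.commute)

lemma zeta_eq: "\<zeta> = w * w" "cnj \<zeta> = cnj w * cnj w"
  using w_square by (auto simp: power2_eq_square)

lemma tau_step:
  assumes "j < n"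
  shows "T j = (cnj \<zeta> * \<alpha> j + T (Suc j)) / (cnj (\<alpha> j) * T (Suc j) + cnj \<zeta>)"
  using assms by (subst tau.simps) simp

lemma tau_denominator:
  assumes "j < n" "cmod (T (Suc j)) = 1"
  shows "cnj (\<alpha> j) * T (Suc j) + cnj \<zeta> \<noteq> 0"
proof
  assume "cnj (\<alpha> j) * T (Suc j) + cnj \<zeta> = 0"
  hence "cnj \<zeta> = - (cnj (\<alpha> j) * T (Suc j))" by (simp add: eq_neg_iff_add_eq_0 add.commute)
  hence "cmod (cnj \<zeta>) = cmod (cnj (\<alpha> j) * T (Suc j))" by (metis norm_minus_cancel)
  thus False using assms norm_alpha[of j] norm_zeta by (simp add: norm_mult)
qed

text \<open>
  Numerator and denominator of \<open>\<tau>\<^sub>j\<close> have the same modulus: the denominator is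
  \<open>\<tau>\<^sub>j\<^sub>+\<^sub>1 cnj \<zeta>\<close> times the conjugate of the numerator.
\<close>
lemma norm_tau:
  assumes "j \<le> n"
  shows "cmod (T j) = 1"
  using assms
proof (induction rule: inc_induct)
  case base
  show ?case using norm_tau_n by (subst tau.simps) simp
next
  case (step j)
  let ?t = "T (Suc j)"
  have t: "?t * cnj ?t = 1" using step.IH complex_norm_square[of ?t] by simp
  have "cnj (\<alpha> j) * ?t + cnj \<zeta> = ?t * cnj \<zeta> * cnj (cnj \<zeta> * \<alpha> j + ?t)"
    using t cnj_zeta_mult by (simp add: algebra_simps)
  hence e: "cmod (cnj (\<alpha> j) * ?t + cnj \<zeta>) = cmod (cnj \<zeta> * \<alpha> j + ?t)"
    using step.IH norm_zeta by (simp only: norm_mult complex_mod_cnj mult_1)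
  have j: "j < n" using step by auto
  have nz: "cmod (cnj (\<alpha> j) * ?t + cnj \<zeta>) \<noteq> 0" using tau_denominator[OF j step.IH] unfolding norm_eq_zero .
  show ?case unfolding tau_step[OF j] norm_divide e[symmetric] by (rule divide_self[OF nz])
qed

lemma tau_unit [simp]:
  assumes "j \<le> n"
  shows "cnj (T j) * T j = 1" "T j * cnj (T j) = 1"
  using norm_tau[OF assms] complex_norm_square[of "T j"] by (auto simp: mult.commute)

lemma tau_cross:
  assumes "j < n"
  shows "T j * (cnj \<zeta> + T (Suc j) * cnj (\<alpha> j)) = cnj \<zeta> * \<alpha> j + T (Suc j)"
  using tau_step[OF assms] tau_denominator[OF assms norm_tau[of "Suc j"]] assms
  by (simp add: nonzero_eq_divide_eq mult.commute add.commute)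

text \<open>
  This is the Moebius recursion for \<open>\<tau>\<^sub>j\<close> without denominators, with the terms in \<open>\<tau>\<^sub>j\<^sub>+\<^sub>1\<close> collected, so that
  \<open>\<tau>\<^sub>j\<^sub>+\<^sub>1\<close> can be eliminated.
\<close>
lemma tau_difference:
  assumes "j < n"
  shows "T (Suc j) * (1 - T j * cnj (\<alpha> j)) = cnj \<zeta> * (T j - \<alpha> j)"
  using tau_cross[OF assms] by (simp add: algebra_simps)

lemma cnj_one_minus_a: "cnj (1 - a j) = 1 - T j * cnj (\<alpha> j)"
  by (simp add: a_def)

lemma norm_a:
  assumes "j < n"
  shows "cmod (a j) = cmod (\<alpha> j)"
  using assms norm_tau[of j] by (simp add: a_def norm_mult)

lemma one_minus_a_nonzero:
  assumes "j < n"
  shows "1 - a j \<noteq> 0" "cnj (1 - a j) \<noteq> 0"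
proof -
  show "1 - a j \<noteq> 0" using norm_a[OF assms] norm_alpha[OF assms] by auto
  thus "cnj (1 - a j) \<noteq> 0" using complex_cnj_zero_iff by blast
qed

lemma tau_ratio:
  assumes "j < n"
  shows "T (Suc j) * cnj (1 - a j) = cnj \<zeta> * T j * (1 - a j)"
proof -
  have "T j * (1 - a j) = T j - \<alpha> j"
    using tau_unit(2)[of j] assms by (simp add: a_def algebra_simps)
  thus ?thesis using tau_difference[OF assms] unfolding cnj_one_minus_a mult.assoc by simp
qed

lemma tau_sum_factor:
  assumes "j < n"
  shows "(cnj \<zeta> + T (Suc j) * cnj (\<alpha> j)) * cnj (1 - a j) = cnj \<zeta> * (1 - \<alpha> j * cnj (\<alpha> j))"
proof -
  have "(cnj \<zeta> + T (Suc j) * cnj (\<alpha> j)) * cnj (1 - a j) =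
     cnj \<zeta> * (1 - T j * cnj (\<alpha> j)) + cnj (\<alpha> j) * (T (Suc j) * (1 - T j * cnj (\<alpha> j)))"
    unfolding cnj_one_minus_a by (simp add: algebra_simps)
  also have "\<dots> = cnj \<zeta> * (1 - T j * cnj (\<alpha> j)) + cnj (\<alpha> j) * (cnj \<zeta> * (T j - \<alpha> j))"
    by (simp only: tau_difference[OF assms])
  finally show ?thesis by (simp add: algebra_simps)
qed

text \<open>
  The numbers \<open>r\<^sub>j\<close> are the ratios of consecutive terms of the sequence \<open>w\<^sup>-\<^sup>j p\<^sub>j(\<zeta>)\<close>, which is real
  because the recurrence at the point \<open>z = \<zeta>\<close> reads \<open>u\<^sub>j\<^sub>+\<^sub>1 = 2 Re (w cnj \<beta>\<^sub>j) u\<^sub>j - u\<^sub>j\<^sub>-\<^sub>1\<close>. Their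
  halves are the pivots of Gaussian elimination applied to \<open>H\<close>.
\<close>
fun r :: "nat \<Rightarrow> real" where
  "r 0 = 1"
| "r (Suc j) = (1 - (cmod (a j))\<^sup>2) / ((cmod (1 - a j))\<^sup>2 * r j)"

lemma r_pos:
  assumes "j \<le> n"
  shows "0 < r j"
  using assms
proof (induction j)
  case (Suc j)
  hence "cmod (a j) < 1" using norm_a norm_alpha by simp
  hence "(cmod (a j))\<^sup>2 < 1" by (simp add: abs_square_less_1)
  moreover have "cmod (1 - a j) > 0" using one_minus_a_nonzero(1)[of j] Suc by simp
  ultimately show ?case using Suc by simp
qed simp

end

text \<open>
  The condition \<open>\<tau>\<^sub>0 \<zeta> \<noteq> 1\<close> says that the denominator of \<open>\<beta>\<^sub>0\<close> does not vanish. It holds whenever \<open>\<zeta>\<close>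
  is not an eigenvalue of \<open>G\<close>, by \<open>not_eigenvalue_imp_regular\<close> below.
\<close>
locale verblunsky_regular = verblunsky +
  assumes zeta_regular: "T 0 * \<zeta> \<noteq> 1"
begin

lemma beta_0_identities: "b 0 * (cnj \<zeta> - T 0) = cnj w" "w * cnj (b 0) * (1 - cnj (T 0 * \<zeta>)) = 1" "b 0 = - cnj (b 0) * cnj (T 0)"
  "cnj w - T 0 * w \<noteq> 0"
proof -
  have iw: "1 / w = cnj w" using cnj_w_mult(1) norm_w by (subst divide_eq_eq) auto
  have e: "cnj w * (cnj w - T 0 * w) = cnj \<zeta> - T 0"
    using cnj_w_mult by (simp add: zeta_eq algebra_simps)
  have "cnj \<zeta> - T 0 \<noteq> 0"
  proof
    assume "cnj \<zeta> - T 0 = 0"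
    hence "T 0 * \<zeta> = cnj \<zeta> * \<zeta>" by simp
    thus False using zeta_regular by simp
  qed
  thus nz: "cnj w - T 0 * w \<noteq> 0" using e by auto
  have b0: "b 0 = 1 / (cnj w - T 0 * w)" by (simp add: iw)
  show "b 0 * (cnj \<zeta> - T 0) = cnj w" unfolding b0 e[symmetric] using nz by simp
  have nz': "w - cnj (T 0) * cnj w \<noteq> 0" using nz by (metis complex_cnj_cnj complex_cnj_diff complex_cnj_mult complex_cnj_zero)
  have cb0: "cnj (b 0) = 1 / (w - cnj (T 0) * cnj w)" unfolding b0 by simp
  have "w * (1 - cnj (T 0 * \<zeta>)) = w - cnj (T 0) * cnj w"
    using cnj_w_mult by (simp add: zeta_eq algebra_simps)
  hence "cnj (b 0) * (w * (1 - cnj (T 0 * \<zeta>))) = 1" unfolding cb0 using nz' by simp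
  thus "w * cnj (b 0) * (1 - cnj (T 0 * \<zeta>)) = 1" by (simp only: mult_ac)
  have "w - cnj (T 0) * cnj w = - cnj (T 0) * (cnj w - T 0 * w)"
    using tau_unit(1)[of 0] by (simp add: algebra_simps)
  thus "b 0 = - cnj (b 0) * cnj (T 0)" unfolding cb0 b0
    using nz nz' by (simp add: field_simps)
qed

text \<open>
  Here \<open>w cnj \<beta>\<^sub>0 = 1 / (1 - u)\<close> with \<open>u\<close> on the unit circle, and \<open>u \<mapsto> 1 / (1 - u)\<close> maps
  the circle without \<open>1\<close> to the line of real part \<open>1/2\<close>.
\<close>
lemma Re_w_cnj_beta_0: "2 * Re (w * cnj (b 0)) = 1"
proof -
  define u where "u = cnj (T 0 * \<zeta>)"
  have "cmod u = 1" using norm_tau[of 0] norm_zeta by (simp add: u_def norm_mult)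
  hence u: "(Re u)\<^sup>2 + (Im u)\<^sup>2 = 1" by (simp add: cmod_power2[symmetric])
  have e: "w * cnj (b 0) = 1 / (1 - u)" using beta_0_identities(2) unfolding u_def
    by (subst eq_divide_eq) auto
  have "1 - u \<noteq> 0" using beta_0_identities(2) unfolding u_def by auto
  hence nz: "(1 - Re u)\<^sup>2 + (Im u)\<^sup>2 \<noteq> 0" by (simp add: complex_eq_iff sum_power2_eq_zero_iff)
  have "Re (1 / (1 - u)) = (1 - Re u) / ((1 - Re u)\<^sup>2 + (Im u)\<^sup>2)"
    by (simp add: Re_divide)
  also have "(1 - Re u)\<^sup>2 + (Im u)\<^sup>2 = 2 * (1 - Re u)" using u by (simp add: power2_eq_square algebra_simps)
  finally show ?thesis using nz e \<open>(1 - Re u)\<^sup>2 + (Im u)\<^sup>2 = 2 * (1 - Re u)\<close> by simp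
qed

text \<open>
  The definition divides by \<open>\<beta>\<^sub>j\<close> and by \<open>cnj \<zeta> + \<tau>\<^sub>j cnj \<alpha>\<^sub>j\<^sub>-\<^sub>1\<close>. The product of these two factors is the
  invariant \<open>r\<^sub>j cnj w\<close>; once it is known for \<open>j\<close>, the closed form of \<open>\<beta>\<^sub>j\<^sub>+\<^sub>1\<close> can be read off, and
  \<open>tau_sum_factor\<close> turns it into the invariant for \<open>j + 1\<close>.
\<close>
lemma beta_closed_form:
  assumes "j \<le> n"
  shows "b j * (cnj \<zeta> + T j * cnj (if j = 0 then - 1 else \<alpha> (j - 1))) = complex_of_real (r j) * cnj w \<and>
    (j \<noteq> 0 \<longrightarrow> b j = w / (complex_of_real (r (j - 1)) * (1 - a (j - 1))))"
  using assms
proof (induction j)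
  case 0
  show ?case using beta_0_identities(1) by (simp del: beta.simps)
next
  case (Suc j)
  let ?s = "cnj \<zeta> + T j * cnj (if j = 0 then - 1 else \<alpha> (j - 1))"
  have j: "j < n" using Suc by simp
  have IH: "b j * ?s = complex_of_real (r j) * cnj w" using Suc by simp
  have rj: "complex_of_real (r j) \<noteq> 0" using r_pos[of j] j by simp
  note nz = one_minus_a_nonzero[OF j]
  have wn: "w \<noteq> 0" using norm_w by auto
  have "b (Suc j) = 1 / (b j * ?s * (1 - a j))" by (simp add: a_def)
  also have "\<dots> = w / (complex_of_real (r j) * (1 - a j))"
    unfolding IH using cnj_w_mult rj nz wn by (simp add: divide_simps)
  finally have bS: "b (Suc j) = w / (complex_of_real (r j) * (1 - a j))" .
  have "complex_of_real ((cmod (1 - a j))\<^sup>2) = (1 - a j) * cnj (1 - a j)" by (rule complex_norm_square)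
  moreover have "complex_of_real (1 - (cmod (a j))\<^sup>2) = 1 - \<alpha> j * cnj (\<alpha> j)"
    unfolding norm_a[OF j] of_real_diff complex_norm_square by simp
  ultimately have rS: "complex_of_real (r (Suc j)) =
      (1 - \<alpha> j * cnj (\<alpha> j)) / ((1 - a j) * cnj (1 - a j) * complex_of_real (r j))"
    by (simp only: r.simps of_real_divide of_real_mult)
  have "(cnj \<zeta> + T (Suc j) * cnj (\<alpha> j)) = cnj \<zeta> * (1 - \<alpha> j * cnj (\<alpha> j)) / cnj (1 - a j)"
    using tau_sum_factor[OF j] by (simp only: nonzero_eq_divide_eq[OF nz(2)])
  hence "b (Suc j) * (cnj \<zeta> + T (Suc j) * cnj (\<alpha> j)) =
      (w * cnj \<zeta>) * ((1 - \<alpha> j * cnj (\<alpha> j)) / ((1 - a j) * cnj (1 - a j) * complex_of_real (r j)))"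
    unfolding bS by (simp only: times_divide_times_eq times_divide_eq_right times_divide_eq_left divide_divide_eq_left mult_ac)
  also have "w * cnj \<zeta> = cnj w" using cnj_w_mult(2) by (simp add: zeta_eq flip: mult.assoc)
  finally have "b (Suc j) * (cnj \<zeta> + T (Suc j) * cnj (\<alpha> j)) = complex_of_real (r (Suc j)) * cnj w"
    unfolding rS by (simp only: mult.commute)
  thus ?case using bS by (simp del: beta.simps r.simps)
qed

lemma beta_Suc_closed_form:
  assumes "j < n"
  shows "b (Suc j) = w / (complex_of_real (r j) * (1 - a j))"
  using beta_closed_form[of "Suc j"] assms by (simp del: beta.simps r.simps)

lemma beta_Suc_sum:
  assumes "j < n"
  shows "cnj (b (Suc j)) * (\<zeta> + cnj (T (Suc j)) * \<alpha> j) = complex_of_real (r (Suc j)) * w"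
proof -
  have "b (Suc j) * (cnj \<zeta> + T (Suc j) * cnj (\<alpha> j)) = complex_of_real (r (Suc j)) * cnj w"
    using beta_closed_form[of "Suc j", THEN conjunct1] assms by (simp del: beta.simps r.simps)
  from arg_cong[OF this, of cnj] show ?thesis by (simp del: beta.simps r.simps)
qed

lemma Re_w_cnj_beta_Suc:
  assumes "j < n"
  shows "2 * Re (w * cnj (b (Suc j))) = r (Suc j) + 1 / r j"
proof -
  note nz = one_minus_a_nonzero[OF assms]
  have rj: "r j > 0" using r_pos assms by simp
  let ?N = "(cmod (1 - a j))\<^sup>2"
  have N: "?N > 0" using nz by simp
  have "w * cnj (b (Suc j)) = (w * cnj w) / (complex_of_real (r j) * cnj (1 - a j))"
    unfolding beta_Suc_closed_form[OF assms] by simp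
  also have "\<dots> = (1 - a j) / (complex_of_real (r j) * ((1 - a j) * cnj (1 - a j)))"
    using nz by simp
  also have "\<dots> = (1 - a j) / complex_of_real (r j * ?N)"
    by (simp only: complex_norm_square of_real_mult)
  finally have "Re (w * cnj (b (Suc j))) = (1 - Re (a j)) / (r j * ?N)"
    by (simp only: Re_divide_of_real minus_complex.simps one_complex.simps)
  moreover have "r (Suc j) + 1 / r j = (1 - (cmod (a j))\<^sup>2 + ?N) / (r j * ?N)"
    using rj N by (simp add: field_simps)
  moreover have "1 - (cmod (a j))\<^sup>2 + ?N = 2 * (1 - Re (a j))"
    by (simp only: cmod_power2) (simp add: power2_eq_square algebra_simps)
  ultimately show ?thesis by simp
qed

text \<open>
  The sequences \<open>x\<close> and \<open>c\<close> run through the Szego recursion at the point \<open>z\<close>, and \<open>p\<close> through the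
  three-term recurrence. The second conjunct is the relation of interest. The first one expresses \<open>p\<^sub>j\<close>
  with the same factor \<open>\<gamma>\<close> and at the same level \<open>j\<close>; it is the second conjunct for \<open>j - 1\<close>, transported
  by one step of the recursion. Carrying both along makes the second-order recurrence amenable to a
  one-step induction in which the case \<open>j = 0\<close>, with \<open>p\<^sub>-\<^sub>1 = 0\<close> and \<open>\<alpha>\<^sub>-\<^sub>1 = -1\<close>, is not special.
  In the step, \<open>\<gamma>\<close> is multiplied by \<open>\<rho>\<^sub>j cnj \<beta>\<^sub>j\<^sub>+\<^sub>1\<close>.
\<close>
lemma three_term_from_szego:
  fixes x c p :: "nat \<Rightarrow> complex" and \<rho> :: "nat \<Rightarrow> complex"
  assumes x: "\<And>j. j < n \<Longrightarrow> \<rho> j * x (Suc j) = z * x j - cnj (\<alpha> j) * c j"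
    and c: "\<And>j. j < n \<Longrightarrow> \<rho> j * c (Suc j) = c j - \<alpha> j * z * x j"
    and c0: "c 0 = x 0" "x 0 \<noteq> 0"
    and p: "p (Suc 0) = (b 0 + cnj (b 0) * z) * p 0"
      "\<And>j. j < n \<Longrightarrow> p (Suc (Suc j)) = (b (Suc j) + cnj (b (Suc j)) * z) * p (Suc j) - z * p j"
    and j: "j \<le> n"
  shows "\<exists>\<gamma>. complex_of_real (r j) * w * p j = \<gamma> * (\<zeta> * x j - cnj (T j) * c j) \<and>
     p (Suc j) = \<gamma> * (z * x j - cnj (T j) * c j)"
  using j
proof (induction j)
  case 0
  have "cnj (b 0 * (cnj \<zeta> - T 0)) = cnj (cnj w)" by (simp only: beta_0_identities(1))
  hence 1: "cnj (b 0) * (\<zeta> - cnj (T 0)) = w" by (simp del: beta.simps)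
  have "complex_of_real (r 0) * w * p 0 = (cnj (b 0) * p 0 / x 0) * (\<zeta> * x 0 - cnj (T 0) * c 0)"
  proof -
    have "(cnj (b 0) * p 0 / x 0) * (\<zeta> * x 0 - cnj (T 0) * c 0) = (cnj (b 0) * (\<zeta> - cnj (T 0))) * p 0"
      using c0 by (simp add: field_simps del: beta.simps)
    thus ?thesis by (simp only: 1) simp
  qed
  moreover have e2: "b 0 + cnj (b 0) * z = cnj (b 0) * (z - cnj (T 0))"
    by (subst beta_0_identities(3)) (simp add: algebra_simps del: beta.simps)
  moreover have "p (Suc 0) = (cnj (b 0) * p 0 / x 0) * (z * x 0 - cnj (T 0) * c 0)"
    unfolding p(1) e2 c0(1) using c0(2) by (simp add: field_simps del: beta.simps)
  ultimately show ?case by blast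
next
  case (Suc j)
  have j: "j < n" using Suc by simp
  obtain g where g1: "complex_of_real (r j) * w * p j = g * (\<zeta> * x j - cnj (T j) * c j)"
    and g2: "p (Suc j) = g * (z * x j - cnj (T j) * c j)" using Suc by auto
  define t t' al B q where defs: "t = T j" "t' = T (Suc j)" "al = \<alpha> j" "B = b (Suc j)" "q = cnj (1 - a j)"
  have rj: "complex_of_real (r j) \<noteq> 0" using r_pos[of j] j by simp
  note nz = one_minus_a_nonzero[OF j]
  have q: "q = 1 - t * cnj al" by (simp only: defs cnj_one_minus_a)
  have "cnj (T j * (cnj \<zeta> + T (Suc j) * cnj (\<alpha> j))) = cnj (cnj \<zeta> * \<alpha> j + T (Suc j))"
    by (simp only: tau_cross[OF j])
  hence cr: "cnj t * (\<zeta> + cnj t' * al) = \<zeta> * cnj al + cnj t'" by (simp add: defs)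
  \<comment> \<open>The identity \<open>tau_difference\<close>, multiplied by \<open>\<zeta> cnj \<tau>\<^sub>j\<^sub>+\<^sub>1\<close>.\<close>
  have key: "\<zeta> * q = cnj t' * (t - al)"
  proof -
    have "\<zeta> * q = \<zeta> * (cnj t' * t') * q" using tau_unit[of "Suc j"] j by (simp add: defs)
    also have "\<dots> = cnj t' * \<zeta> * (T (Suc j) * (1 - T j * cnj (\<alpha> j)))" by (simp add: q defs mult_ac)
    also have "\<dots> = cnj t' * (\<zeta> * cnj \<zeta>) * (t - al)" unfolding tau_difference[OF j] defs by (simp only: mult_ac)
    finally show ?thesis by simp
  qed
  have cB: "cnj B * complex_of_real (r j) * q = cnj w"
    using beta_Suc_closed_form[OF j] rj nz by (simp add: defs)
  have Bq: "B = cnj B * (cnj t' * t)"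
  proof -
    have 1: "t' * q = cnj \<zeta> * t * (1 - a j)" using tau_ratio[OF j] by (simp add: defs)
    have "cnj t' * t * (1 - a j) = (cnj \<zeta> * \<zeta>) * (cnj t' * t * (1 - a j))" by simp
    also have "\<dots> = cnj t' * \<zeta> * (cnj \<zeta> * t * (1 - a j))" by (simp only: mult_ac)
    also have "\<dots> = (cnj t' * t') * \<zeta> * q" unfolding 1[symmetric] by (simp only: mult_ac)
    also have "\<dots> = \<zeta> * q" using tau_unit[of "Suc j"] j by (simp add: defs)
    finally have e: "cnj t' * t * (1 - a j) = \<zeta> * q" .
    have "B * (complex_of_real (r j) * (1 - a j)) = w" using beta_Suc_closed_form[OF j] rj nz by (simp add: defs)
    moreover have "cnj B * (cnj t' * t) * (complex_of_real (r j) * (1 - a j)) = w"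
    proof -
      have "cnj B * (cnj t' * t) * (complex_of_real (r j) * (1 - a j)) =
          cnj B * complex_of_real (r j) * (cnj t' * t * (1 - a j))" by (simp only: mult_ac)
      also have "\<dots> = (cnj B * complex_of_real (r j) * q) * \<zeta>"
        unfolding e by (simp only: mult_ac)
      also have "\<dots> = (cnj w * w) * w" unfolding cB by (simp only: zeta_eq mult.assoc)
      finally show ?thesis by simp
    qed
    ultimately have "B * (complex_of_real (r j) * (1 - a j)) = cnj B * (cnj t' * t) * (complex_of_real (r j) * (1 - a j))"
      by (rule trans[OF _ sym])
    thus ?thesis using rj nz(1) by simp
  qed
  have rB: "cnj B * (\<zeta> + cnj t' * al) = complex_of_real (r (Suc j)) * w"
    using beta_Suc_sum[OF j] by (simp add: defs del: beta.simps r.simps)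
  have pj: "p j = cnj B * q * (g * (\<zeta> * x j - cnj t * c j))"
  proof -
    have "cnj B * q * (g * (\<zeta> * x j - cnj t * c j)) = (cnj B * complex_of_real (r j) * q) * w * p j"
      unfolding defs(1) g1[symmetric] by (simp only: mult_ac)
    also have "\<dots> = (cnj w * w) * p j" by (simp only: cB)
    finally show ?thesis by simp
  qed
  define \<gamma> where "\<gamma> = g * \<rho> j * cnj B"
  have "\<gamma> * (\<zeta> * x (Suc j) - cnj t' * c (Suc j)) =
      g * cnj B * (\<zeta> * (\<rho> j * x (Suc j)) - cnj t' * (\<rho> j * c (Suc j)))"
    by (simp add: \<gamma>_def algebra_simps)
  also have "\<dots> = g * cnj B * ((\<zeta> + cnj t' * al) * z * x j - (\<zeta> * cnj al + cnj t') * c j)"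
    by (simp only: x[OF j] c[OF j] defs) (simp add: algebra_simps)
  also have "\<dots> = g * (cnj B * (\<zeta> + cnj t' * al)) * (z * x j - cnj t * c j)"
    by (simp only: cr[symmetric]) (simp add: algebra_simps)
  also have "\<dots> = complex_of_real (r (Suc j)) * w * p (Suc j)"
    unfolding rB g2 by (simp add: defs mult_ac del: r.simps)
  finally have 1: "complex_of_real (r (Suc j)) * w * p (Suc j) = \<gamma> * (\<zeta> * x (Suc j) - cnj t' * c (Suc j))" ..
  have "\<gamma> * (z * x (Suc j) - cnj t' * c (Suc j)) =
      g * cnj B * (z * (\<rho> j * x (Suc j)) - cnj t' * (\<rho> j * c (Suc j)))"
    by (simp add: \<gamma>_def algebra_simps)
  also have "\<dots> = g * cnj B * (z * z * x j - z * cnj al * c j - cnj t' * c j + cnj t' * al * z * x j)"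
    by (simp only: x[OF j] c[OF j] defs) (simp add: algebra_simps)
  also have "\<dots> = g * cnj B * ((cnj t' * t + z) * (z * x j - cnj t * c j) - z * q * (\<zeta> * x j - cnj t * c j))"
  proof -
    have t: "t * cnj t = 1" using tau_unit[of j] j by (simp add: defs)
    have "(cnj t' * t + z) * (z * x j - cnj t * c j) - z * q * (\<zeta> * x j - cnj t * c j) =
      cnj t' * t * z * x j - cnj t' * (t * cnj t) * c j + z * z * x j - z * cnj t * c j - z * x j * (\<zeta> * q) + z * (q * cnj t) * c j"
      by (simp add: algebra_simps)
    also have "q * cnj t = cnj t - (t * cnj t) * cnj al" by (simp add: q algebra_simps)
    also have "cnj t' * t * z * x j - cnj t' * (t * cnj t) * c j + z * z * x j - z * cnj t * c j - z * x j * (\<zeta> * q)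
        + z * (cnj t - (t * cnj t) * cnj al) * c j
      = z * z * x j - z * cnj al * c j - cnj t' * c j + cnj t' * al * z * x j"
      unfolding key t by (simp add: algebra_simps)
    finally show ?thesis by (simp only:)
  qed
  also have "\<dots> = (B + cnj B * z) * (g * (z * x j - cnj t * c j)) - z * (cnj B * q * (g * (\<zeta> * x j - cnj t * c j)))"
    by (subst (2) Bq) (simp add: algebra_simps)
  also have "\<dots> = p (Suc (Suc j))" unfolding pj[symmetric] using p(2)[OF j] g2 by (simp add: defs)
  finally have 2: "p (Suc (Suc j)) = \<gamma> * (z * x (Suc j) - cnj t' * c (Suc j))" ..
  show ?case using 1 2 unfolding defs by blast
qed

end

section \<open>Left eigenvectors of the Hessenberg matrix\<close>

definition rho :: "complex \<Rightarrow> complex" where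
  "rho a = complex_of_real (sqrt (1 - (cmod a)\<^sup>2))"

lemma rho_square:
  assumes "cmod a < 1"
  shows "rho a * rho a = 1 - a * cnj a"
proof -
  have "(cmod a)\<^sup>2 \<le> 1" using assms by (simp add: abs_square_le_1)
  hence "rho a * rho a = complex_of_real (1 - (cmod a)\<^sup>2)"
    unfolding rho_def of_real_mult[symmetric] by simp
  also have "\<dots> = 1 - a * cnj a" unfolding of_real_diff complex_norm_square by simp
  finally show ?thesis .
qed

lemma rho_nonzero:
  assumes "cmod a < 1"
  shows "rho a \<noteq> 0"
proof -
  have "(cmod a)\<^sup>2 < 1" using assms by (simp add: abs_square_less_1)
  thus ?thesis by (simp add: rho_def)
qed

lemma Theta_mat_carrier [simp, intro]: "Theta_mat a \<in> carrier_mat 2 2"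
  by (intro carrier_matI) (simp_all add: Theta_mat_def Let_def mat_of_rows_list_def)

lemma Theta_mat_index:
  "Theta_mat a $$ (0, 0) = cnj a" "Theta_mat a $$ (0, Suc 0) = rho a"
  "Theta_mat a $$ (Suc 0, 0) = rho a" "Theta_mat a $$ (Suc 0, Suc 0) = - a"
  by (simp_all add: Theta_mat_def Let_def mat_of_rows_list_def rho_def)

lemma G_factor_carrier:
  assumes "k < n"
  shows "G_factor n \<alpha> k \<in> carrier_mat (Suc n) (Suc n)"
  using assms carrier_matD[OF Theta_mat_carrier[of "\<alpha> k"]]
  by (intro carrier_matI) (simp_all add: G_factor_def Let_def)

lemma G_factor_index:
  assumes "k < n" "i < Suc n" "l < Suc n"
  shows "G_factor n \<alpha> k $$ (i, l) =
    (if i = k \<and> l = k then cnj (\<alpha> k) else if i = k \<and> l = Suc k then rho (\<alpha> k)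
     else if i = Suc k \<and> l = k then rho (\<alpha> k) else if i = Suc k \<and> l = Suc k then - \<alpha> k
     else if i = l then 1 else 0)"
proof -
  define r where "r = n - k - 1"
  define E where "E = four_block_mat (Theta_mat (\<alpha> k)) (0\<^sub>m 2 r) (0\<^sub>m r 2) (1\<^sub>m r)"
  have n: "Suc n = k + (2 + r)" using assms(1) by (simp add: r_def)
  note Th = carrier_matD[OF Theta_mat_carrier[of "\<alpha> k"]]
  have Ed: "dim_row E = 2 + r" "dim_col E = 2 + r" using Th by (simp_all add: E_def)
  have G: "G_factor n \<alpha> k = four_block_mat (1\<^sub>m k) (0\<^sub>m k (dim_col E)) (0\<^sub>m (dim_row E) k) E"
  proof -
    have "four_block_mat (1\<^sub>m r) (0\<^sub>m r 0) (0\<^sub>m 0 r) (0\<^sub>m 0 0) = (1\<^sub>m r :: complex mat)"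
      by (rule eq_matI) auto
    thus ?thesis using Th by (simp add: G_factor_def Let_def E_def r_def)
  qed
  have Ei: "E $$ (a, b) = (if a < 2 then if b < 2 then Theta_mat (\<alpha> k) $$ (a, b) else 0
      else if b < 2 then 0 else if a = b then 1 else 0)" if "a < 2 + r" "b < 2 + r" for a b
  proof -
    have "E $$ (a, b) = (if a < 2 then if b < 2 then Theta_mat (\<alpha> k) $$ (a, b) else 0\<^sub>m 2 r $$ (a, b - 2)
      else if b < 2 then 0\<^sub>m r 2 $$ (a - 2, b) else 1\<^sub>m r $$ (a - 2, b - 2))"
      unfolding E_def using that Th by (subst index_mat_four_block(1)) simp_all
    thus ?thesis using that by auto
  qed
  have Gi: "G_factor n \<alpha> k $$ (i, l) = (if i < k then if l < k then (if i = l then 1 else 0) else 0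
     else if l < k then 0 else E $$ (i - k, l - k))"
  proof -
    have "G_factor n \<alpha> k $$ (i, l) = (if i < k then if l < k then 1\<^sub>m k $$ (i, l) else 0\<^sub>m k (dim_col E) $$ (i, l - k)
      else if l < k then 0\<^sub>m (dim_row E) k $$ (i - k, l) else E $$ (i - k, l - k))"
      unfolding G using assms n Ed by (subst index_mat_four_block(1)) simp_all
    thus ?thesis using assms n Ed by auto
  qed
  show ?thesis
  proof (cases "i < k \<or> l < k")
    case True
    thus ?thesis unfolding Gi by auto
  next
    case False
    then obtain a b where ab: "i = k + a" "l = k + b"
      by (metis le_Suc_ex not_less)
    have lt: "a < 2 + r" "b < 2 + r" using ab assms n by auto
    have Th_entries: "Theta_mat (\<alpha> k) $$ (a, b) = (if a = 0 then if b = 0 then cnj (\<alpha> k) else rho (\<alpha> k)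
        else if b = 0 then rho (\<alpha> k) else - \<alpha> k)" if "a < 2" "b < 2"
      using that by (auto simp: Theta_mat_index less_2_cases_iff)
    have "G_factor n \<alpha> k $$ (i, l) = E $$ (a, b)" unfolding Gi using ab by simp
    also have "\<dots> = (if a = 0 \<and> b = 0 then cnj (\<alpha> k) else if a = 0 \<and> b = 1 then rho (\<alpha> k)
       else if a = 1 \<and> b = 0 then rho (\<alpha> k) else if a = 1 \<and> b = 1 then - \<alpha> k
       else if a = b then 1 else 0)"
      unfolding Ei[OF lt] using Th_entries by (auto simp: less_2_cases_iff)
    finally show ?thesis unfolding ab by simp
  qed
qed

lemma G_last_carrier: "G_last n \<tau> \<in> carrier_mat (Suc n) (Suc n)"
  by (auto simp: G_last_def Let_def)

lemma G_last_index:
  assumes "i < Suc n" "l < Suc n"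
  shows "G_last n \<tau> $$ (i, l) = (if i = l then (if i = n then cnj \<tau> else 1) else 0)"
  using assms by (auto simp: G_last_def Let_def)

text \<open>
  Partial products from the right: the induction over the factors goes from the last one to the first.
\<close>
definition G_tail :: "nat \<Rightarrow> (nat \<Rightarrow> complex) \<Rightarrow> complex \<Rightarrow> nat \<Rightarrow> complex mat" where
  "G_tail n \<alpha> \<tau> k = foldr (*) (map (G_factor n \<alpha>) [k..<n]) (G_last n \<tau>)"

lemma G_tail_n: "G_tail n \<alpha> \<tau> n = G_last n \<tau>"
  by (simp add: G_tail_def)

lemma G_tail_step: "k < n \<Longrightarrow> G_tail n \<alpha> \<tau> k = G_factor n \<alpha> k * G_tail n \<alpha> \<tau> (Suc k)"
  by (simp add: G_tail_def upt_conv_Cons)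

lemma G_tail_carrier:
  assumes "k \<le> n"
  shows "G_tail n \<alpha> \<tau> k \<in> carrier_mat (Suc n) (Suc n)"
  using assms
proof (induction rule: inc_induct)
  case base
  show ?case by (simp only: G_tail_n G_last_carrier)
next
  case (step k)
  thus ?case by (simp only: G_tail_step) (rule mult_carrier_mat[OF G_factor_carrier])
qed

lemma G_mat_carrier: "G_mat n \<alpha> \<tau> \<in> carrier_mat (Suc n) (Suc n)"
  using G_tail_carrier[of 0 n] by (simp add: G_tail_def G_mat_def)

lemma row_times_G_factor:
  assumes k: "k < n" and l: "l < Suc n"
  shows "(\<Sum>i<Suc n. x i * G_factor n \<alpha> k $$ (i, l)) =
    (if l = k then x k * cnj (\<alpha> k) + x (Suc k) * rho (\<alpha> k)
     else if l = Suc k then x k * rho (\<alpha> k) - x (Suc k) * \<alpha> k else x l)"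
proof -
  have "(\<Sum>i<Suc n. x i * G_factor n \<alpha> k $$ (i, l)) =
     (\<Sum>i<Suc n. (if i = k then (if l = k then x k * cnj (\<alpha> k) else if l = Suc k then x k * rho (\<alpha> k) else 0) else 0)
       + (if i = Suc k then (if l = k then x (Suc k) * rho (\<alpha> k) else if l = Suc k then - x (Suc k) * \<alpha> k else 0) else 0)
       + (if i = l then (if l = k \<or> l = Suc k then 0 else x l) else 0))"
    using k l by (intro sum.cong refl) (auto simp: G_factor_index)
  also have "\<dots> = (if l = k then x k * cnj (\<alpha> k) else if l = Suc k then x k * rho (\<alpha> k) else 0)
      + (if l = k then x (Suc k) * rho (\<alpha> k) else if l = Suc k then - x (Suc k) * \<alpha> k else 0)
      + (if l = k \<or> l = Suc k then 0 else x l)"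
    unfolding sum.distrib using k l by (simp only: sum.delta finite_lessThan) simp
  finally show ?thesis by simp
qed

text \<open>
  The factor \<open>G\<^sub>j\<close> mixes only the columns \<open>j\<close> and \<open>j + 1\<close>. So when a row is multiplied by the factors from
  left to right, column \<open>j\<close> is final after \<open>G\<^sub>j\<close>, and the only memory is the entry \<open>c\<^sub>j\<close> that has been
  carried from the earlier factors into column \<open>j\<close>.
\<close>
lemma row_times_G_tail:
  assumes "k \<le> n" "l < Suc n"
    and "c k = x k" "\<And>j. k \<le> j \<Longrightarrow> j < n \<Longrightarrow> c (Suc j) = rho (\<alpha> j) * c j - \<alpha> j * x (Suc j)"
  shows "(\<Sum>i<Suc n. x i * G_tail n \<alpha> \<tau> k $$ (i, l)) =
    (if l < k then x l else if l < n then cnj (\<alpha> l) * c l + rho (\<alpha> l) * x (Suc l) else cnj \<tau> * c n)"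
  using assms
proof (induction arbitrary: x rule: inc_induct)
  case base
  have "(\<Sum>i<Suc n. x i * G_tail n \<alpha> \<tau> n $$ (i, l)) =
    (\<Sum>i<Suc n. if i = l then (if l = n then x n * cnj \<tau> else x l) else 0)"
    unfolding G_tail_n using base by (intro sum.cong refl) (auto simp: G_last_index)
  thus ?case using base by (auto simp del: sum.lessThan_Suc)
next
  case (step k)
  have k: "k < n" and l: "l < Suc n" using step by auto
  define x' where "x' l = (if l = k then x k * cnj (\<alpha> k) + x (Suc k) * rho (\<alpha> k)
     else if l = Suc k then x k * rho (\<alpha> k) - x (Suc k) * \<alpha> k else x l)" for l
  have "(\<Sum>i<Suc n. x i * G_tail n \<alpha> \<tau> k $$ (i, l)) =
    (\<Sum>i<Suc n. \<Sum>m<Suc n. x i * G_factor n \<alpha> k $$ (i, m) * G_tail n \<alpha> \<tau> (Suc k) $$ (m, l))"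
    unfolding G_tail_step[OF k]
    using k l G_tail_carrier[of "Suc k" n \<alpha> \<tau>]
    by (intro sum.cong refl)
      (simp add: index_mult_sum[OF G_factor_carrier[OF k]] sum_distrib_left mult.assoc del: sum.lessThan_Suc index_mult_mat)
  also have "\<dots> = (\<Sum>m<Suc n. \<Sum>i<Suc n. x i * G_factor n \<alpha> k $$ (i, m) * G_tail n \<alpha> \<tau> (Suc k) $$ (m, l))"
    by (rule sum.swap)
  also have "\<dots> = (\<Sum>m<Suc n. x' m * G_tail n \<alpha> \<tau> (Suc k) $$ (m, l))"
    unfolding sum_distrib_right[symmetric]
    using row_times_G_factor[OF k] by (intro sum.cong refl) (simp add: x'_def del: sum.lessThan_Suc)
  also have "\<dots> = (if l < Suc k then x' l else if l < n then cnj (\<alpha> l) * c l + rho (\<alpha> l) * x' (Suc l) else cnj \<tau> * c n)"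
    by (rule step.IH) (use step.prems k in \<open>auto simp: x'_def mult.commute\<close>)
  also have "\<dots> = (if l < k then x l else if l < n then cnj (\<alpha> l) * c l + rho (\<alpha> l) * x (Suc l) else cnj \<tau> * c n)"
    using step.prems k by (auto simp: x'_def mult.commute less_Suc_eq)
  finally show ?case .
qed

lemma row_times_G:
  assumes "l \<le> n" and "c 0 = x 0" and "\<And>j. j < n \<Longrightarrow> c (Suc j) = rho (\<alpha> j) * c j - \<alpha> j * x (Suc j)"
  shows "(\<Sum>i<Suc n. x i * G_mat n \<alpha> \<tau> $$ (i, l)) =
    (if l < n then cnj (\<alpha> l) * c l + rho (\<alpha> l) * x (Suc l) else cnj \<tau> * c n)"
  using row_times_G_tail[of 0 n l c x \<alpha> \<tau>] assms by (simp add: G_tail_def G_mat_def del: sum.lessThan_Suc)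

lemma G_first_row:
  assumes "l \<le> n"
  shows "G_mat n \<alpha> \<tau> $$ (0, l) = (if l < n then cnj (\<alpha> l) else cnj \<tau>) * (\<Prod>j<l. rho (\<alpha> j))"
proof -
  define x :: "nat \<Rightarrow> complex" where "x i = (if i = 0 then 1 else 0)" for i
  have "(\<Sum>i<Suc n. x i * G_mat n \<alpha> \<tau> $$ (i, l)) = (\<Sum>i<Suc n. if i = 0 then G_mat n \<alpha> \<tau> $$ (0, l) else 0)"
    by (intro sum.cong) (auto simp: x_def)
  also have "\<dots> = G_mat n \<alpha> \<tau> $$ (0, l)" by (simp add: sum.delta del: sum.lessThan_Suc)
  finally have "G_mat n \<alpha> \<tau> $$ (0, l) = (\<Sum>i<Suc n. x i * G_mat n \<alpha> \<tau> $$ (i, l))" ..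
  also have "\<dots> = (if l < n then cnj (\<alpha> l) * (\<Prod>j<l. rho (\<alpha> j)) + rho (\<alpha> l) * x (Suc l) else cnj \<tau> * (\<Prod>j<n. rho (\<alpha> j)))"
    by (rule row_times_G) (use assms in \<open>auto simp: x_def\<close>)
  finally show ?thesis using assms by (auto simp: x_def)
qed

text \<open>
  A left eigenvector \<open>x\<close> and its carried entries \<open>c\<close> satisfy the Szego recursion. The entry \<open>x\<^sub>0\<close> cannot
  vanish, since the recursion would then propagate the zero to the whole vector.
\<close>
lemma eigenvalue_imp_left_recursion:
  assumes alpha: "\<And>j. j < n \<Longrightarrow> cmod (\<alpha> j) < 1" and z: "z \<in> spectrum (G_mat n \<alpha> \<tau>)"
  shows "\<exists>x c. c 0 = x 0 \<and> x 0 \<noteq> 0 \<and>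
    (\<forall>j<n. rho (\<alpha> j) * x (Suc j) = z * x j - cnj (\<alpha> j) * c j) \<and>
    (\<forall>j<n. rho (\<alpha> j) * c (Suc j) = c j - \<alpha> j * z * x j) \<and> z * x n = cnj \<tau> * c n"
proof -
  let ?G = "G_mat n \<alpha> \<tau>"
  note G = G_mat_carrier[of n \<alpha> \<tau>]
  have "z \<in> spectrum (transpose_mat ?G)"
    using z G by (simp add: spectrum_root_char_poly[of _ "Suc n"] char_poly_transpose_mat[OF G])
  then obtain v where "eigenvector (transpose_mat ?G) v z" by (auto simp: spectrum_def eigenvalue_def)
  hence v: "v \<in> carrier_vec (Suc n)" "v \<noteq> 0\<^sub>v (Suc n)" "transpose_mat ?G *\<^sub>v v = z \<cdot>\<^sub>v v"
    using G by (auto simp: eigenvector_def)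
  define x where "x i = v $ i" for i
  define c where "c = rec_nat (x 0) (\<lambda>j y. rho (\<alpha> j) * y - \<alpha> j * x (Suc j))"
  have c: "c 0 = x 0" "\<And>j. c (Suc j) = rho (\<alpha> j) * c j - \<alpha> j * x (Suc j)" by (simp_all add: c_def)
  have ev: "(\<Sum>i<Suc n. x i * ?G $$ (i, l)) = z * x l" if l: "l < Suc n" for l
  proof -
    have "(transpose_mat ?G *\<^sub>v v) $ l = (\<Sum>i<Suc n. transpose_mat ?G $$ (l, i) * v $ i)"
      using G v l by (intro index_mult_vec_sum) auto
    also have "\<dots> = (\<Sum>i<Suc n. x i * ?G $$ (i, l))"
      using G l by (intro sum.cong) (auto simp: x_def mult.commute)
    finally show ?thesis using v l by (simp add: x_def)
  qed
  have e1: "cnj (\<alpha> j) * c j + rho (\<alpha> j) * x (Suc j) = z * x j" if "j < n" for j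
    using ev[of j] row_times_G[of j n c x \<alpha> \<tau>] c that by simp
  have e2: "cnj \<tau> * c n = z * x n"
    using ev[of n] row_times_G[of n n c x \<alpha> \<tau>] c by simp
  have r1: "rho (\<alpha> j) * x (Suc j) = z * x j - cnj (\<alpha> j) * c j" if "j < n" for j
    using e1[OF that] by (simp add: eq_diff_eq add.commute)
  have r2: "rho (\<alpha> j) * c (Suc j) = c j - \<alpha> j * z * x j" if "j < n" for j
  proof -
    have "rho (\<alpha> j) * c (Suc j) = (rho (\<alpha> j) * rho (\<alpha> j)) * c j - \<alpha> j * (rho (\<alpha> j) * x (Suc j))"
      by (simp add: c algebra_simps)
    thus ?thesis unfolding r1[OF that] rho_square[OF alpha[OF that]] by (simp add: algebra_simps)
  qed
  have "x 0 \<noteq> 0"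
  proof
    assume x0: "x 0 = 0"
    have "x j = 0 \<and> c j = 0" if "j \<le> n" for j using that
    proof (induction j)
      case (Suc j)
      hence "rho (\<alpha> j) * x (Suc j) = 0" "rho (\<alpha> j) * c (Suc j) = 0" using r1[of j] r2[of j] by auto
      thus ?case using rho_nonzero[OF alpha[of j]] Suc by auto
    qed (use x0 c in auto)
    hence "v = 0\<^sub>v (Suc n)" using v by (intro eq_vecI) (auto simp: x_def)
    thus False using v by simp
  qed
  thus ?thesis using c(1) r1 r2 e2[symmetric] by (intro exI[of _ x] exI[of _ c]) auto
qed

context verblunsky
begin

lemma tau_cross_cnj:
  assumes "j < n"
  shows "cnj (T j) * (\<zeta> + cnj (T (Suc j)) * \<alpha> j) = \<zeta> * cnj (\<alpha> j) + cnj (T (Suc j))"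
  using arg_cong[OF tau_cross[OF assms], of cnj] by simp

text \<open>
  If \<open>\<tau>\<^sub>0 \<zeta> = 1\<close>, then the solution of the Szego recursion at \<open>\<zeta>\<close> with \<open>x\<^sub>0 = c\<^sub>0 = 1\<close> satisfies the boundary
  condition at level \<open>0\<close>. The \<open>\<tau>\<^sub>j\<close> are made so that the condition passes from level to level at this
  point; at level \<open>n\<close> it says that \<open>x\<close> is a left eigenvector for \<open>\<zeta>\<close>.
\<close>
lemma not_eigenvalue_imp_regular:
  assumes "\<zeta> \<notin> spectrum (G_mat n \<alpha> \<tau>n)"
  shows "T 0 * \<zeta> \<noteq> 1"
proof
  assume T0: "T 0 * \<zeta> = 1"
  let ?G = "G_mat n \<alpha> \<tau>n"
  note G = G_mat_carrier[of n \<alpha> \<tau>n]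
  define xc where "xc = rec_nat (1, 1) (\<lambda>j (x, c). let y = (\<zeta> * x - cnj (\<alpha> j) * c) / rho (\<alpha> j)
     in (y, rho (\<alpha> j) * c - \<alpha> j * y))"
  define x where "x j = fst (xc j)" for j
  define c where "c j = snd (xc j)" for j
  have x0: "x 0 = 1" "c 0 = 1" by (simp_all add: x_def c_def xc_def)
  have xS: "x (Suc j) = (\<zeta> * x j - cnj (\<alpha> j) * c j) / rho (\<alpha> j)"
    and cS: "c (Suc j) = rho (\<alpha> j) * c j - \<alpha> j * x (Suc j)" for j
    by (simp_all add: x_def c_def xc_def Let_def case_prod_unfold)
  have r1: "rho (\<alpha> j) * x (Suc j) = \<zeta> * x j - cnj (\<alpha> j) * c j" if "j < n" for j
    using rho_nonzero[OF norm_alpha[OF that]] by (simp add: xS)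
  have r2: "rho (\<alpha> j) * c (Suc j) = c j - \<alpha> j * \<zeta> * x j" if "j < n" for j
  proof -
    have "rho (\<alpha> j) * c (Suc j) = (rho (\<alpha> j) * rho (\<alpha> j)) * c j - \<alpha> j * (rho (\<alpha> j) * x (Suc j))"
      by (simp add: cS algebra_simps)
    thus ?thesis unfolding r1[OF that] rho_square[OF norm_alpha[OF that]] by (simp add: algebra_simps)
  qed
  have B: "\<zeta> * x j - cnj (T j) * c j = 0" if "j \<le> n" for j
    using that
  proof (induction j)
    case 0
    have "cnj (T 0) * (T 0 * \<zeta>) = cnj (T 0)" using T0 by simp
    hence "\<zeta> = cnj (T 0)" using tau_unit(1)[of 0] by (simp flip: mult.assoc)
    thus ?case using x0 by simp
  next
    case (Suc j)
    hence j: "j < n" by simp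
    have "rho (\<alpha> j) * (\<zeta> * x (Suc j) - cnj (T (Suc j)) * c (Suc j)) =
      \<zeta> * (rho (\<alpha> j) * x (Suc j)) - cnj (T (Suc j)) * (rho (\<alpha> j) * c (Suc j))" by (simp add: algebra_simps)
    also have "\<dots> = (\<zeta> + cnj (T (Suc j)) * \<alpha> j) * \<zeta> * x j - (\<zeta> * cnj (\<alpha> j) + cnj (T (Suc j))) * c j"
      unfolding r1[OF j] r2[OF j] by (simp add: algebra_simps)
    also have "\<dots> = (\<zeta> + cnj (T (Suc j)) * \<alpha> j) * (\<zeta> * x j - cnj (T j) * c j)"
      unfolding tau_cross_cnj[OF j, symmetric] by (simp add: algebra_simps)
    also have "\<dots> = 0" using Suc by simp
    finally show ?case using rho_nonzero[OF norm_alpha[OF j]] by (metis mult_eq_0_iff)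
  qed
  have Tn: "T n = \<tau>n" by (subst tau.simps) simp
  define v where "v = vec (Suc n) x"
  have v: "v \<in> carrier_vec (Suc n)" by (simp add: v_def)
  have "v \<noteq> 0\<^sub>v (Suc n)"
  proof
    assume "v = 0\<^sub>v (Suc n)"
    hence "v $ 0 = 0" by simp
    thus False using x0 by (simp add: v_def)
  qed
  moreover have "transpose_mat ?G *\<^sub>v v = \<zeta> \<cdot>\<^sub>v v"
  proof (rule eq_vecI)
    fix l assume "l < dim_vec (\<zeta> \<cdot>\<^sub>v v)"
    hence l: "l < Suc n" using v by simp
    have "(transpose_mat ?G *\<^sub>v v) $ l = (\<Sum>i<Suc n. transpose_mat ?G $$ (l, i) * v $ i)"
      using G v l by (intro index_mult_vec_sum) auto
    also have "\<dots> = (\<Sum>i<Suc n. x i * ?G $$ (i, l))"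
      using G l by (intro sum.cong) (auto simp: v_def mult.commute)
    also have "\<dots> = (if l < n then cnj (\<alpha> l) * c l + rho (\<alpha> l) * x (Suc l) else cnj \<tau>n * c n)"
      by (rule row_times_G) (use l x0 cS in auto)
    also have "\<dots> = \<zeta> * x l" using r1[of l] B[of n] Tn l by (auto simp: less_Suc_eq)
    finally show "(transpose_mat ?G *\<^sub>v v) $ l = (\<zeta> \<cdot>\<^sub>v v) $ l" using l by (simp add: v_def)
  qed (use G v in auto)
  ultimately have "\<zeta> \<in> spectrum (transpose_mat ?G)"
    using v G by (auto simp: spectrum_def eigenvalue_def eigenvector_def)
  hence "\<zeta> \<in> spectrum ?G"
    using G by (simp add: spectrum_root_char_poly[of _ "Suc n"] char_poly_transpose_mat[OF G])
  thus False using assms by simp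
qed

end

section \<open>The Toeplitz decomposition of the bidiagonal matrix\<close>

lemma A_mat_carrier: "A_mat n \<beta> w \<in> carrier_mat (Suc n) (Suc n)"
  by (simp add: A_mat_def)

lemma toeplitz_carrier:
  "toeplitz_H (A_mat n \<beta> w) \<in> carrier_mat (Suc n) (Suc n)"
  "toeplitz_K (A_mat n \<beta> w) \<in> carrier_mat (Suc n) (Suc n)"
  using A_mat_carrier[of n \<beta> w] by (auto simp: toeplitz_H_def toeplitz_K_def)

lemma A_mat_index:
  "i < Suc n \<Longrightarrow> j < Suc n \<Longrightarrow> A_mat n \<beta> w $$ (i, j) =
     (if i = j then w * cnj (\<beta> i) else if i = Suc j then - w else 0)"
  by (simp add: A_mat_def)

lemma toeplitz_index:
  assumes "i < Suc n" "j < Suc n"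
  shows "toeplitz_H (A_mat n \<beta> w) $$ (i, j) = (A_mat n \<beta> w $$ (i, j) + cnj (A_mat n \<beta> w $$ (j, i))) / 2"
    "toeplitz_K (A_mat n \<beta> w) $$ (i, j) = (A_mat n \<beta> w $$ (i, j) - cnj (A_mat n \<beta> w $$ (j, i))) / (2 * \<i>)"
  using assms carrier_matD[OF A_mat_carrier[of n \<beta> w]] by (simp_all add: toeplitz_H_def toeplitz_K_def)

lemma toeplitz_adjoint:
  "mat_adjoint (toeplitz_H (A_mat n \<beta> w)) = toeplitz_H (A_mat n \<beta> w)"
  "mat_adjoint (toeplitz_K (A_mat n \<beta> w)) = toeplitz_K (A_mat n \<beta> w)"
proof -
  note d = carrier_matD[OF toeplitz_carrier(1)[of n \<beta> w]] carrier_matD[OF toeplitz_carrier(2)[of n \<beta> w]]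
  show "mat_adjoint (toeplitz_H (A_mat n \<beta> w)) = toeplitz_H (A_mat n \<beta> w)"
    using d by (intro eq_matI) (auto simp: toeplitz_index add.commute)
  show "mat_adjoint (toeplitz_K (A_mat n \<beta> w)) = toeplitz_K (A_mat n \<beta> w)"
    using d by (intro eq_matI) (auto simp: toeplitz_index field_simps)
qed

lemma toeplitz_H_tridiagonal:
  assumes "i < Suc n" "j < Suc n"
  shows "toeplitz_H (A_mat n \<beta> w) $$ (i, j) =
    (if i = j then complex_of_real (Re (w * cnj (\<beta> i))) else if i = Suc j then - w / 2
     else if j = Suc i then - cnj w / 2 else 0)"
proof -
  have "w * cnj (\<beta> i) + cnj (w * cnj (\<beta> i)) = 2 * complex_of_real (Re (w * cnj (\<beta> i)))"
    by (subst complex_add_cnj) simp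
  thus ?thesis using assms by (auto simp: toeplitz_index A_mat_index)
qed

context verblunsky_regular
begin

text \<open>
  With \<open>h\<^sub>j = Re (w cnj \<beta>\<^sub>j)\<close>, twice the quadratic form is
  \<open>\<Sum> 2 h\<^sub>j |y\<^sub>j|\<^sup>2 - 2 \<Sum> Re (w y\<^sub>j cnj y\<^sub>j\<^sub>+\<^sub>1)\<close>. Since \<open>2 h\<^sub>0 = r\<^sub>0\<close> and
  \<open>2 h\<^sub>j\<^sub>+\<^sub>1 = r\<^sub>j\<^sub>+\<^sub>1 + 1 / r\<^sub>j\<close>, it equals
  \<open>\<Sum> |r\<^sub>j y\<^sub>j - cnj w y\<^sub>j\<^sub>+\<^sub>1|\<^sup>2 / r\<^sub>j + r\<^sub>n |y\<^sub>n|\<^sup>2\<close>, where the sum runs over \<open>j < n\<close>. In the proof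
  \<open>S k\<close> is the form of the leading block of order \<open>k + 1\<close>.
\<close>
lemma toeplitz_H_pos_def: "pos_def (toeplitz_H (A_mat n b w))"
  unfolding pos_def_def
proof (intro conjI ballI impI)
  let ?H = "toeplitz_H (A_mat n b w)"
  have H: "?H \<in> carrier_mat (Suc n) (Suc n)" by (rule toeplitz_carrier)
  show "square_mat ?H" using H by auto
  show "mat_adjoint ?H = ?H" by (rule toeplitz_adjoint)
  fix v :: "complex vec" assume "v \<in> carrier_vec (dim_row ?H)" "v \<noteq> 0\<^sub>v (dim_row ?H)"
  hence v: "v \<in> carrier_vec (Suc n)" "v \<noteq> 0\<^sub>v (Suc n)" using H by auto
  define y where "y i = v $ i" for i
  define h where "h i = Re (w * cnj (b i))" for i
  define f where "f i l = (if i = l then complex_of_real (h i) else if i = Suc l then - w / 2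
     else if l = Suc i then - cnj w / 2 else 0) * y l * cnj (y i)" for i l
  define S where "S k = (\<Sum>i\<le>k. h i * (cmod (y i))\<^sup>2) - (\<Sum>i<k. Re (w * y i * cnj (y (Suc i))))" for k
  have Q: "(\<Sum>i\<le>k. \<Sum>l\<le>k. f i l) = complex_of_real (S k)" for k
  proof (induction k)
    case 0
    show ?case by (simp add: f_def S_def mult.assoc flip: complex_norm_square)
  next
    case (Suc k)
    define W where "W = w * y k * cnj (y (Suc k))"
    have "(\<Sum>i\<le>Suc k. \<Sum>l\<le>Suc k. f i l) = (\<Sum>i\<le>k. \<Sum>l\<le>k. f i l) + (\<Sum>i\<le>k. f i (Suc k))
       + (\<Sum>l\<le>k. f (Suc k) l) + f (Suc k) (Suc k)"
      by (simp add: sum.distrib)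
    also have "(\<Sum>i\<le>k. f i (Suc k)) = (\<Sum>i\<le>k. if i = k then - cnj w / 2 * y (Suc k) * cnj (y k) else 0)"
      by (intro sum.cong) (auto simp: f_def)
    also have "\<dots> = cnj (- (W / 2))" by (simp add: W_def)
    also have "(\<Sum>l\<le>k. f (Suc k) l) = (\<Sum>l\<le>k. if l = k then - w / 2 * y k * cnj (y (Suc k)) else 0)"
      by (intro sum.cong) (auto simp: f_def)
    also have "\<dots> = - (W / 2)" by (simp add: W_def)
    also have "f (Suc k) (Suc k) = complex_of_real (h (Suc k) * (cmod (y (Suc k)))\<^sup>2)"
      by (simp add: f_def mult.assoc flip: complex_norm_square)
    finally have e: "(\<Sum>i\<le>Suc k. \<Sum>l\<le>Suc k. f i l) = complex_of_real (S k) + cnj (- (W / 2)) + - (W / 2)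
      + complex_of_real (h (Suc k) * (cmod (y (Suc k)))\<^sup>2)"
      unfolding Suc.IH .
    have "S (Suc k) = S k - Re W + h (Suc k) * (cmod (y (Suc k)))\<^sup>2" by (simp add: S_def W_def)
    thus ?case unfolding e by (simp add: complex_eq_iff)
  qed
  have sq: "(cmod (complex_of_real a * u - cnj w * u'))\<^sup>2 = a\<^sup>2 * (cmod u)\<^sup>2 + (cmod u')\<^sup>2 - 2 * a * Re (w * u * cnj u')" for a u u'
  proof -
    have "complex_of_real ((cmod (complex_of_real a * u - cnj w * u'))\<^sup>2) =
       (complex_of_real a * u - cnj w * u') * cnj (complex_of_real a * u - cnj w * u')" by (rule complex_norm_square)
    also have "\<dots> = complex_of_real (a\<^sup>2) * (u * cnj u) + (cnj w * w) * (u' * cnj u')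
        - complex_of_real a * (w * u * cnj u' + cnj (w * u * cnj u'))"
      by (simp add: algebra_simps power2_eq_square)
    also have "\<dots> = complex_of_real (a\<^sup>2 * (cmod u)\<^sup>2 + (cmod u')\<^sup>2 - 2 * a * Re (w * u * cnj u'))"
      unfolding complex_add_cnj complex_norm_square[symmetric] by simp
    finally show ?thesis by (simp only: of_real_eq_iff)
  qed
  have pos: "r k * (cmod (y k))\<^sup>2 \<le> 2 * S k \<and> (2 * S k \<le> 0 \<longrightarrow> (\<forall>i\<le>k. y i = 0))" if "k \<le> n" for k
    using that
  proof (induction k)
    case 0
    show ?case using Re_w_cnj_beta_0 by (auto simp: S_def h_def mult.assoc[symmetric] simp del: beta.simps)
  next
    case (Suc k)
    have rk: "r k > 0" "r (Suc k) > 0" using r_pos Suc.prems by (simp_all del: r.simps)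
    \<comment> \<open>Completing this square uses up the term \<open>r k * |y k|\<^sup>2\<close> that the induction hypothesis leaves over.\<close>
    define E where "E = (cmod (complex_of_real (r k) * y k - cnj w * y (Suc k)))\<^sup>2 / r k"
    have E0: "E \<ge> 0" using rk by (simp add: E_def)
    have "E = r k * (cmod (y k))\<^sup>2 + (cmod (y (Suc k)))\<^sup>2 / r k - 2 * Re (w * y k * cnj (y (Suc k)))"
      unfolding E_def sq using rk by (simp add: field_simps power2_eq_square)
    moreover have "2 * S (Suc k) = 2 * S k + (2 * h (Suc k)) * (cmod (y (Suc k)))\<^sup>2 - 2 * Re (w * y k * cnj (y (Suc k)))"
      by (simp add: S_def algebra_simps)
    moreover have "2 * h (Suc k) = r (Suc k) + 1 / r k"
      unfolding h_def by (rule Re_w_cnj_beta_Suc) (use Suc.prems in simp)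
    ultimately have step: "2 * S (Suc k) = (2 * S k - r k * (cmod (y k))\<^sup>2) + E + r (Suc k) * (cmod (y (Suc k)))\<^sup>2"
      by (simp only: ring_distribs) simp
    have IH: "r k * (cmod (y k))\<^sup>2 \<le> 2 * S k" "2 * S k \<le> 0 \<Longrightarrow> \<forall>i\<le>k. y i = 0" using Suc by auto
    have nn: "0 \<le> r (Suc k) * (cmod (y (Suc k)))\<^sup>2" using rk by (simp del: r.simps)
    have "\<forall>i\<le>Suc k. y i = 0" if "2 * S (Suc k) \<le> 0"
    proof -
      have "r (Suc k) * (cmod (y (Suc k)))\<^sup>2 = 0" using step that IH(1) E0 nn by linarith
      hence y1: "y (Suc k) = 0" using rk by (simp del: r.simps)
      have "E = 0" using step that IH(1) E0 nn by linarith
      hence y0: "y k = 0" using rk y1 by (simp add: E_def)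
      have "2 * S k \<le> 0" using step that y0 E0 nn by simp
      thus ?thesis using IH(2) y1 by (auto simp: le_Suc_eq)
    qed
    moreover have "r (Suc k) * (cmod (y (Suc k)))\<^sup>2 \<le> 2 * S (Suc k)" using step IH(1) E0 by linarith
    ultimately show ?case by (simp del: r.simps)
  qed
  have "\<not> (\<forall>i\<le>n. y i = 0)"
  proof
    assume "\<forall>i\<le>n. y i = 0"
    hence "v = 0\<^sub>v (Suc n)" using v by (intro eq_vecI) (auto simp: y_def)
    thus False using v by simp
  qed
  hence Spos: "S n > 0" using pos[of n] by fastforce
  have "(?H *\<^sub>v v) \<bullet>c v = (\<Sum>i<Suc n. \<Sum>l<Suc n. f i l)"
    unfolding quad_form_sum[OF H v(1)]
    by (intro sum.cong refl) (auto simp: f_def y_def h_def toeplitz_H_tridiagonal simp del: beta.simps)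
  also have "\<dots> = complex_of_real (S n)" unfolding lessThan_Suc_atMost by (rule Q)
  finally show "0 < (?H *\<^sub>v v) \<bullet>c v" using Spos by (simp add: less_complex_def)
qed

text \<open>
  With \<open>u = A P\<close> and \<open>v = A\<^sup>* P\<close>, the recurrence for \<open>p\<close> is row \<open>i\<close> of \<open>z u + \<zeta> v = 0\<close>; the last row needs
  \<open>p\<^sub>n\<^sub>+\<^sub>1(z) = 0\<close>. Since \<open>H P = (u + v) / 2\<close> and \<open>K P = (u - v) / (2 i)\<close>, this is the asserted equation.
\<close>
lemma toeplitz_pencil:
  fixes p0 :: real
  assumes z: "z \<in> spectrum (G_mat n \<alpha> \<tau>n)" and zz: "z \<noteq> \<zeta>"
  defines "P \<equiv> vec (Suc n) (\<lambda>j. poly (p_poly b p0 j) z)"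
  shows "toeplitz_K (A_mat n b w) *\<^sub>v P = (\<i> * (z + \<zeta>) / (z - \<zeta>)) \<cdot>\<^sub>v (toeplitz_H (A_mat n b w) *\<^sub>v P)"
proof -
  define p where "p j = poly (p_poly b p0 j) z" for j
  have p1: "p (Suc 0) = (b 0 + cnj (b 0) * z) * p 0" by (simp add: p_def algebra_simps del: beta.simps)
  have p2: "p (Suc (Suc j)) = (b (Suc j) + cnj (b (Suc j)) * z) * p (Suc j) - z * p j" for j
    by (simp add: p_def algebra_simps del: beta.simps)
  obtain x c where xc: "c 0 = x 0" "x 0 \<noteq> 0"
      "\<forall>j<n. rho (\<alpha> j) * x (Suc j) = z * x j - cnj (\<alpha> j) * c j"
      "\<forall>j<n. rho (\<alpha> j) * c (Suc j) = c j - \<alpha> j * z * x j" "z * x n = cnj \<tau>n * c n"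
    using eigenvalue_imp_left_recursion[OF norm_alpha z] by blast
  obtain g where "p (Suc n) = g * (z * x n - cnj (T n) * c n)"
    using three_term_from_szego[of "\<lambda>j. rho (\<alpha> j)" x z c p n] xc p1 p2 by blast
  moreover have "T n = \<tau>n" by (subst tau.simps) simp
  ultimately have pn: "p (Suc n) = 0" using xc(5) by simp
  have P: "P \<in> carrier_vec (Suc n)" by (simp add: P_def)
  let ?A = "A_mat n b w"
  define u where "u i = w * (cnj (b i) * p i - (if i = 0 then 0 else p (i - 1)))" for i
  define v where "v i = cnj w * (b i * p i - p (Suc i))" for i
  have Ap: "(\<Sum>l<Suc n. ?A $$ (i, l) * P $ l) = u i" if i: "i < Suc n" for i
  proof -
    have "(\<Sum>l<Suc n. ?A $$ (i, l) * P $ l) =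
      (\<Sum>l<Suc n. (if l = i then w * cnj (b i) * p i else 0) + (if l = i - 1 then (if i = 0 then 0 else - w * p (i - 1)) else 0))"
      using i by (intro sum.cong refl) (auto simp: A_mat_index P_def p_def simp del: beta.simps)
    also have "\<dots> = u i" unfolding sum.distrib using i
      by (auto simp add: u_def algebra_simps simp del: sum.lessThan_Suc beta.simps)
    finally show ?thesis .
  qed
  have Aap: "(\<Sum>l<Suc n. cnj (?A $$ (l, i)) * P $ l) = v i" if i: "i < Suc n" for i
  proof -
    have "(\<Sum>l<Suc n. cnj (?A $$ (l, i)) * P $ l) =
      (\<Sum>l<Suc n. (if l = i then cnj w * b i * p i else 0) + (if l = Suc i then - cnj w * p (Suc i) else 0))"
      using i by (intro sum.cong refl) (auto simp: A_mat_index P_def p_def simp del: beta.simps)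
    also have "\<dots> = v i" unfolding sum.distrib using i pn
      by (auto simp add: v_def algebra_simps less_Suc_eq simp del: sum.lessThan_Suc beta.simps)
    finally show ?thesis .
  qed
  have key: "z * u i + \<zeta> * v i = 0" for i
  proof -
    have "z * u i + \<zeta> * v i = w * ((b i + cnj (b i) * z) * p i - z * (if i = 0 then 0 else p (i - 1)) - p (Suc i))"
    proof -
      have "\<zeta> * cnj w = w" using cnj_w_mult(2) by (simp add: zeta_eq mult.assoc)
      hence "\<zeta> * v i = w * (b i * p i - p (Suc i))" by (simp add: v_def flip: mult.assoc del: beta.simps)
      thus ?thesis by (simp add: u_def algebra_simps del: beta.simps)
    qed
    also have "\<dots> = 0" using p1 p2[of "i - 1"] by (cases i) (simp_all del: beta.simps)
    finally show ?thesis .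
  qed
  show ?thesis
  proof (rule eq_vecI)
    fix i assume "i < dim_vec ((\<i> * (z + \<zeta>) / (z - \<zeta>)) \<cdot>\<^sub>v (toeplitz_H ?A *\<^sub>v P))"
    hence i: "i < Suc n" using carrier_matD[OF toeplitz_carrier(1)[of n b w]] by simp
    have "(toeplitz_H ?A *\<^sub>v P) $ i = (\<Sum>l<Suc n. (?A $$ (i, l) * P $ l + cnj (?A $$ (l, i)) * P $ l) / 2)"
      unfolding index_mult_vec_sum[OF toeplitz_carrier(1) P i]
      using i by (intro sum.cong refl) (simp add: toeplitz_index distrib_right)
    hence Hp: "(toeplitz_H ?A *\<^sub>v P) $ i = (u i + v i) / 2"
      by (simp only: sum_divide_distrib[symmetric] sum.distrib Ap[OF i] Aap[OF i])
    have "(toeplitz_K ?A *\<^sub>v P) $ i = (\<Sum>l<Suc n. (?A $$ (i, l) * P $ l - cnj (?A $$ (l, i)) * P $ l) / (2 * \<i>))"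
      unfolding index_mult_vec_sum[OF toeplitz_carrier(2) P i]
      using i by (intro sum.cong refl) (simp add: toeplitz_index left_diff_distrib diff_divide_distrib)
    hence Kp: "(toeplitz_K ?A *\<^sub>v P) $ i = (u i - v i) / (2 * \<i>)"
      by (simp only: sum_divide_distrib[symmetric] sum_subtractf Ap[OF i] Aap[OF i])
    have "(z + \<zeta>) * (u i + v i) + (z - \<zeta>) * (u i - v i) = 2 * (z * u i + \<zeta> * v i)" by (simp add: algebra_simps)
    hence nk: "(z + \<zeta>) * (u i + v i) = - ((z - \<zeta>) * (u i - v i))"
      unfolding key by (simp only: eq_neg_iff_add_eq_0 mult_zero_right)
    have "\<i> * (z + \<zeta>) / (z - \<zeta>) * ((u i + v i) / 2) = \<i> * ((z + \<zeta>) * (u i + v i)) / ((z - \<zeta>) * 2)"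
      by (simp only: times_divide_times_eq mult.assoc)
    also have "\<dots> = - \<i> * (u i - v i) / 2"
    proof -
      have c: "\<i> * - (q * d) / (q * 2) = - \<i> * d / 2" if "q \<noteq> 0" for q d :: complex
        using that by (simp add: field_simps)
      show ?thesis unfolding nk by (rule c) (use zz in simp)
    qed
    also have "\<dots> = (u i - v i) / (2 * \<i>)" by (simp add: field_simps)
    finally have f: "\<i> * (z + \<zeta>) / (z - \<zeta>) * ((u i + v i) / 2) = (u i - v i) / (2 * \<i>)" .
    have "i < dim_vec (toeplitz_H ?A *\<^sub>v P)" using i carrier_matD[OF toeplitz_carrier(1)[of n b w]] by simp
    from index_smult_vec(1)[OF this]
    show "(toeplitz_K ?A *\<^sub>v P) $ i = ((\<i> * (z + \<zeta>) / (z - \<zeta>)) \<cdot>\<^sub>v (toeplitz_H ?A *\<^sub>v P)) $ i"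
      by (simp only: Hp Kp f)
  qed (use carrier_matD[OF toeplitz_carrier(1)[of n b w]] carrier_matD[OF toeplitz_carrier(2)[of n b w]] in auto)
qed

end

section \<open>Differentiable dependence on the parameters\<close>

lemma rho_differentiable:
  fixes f :: "real \<Rightarrow> complex"
  assumes "f differentiable (at t)" "cmod (f t) < 1"
  shows "(\<lambda>s. rho (f s)) differentiable (at t)"
proof -
  have Re: "(\<lambda>s. Re (f s)) differentiable (at t)" and Im: "(\<lambda>s. Im (f s)) differentiable (at t)"
    using differentiable_compose[OF bounded_linear_imp_differentiable[OF bounded_linear_Re] assms(1)]
      differentiable_compose[OF bounded_linear_imp_differentiable[OF bounded_linear_Im] assms(1)] by auto
  have g: "(\<lambda>s. 1 - (cmod (f s))\<^sup>2) differentiable (at t)"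
    unfolding cmod_power2 using Re Im by simp
  have "1 - (cmod (f t))\<^sup>2 > 0" using assms(2) by (simp add: abs_square_less_1)
  hence "sqrt differentiable (at (1 - (cmod (f t))\<^sup>2))"
    using DERIV_real_sqrt real_differentiable_def by blast
  from differentiable_compose[OF this g] have "(\<lambda>s. sqrt (1 - (cmod (f s))\<^sup>2)) differentiable (at t)" .
  from differentiable_compose[OF bounded_linear_imp_differentiable[OF bounded_linear_of_real] this]
  show ?thesis unfolding rho_def .
qed

lemma cnj_differentiable:
  fixes f :: "real \<Rightarrow> complex"
  assumes "f differentiable (at t)"
  shows "(\<lambda>s. cnj (f s)) differentiable (at t)"
  using differentiable_compose[OF bounded_linear_imp_differentiable[OF bounded_linear_cnj] assms] .

text \<open>
  Up to conjugation, the first row of \<open>G\<close> contains the parameters one after the other, each multiplied by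
  the product of the preceding \<open>\<rho>\<^sub>i\<close>. So they can be recovered from the matrix successively, without dividing by
  zero.
\<close>
lemma parameters_differentiable:
  fixes \<alpha> :: "nat \<Rightarrow> real \<Rightarrow> complex" and \<tau> :: "real \<Rightarrow> complex"
  assumes alpha: "\<And>s j. j < n \<Longrightarrow> cmod (\<alpha> j s) < 1"
    and G: "\<And>j. j \<le> n \<Longrightarrow> (\<lambda>s. G_mat n (\<lambda>j. \<alpha> j s) (\<tau> s) $$ (0, j)) differentiable (at t)"
  shows "\<And>j. j < n \<Longrightarrow> \<alpha> j differentiable (at t)" and "\<tau> differentiable (at t)"
proof -
  have nz: "(\<Prod>i<j. rho (\<alpha> i s)) \<noteq> 0" if "j \<le> n" for j s
    using that rho_nonzero[OF alpha] by auto
  have row: "(if j < n then cnj (\<alpha> j s) else cnj (\<tau> s)) =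
      G_mat n (\<lambda>j. \<alpha> j s) (\<tau> s) $$ (0, j) / (\<Prod>i<j. rho (\<alpha> i s))" if "j \<le> n" for j s
    using G_first_row[OF that, of "\<lambda>j. \<alpha> j s" "\<tau> s"] nz[OF that] by simp
  have step: "(\<lambda>s. if j < n then cnj (\<alpha> j s) else cnj (\<tau> s)) differentiable (at t)"
    if "j \<le> n" "\<And>i. i < j \<Longrightarrow> \<alpha> i differentiable (at t)" for j
  proof -
    have "(\<lambda>s. \<Prod>i<j. rho (\<alpha> i s)) differentiable (at t)"
      using that alpha by (intro differentiable_prod rho_differentiable) auto
    thus ?thesis unfolding row[OF that(1)] using G[OF that(1)] nz[OF that(1)] by simp
  qed
  show a: "\<alpha> j differentiable (at t)" if "j < n" for j
    using that
  proof (induction j rule: less_induct)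
    case (less j)
    have "(\<lambda>s. cnj (\<alpha> j s)) differentiable (at t)" using step[of j] less by simp
    from cnj_differentiable[OF this] show ?case by simp
  qed
  have "(\<lambda>s. cnj (\<tau> s)) differentiable (at t)" using step[of n] a by simp
  from cnj_differentiable[OF this] show "\<tau> differentiable (at t)" by simp
qed

lemma tau_differentiable:
  fixes \<alpha> :: "nat \<Rightarrow> real \<Rightarrow> complex" and \<tau> :: "real \<Rightarrow> complex"
  assumes V: "\<And>s. verblunsky n (\<lambda>j. \<alpha> j s) (\<tau> s) \<zeta> w"
    and d: "\<And>j. j < n \<Longrightarrow> \<alpha> j differentiable (at t)" "\<tau> differentiable (at t)"
    and j: "j \<le> n"
  shows "(\<lambda>s. tau n (\<lambda>j. \<alpha> j s) (\<tau> s) \<zeta> j) differentiable (at t)"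
  using j
proof (induction rule: inc_induct)
  case base
  have "(\<lambda>s. tau n (\<lambda>j. \<alpha> j s) (\<tau> s) \<zeta> n) = \<tau>" by (simp add: tau.simps fun_eq_iff)
  thus ?case using d by simp
next
  case (step j)
  interpret verblunsky n "\<lambda>j. \<alpha> j t" "\<tau> t" \<zeta> w by (rule V)
  have jn: "j < n" using step by auto
  have nz: "cnj (\<alpha> j t) * T (Suc j) + cnj \<zeta> \<noteq> 0"
    using tau_denominator[OF jn] norm_tau[of "Suc j"] jn by simp
  show ?case unfolding verblunsky.tau_step[OF V jn]
    using d(1)[OF jn] step.IH nz by (intro differentiable_divide differentiable_add differentiable_mult cnj_differentiable) auto
qed

lemma beta_differentiable:
  fixes \<alpha> :: "nat \<Rightarrow> real \<Rightarrow> complex" and \<tau> :: "real \<Rightarrow> complex"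
  assumes V: "\<And>s. verblunsky n (\<lambda>j. \<alpha> j s) (\<tau> s) \<zeta> w"
    and R: "verblunsky_regular n (\<lambda>j. \<alpha> j t) (\<tau> t) \<zeta> w"
    and d: "\<And>j. j < n \<Longrightarrow> \<alpha> j differentiable (at t)" "\<tau> differentiable (at t)"
    and j: "j \<le> n"
  shows "(\<lambda>s. beta n (\<lambda>j. \<alpha> j s) (\<tau> s) \<zeta> w j) differentiable (at t)"
  using j
proof (induction j)
  case 0
  interpret verblunsky_regular n "\<lambda>j. \<alpha> j t" "\<tau> t" \<zeta> w by (rule R)
  have "1 / w = cnj w" using cnj_w_mult(1) norm_w by (subst divide_eq_eq) auto
  hence nz: "1 / w - T 0 * w \<noteq> 0" using beta_0_identities(4) by simp
  have "(\<lambda>s. tau n (\<lambda>j. \<alpha> j s) (\<tau> s) \<zeta> 0) differentiable (at t)"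
    by (rule tau_differentiable[OF V d]) simp_all
  thus ?case using nz by simp
next
  case (Suc j)
  interpret verblunsky_regular n "\<lambda>j. \<alpha> j t" "\<tau> t" \<zeta> w by (rule R)
  have jn: "j < n" using Suc by simp
  have t: "(\<lambda>s. tau n (\<lambda>j. \<alpha> j s) (\<tau> s) \<zeta> j) differentiable (at t)"
    by (rule tau_differentiable[OF V d]) (use jn in simp_all)
  let ?e = "\<lambda>s. cnj \<zeta> + tau n (\<lambda>j. \<alpha> j s) (\<tau> s) \<zeta> j * cnj (if j = 0 then - 1 else \<alpha> (j - 1) s)"
  have "b j * ?e t = complex_of_real (r j) * cnj w"
    using beta_closed_form[of j, THEN conjunct1] jn by (simp del: beta.simps)
  moreover have "complex_of_real (r j) * cnj w \<noteq> 0" using r_pos[of j] jn norm_w by auto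
  ultimately have nz: "b j \<noteq> 0" "?e t \<noteq> 0" by auto
  have nz2: "1 - cnj (T j) * \<alpha> j t \<noteq> 0" using one_minus_a_nonzero(1)[OF jn] by (simp add: a_def)
  have "(\<lambda>s. if j = 0 then - 1 else \<alpha> (j - 1) s) differentiable (at t)"
    using d(1)[of "j - 1"] jn by (cases "j = 0") auto
  hence "?e differentiable (at t)" using t
    by (intro differentiable_add differentiable_mult cnj_differentiable) auto
  moreover have "(\<lambda>s. 1 - cnj (tau n (\<lambda>j. \<alpha> j s) (\<tau> s) \<zeta> j) * \<alpha> j s) differentiable (at t)"
    using t d(1)[OF jn] by (intro differentiable_diff differentiable_mult cnj_differentiable) auto
  ultimately show ?case using Suc jn nz nz2 unfolding beta.simps(2)
    by (intro differentiable_mult differentiable_divide differentiable_const) auto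
qed

lemma p_poly_differentiable:
  fixes \<beta> :: "real \<Rightarrow> nat \<Rightarrow> complex" and \<eta> :: "real \<Rightarrow> complex"
  assumes "\<And>j. j \<le> n \<Longrightarrow> (\<lambda>s. \<beta> s j) differentiable (at t)" "\<eta> differentiable (at t)" "j \<le> Suc n"
  shows "(\<lambda>s. poly (p_poly (\<beta> s) p0 j) (\<eta> s)) differentiable (at t)"
  using assms(3)
proof (induction j rule: less_induct)
  case (less j)
  show ?case
  proof (cases j)
    case 0
    thus ?thesis by simp
  next
    case (Suc i)
    have b: "(\<lambda>s. \<beta> s i) differentiable (at t)" using assms(1)[of i] less Suc by simp
    have p: "(\<lambda>s. poly (p_poly (\<beta> s) p0 i) (\<eta> s)) differentiable (at t)" using less Suc by simp
    have q: "(\<lambda>s. poly (if i = 0 then 0 else p_poly (\<beta> s) p0 (i - 1)) (\<eta> s)) differentiable (at t)"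
      using less.IH[of "i - 1"] less.prems Suc by (cases "i = 0") auto
    have "(\<lambda>s. poly (p_poly (\<beta> s) p0 j) (\<eta> s)) = (\<lambda>s. (\<beta> s i + \<eta> s * cnj (\<beta> s i)) * poly (p_poly (\<beta> s) p0 i) (\<eta> s)
        - \<eta> s * poly (if i = 0 then 0 else p_poly (\<beta> s) p0 (i - 1)) (\<eta> s))"
      by (simp add: Suc fun_eq_iff algebra_simps)
    moreover have "(\<lambda>s. (\<beta> s i + \<eta> s * cnj (\<beta> s i)) * poly (p_poly (\<beta> s) p0 i) (\<eta> s)
        - \<eta> s * poly (if i = 0 then 0 else p_poly (\<beta> s) p0 (i - 1)) (\<eta> s)) differentiable (at t)"
      using b p q assms(2) cnj_differentiable[OF b]
      by (intro differentiable_diff differentiable_mult differentiable_add) auto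
    ultimately show ?thesis by simp
  qed
qed

lemma toeplitz_differentiable:
  fixes b :: "real \<Rightarrow> nat \<Rightarrow> complex"
  assumes b: "\<And>j. j \<le> n \<Longrightarrow> (\<lambda>s. b s j) differentiable (at t)" and ij: "i < Suc n" "j < Suc n"
  shows "(\<lambda>s. toeplitz_H (A_mat n (b s) w) $$ (i, j)) differentiable (at t)"
    "(\<lambda>s. toeplitz_K (A_mat n (b s) w) $$ (i, j)) differentiable (at t)"
proof -
  have A: "(\<lambda>s. A_mat n (b s) w $$ (i, j)) differentiable (at t)" if "i < Suc n" "j < Suc n" for i j
    using cnj_differentiable[OF b[of i]] that by (cases "i = j") (auto simp: A_mat_index)
  have A': "(\<lambda>s. cnj (A_mat n (b s) w $$ (j, i))) differentiable (at t)"
    by (rule cnj_differentiable[OF A[OF ij(2,1)]])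
  show "(\<lambda>s. toeplitz_H (A_mat n (b s) w) $$ (i, j)) differentiable (at t)"
    unfolding toeplitz_index(1)[OF ij] using A[OF ij] A' by simp
  show "(\<lambda>s. toeplitz_K (A_mat n (b s) w) $$ (i, j)) differentiable (at t)"
    unfolding toeplitz_index(2)[OF ij] using A[OF ij] A' by simp
qed

lemma eventually_nhds_neq:
  fixes f :: "real \<Rightarrow> complex"
  assumes "f differentiable (at t)" "f t \<noteq> c"
  shows "\<forall>\<^sub>F s in nhds t. f s \<noteq> c"
proof -
  have "isCont f t" using assms(1) differentiable_imp_continuous_within by blast
  hence "(f \<longlongrightarrow> f t) (nhds t)" by (simp add: isCont_def tendsto_at_iff_tendsto_nhds)
  thus ?thesis using assms(2) by (rule tendsto_imp_eventually_ne)
qed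

section \<open>First-order perturbation of a Hermitian pencil\<close>

lemma mult_differentiable:
  fixes M N :: "real \<Rightarrow> complex mat"
  assumes "\<forall>\<^sub>F s in nhds t. M s \<in> carrier_mat m m \<and> N s \<in> carrier_mat m m"
    and "\<And>i j. i < m \<Longrightarrow> j < m \<Longrightarrow> (\<lambda>s. M s $$ (i, j)) differentiable (at t)"
    and "\<And>i j. i < m \<Longrightarrow> j < m \<Longrightarrow> (\<lambda>s. N s $$ (i, j)) differentiable (at t)"
    and ij: "i < m" "j < m"
  shows "(\<lambda>s. (M s * N s) $$ (i, j)) differentiable (at t)"
proof (rule differentiable_transform_nhds)
  show "(\<lambda>s. \<Sum>l<m. M s $$ (i, l) * N s $$ (l, j)) differentiable (at t)"
    using assms by (intro differentiable_sum differentiable_mult) auto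
  show "\<forall>\<^sub>F s in nhds t. (\<Sum>l<m. M s $$ (i, l) * N s $$ (l, j)) = (M s * N s) $$ (i, j)"
    using assms(1) by (rule eventually_mono) (use ij in \<open>simp add: index_mult_sum[of _ m m _ m] del: index_mult_mat\<close>)
qed

lemma mult_vec_differentiable:
  fixes M :: "real \<Rightarrow> complex mat" and v :: "real \<Rightarrow> complex vec"
  assumes "\<forall>\<^sub>F s in nhds t. M s \<in> carrier_mat m m \<and> v s \<in> carrier_vec m"
    and "\<And>i j. i < m \<Longrightarrow> j < m \<Longrightarrow> (\<lambda>s. M s $$ (i, j)) differentiable (at t)"
    and "\<And>i. i < m \<Longrightarrow> (\<lambda>s. v s $ i) differentiable (at t)"
    and i: "i < m"
  shows "(\<lambda>s. (M s *\<^sub>v v s) $ i) differentiable (at t)"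
proof (rule differentiable_transform_nhds)
  show "(\<lambda>s. \<Sum>l<m. M s $$ (i, l) * v s $ l) differentiable (at t)"
    using assms by (intro differentiable_sum differentiable_mult) auto
  show "\<forall>\<^sub>F s in nhds t. (\<Sum>l<m. M s $$ (i, l) * v s $ l) = (M s *\<^sub>v v s) $ i"
    using assms(1) by (rule eventually_mono) (use i in \<open>simp add: index_mult_vec_sum[of _ m m] del: index_mult_mat_vec\<close>)
qed

lemma hermitian_form_real:
  fixes X :: "complex mat"
  assumes "X \<in> carrier_mat m m" "mat_adjoint X = X" "v \<in> carrier_vec m"
  shows "(X *\<^sub>v v) \<bullet>c v = complex_of_real (Re ((X *\<^sub>v v) \<bullet>c v))"
proof -
  have Xv: "X *\<^sub>v v \<in> carrier_vec m" using assms by auto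
  have "(X *\<^sub>v v) \<bullet>c v = v \<bullet>c (X *\<^sub>v v)" using adjoint_swap[OF assms(1,3,3)] assms(2) by simp
  also have "\<dots> = cnj ((X *\<^sub>v v) \<bullet>c v)"
    unfolding cscalar_sum[OF assms(3) Xv] cscalar_sum[OF Xv assms(3)] by (simp add: mult.commute)
  finally have "Im ((X *\<^sub>v v) \<bullet>c v) = 0" by (simp add: complex_eq_iff)
  thus ?thesis by (simp add: complex_eq_iff)
qed

text \<open>
  Differentiate \<open>(M(s) q(s), q(t)) = \<mu>(s) (q(s), q(t))\<close> at \<open>s = t\<close>, with the second argument kept fixed. The terms
  with \<open>q'\<close> cancel because \<open>q(t)\<close> is also a left eigenvector of the Hermitian matrix \<open>M(t)\<close>.
\<close>
lemma hellmann_feynman: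
  fixes M :: "real \<Rightarrow> complex mat" and q :: "real \<Rightarrow> complex vec" and \<mu> :: "real \<Rightarrow> real"
  assumes carrier: "\<forall>\<^sub>F s in nhds t. M s \<in> carrier_mat m m \<and> q s \<in> carrier_vec m"
    and dM: "\<And>i j. i < m \<Longrightarrow> j < m \<Longrightarrow> (\<lambda>s. M s $$ (i, j)) differentiable (at t)"
    and dq: "\<And>i. i < m \<Longrightarrow> (\<lambda>s. q s $ i) differentiable (at t)"
    and herm: "mat_adjoint (M t) = M t"
    and eigen: "\<forall>\<^sub>F s in nhds t. M s *\<^sub>v q s = complex_of_real (\<mu> s) \<cdot>\<^sub>v q s"
    and dl: "(\<mu> has_real_derivative l') (at t)"
  shows "(mat_deriv M t *\<^sub>v q t) \<bullet>c q t = complex_of_real l' * (q t \<bullet>c q t)"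
proof -
  have Mt: "M t \<in> carrier_mat m m" and qt: "q t \<in> carrier_vec m" using eventually_nhds_x_imp_x[OF carrier] by auto
  have et: "M t *\<^sub>v q t = complex_of_real (\<mu> t) \<cdot>\<^sub>v q t" using eventually_nhds_x_imp_x[OF eigen] .
  define M' where "M' i j = vector_derivative (\<lambda>s. M s $$ (i, j)) (at t)" for i j
  define q' where "q' i = vector_derivative (\<lambda>s. q s $ i) (at t)" for i
  have vM: "((\<lambda>s. M s $$ (i, j)) has_vector_derivative M' i j) (at t)" if "i < m" "j < m" for i j
    using dM[OF that] unfolding M'_def by (simp add: vector_derivative_works)
  have vq: "((\<lambda>s. q s $ i) has_vector_derivative q' i) (at t)" if "i < m" for i
    using dq[OF that] unfolding q'_def by (simp add: vector_derivative_works)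
  have vl: "((\<lambda>s. complex_of_real (\<mu> s)) has_vector_derivative complex_of_real l') (at t)"
    using dl by (intro has_vector_derivative_of_real) (simp add: has_real_derivative_iff_has_vector_derivative)
  define c where "c i = cnj (q t $ i)" for i
  define f where "f s = (\<Sum>i<m. \<Sum>j<m. (M s $$ (i, j) * q s $ j) * c i)" for s
  define g where "g s = complex_of_real (\<mu> s) * (\<Sum>i<m. q s $ i * c i)" for s
  have fg: "\<forall>\<^sub>F s in nhds t. f s = g s"
    using carrier eigen
  proof eventually_elim
    case (elim s)
    have ix: "(M s *\<^sub>v q s) $ i = (\<Sum>j<m. M s $$ (i, j) * q s $ j)" if "i < m" for i
      using that elim(1) by (intro index_mult_vec_sum) auto
    have "f s = (\<Sum>i<m. (M s *\<^sub>v q s) $ i * c i)"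
      unfolding f_def by (intro sum.cong refl) (simp add: ix sum_distrib_right del: index_mult_mat_vec)
    also have "\<dots> = (\<Sum>i<m. complex_of_real (\<mu> s) * (q s $ i * c i))"
      unfolding elim(2) using elim(1) by (intro sum.cong refl) auto
    finally show ?case by (simp add: g_def sum_distrib_left)
  qed
  have "(f has_vector_derivative (\<Sum>i<m. \<Sum>j<m. (M t $$ (i, j) * q' j + M' i j * q t $ j) * c i)) (at t)"
    unfolding f_def by (intro has_vector_derivative_sum has_vector_derivative_mult_left has_vector_derivative_mult vM vq) auto
  moreover have "(g has_vector_derivative (complex_of_real (\<mu> t) * (\<Sum>i<m. q' i * c i) + complex_of_real l' * (\<Sum>i<m. q t $ i * c i))) (at t)"
    unfolding g_def by (intro has_vector_derivative_mult has_vector_derivative_sum has_vector_derivative_mult_left vq vl) auto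
  moreover have "(g has_vector_derivative y) (at t)" if "(f has_vector_derivative y) (at t)" for y
    by (rule has_vector_derivative_transform_nhds[OF that fg])
  ultimately have eq: "(\<Sum>i<m. \<Sum>j<m. (M t $$ (i, j) * q' j + M' i j * q t $ j) * c i) =
     complex_of_real (\<mu> t) * (\<Sum>i<m. q' i * c i) + complex_of_real l' * (\<Sum>i<m. q t $ i * c i)"
    using vector_derivative_unique_at by blast
  have Mc: "(\<Sum>i<m. M t $$ (i, j) * c i) = complex_of_real (\<mu> t) * c j" if j: "j < m" for j
  proof -
    have "(\<Sum>i<m. M t $$ (i, j) * c i) = cnj (\<Sum>i<m. M t $$ (j, i) * q t $ i)"
      unfolding cnj_sum
    proof (rule sum.cong[OF refl])
      fix i assume "i \<in> {..<m}"
      hence "M t $$ (i, j) = cnj (M t $$ (j, i))" using herm Mt j by (metis carrier_matD index_adjoint lessThan_iff)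
      thus "M t $$ (i, j) * c i = cnj (M t $$ (j, i) * q t $ i)" by (simp add: c_def)
    qed
    also have "(\<Sum>i<m. M t $$ (j, i) * q t $ i) = (M t *\<^sub>v q t) $ j"
      by (rule index_mult_vec_sum[symmetric, OF Mt qt j])
    finally show ?thesis using et qt j by (simp add: c_def)
  qed
  have "(\<Sum>i<m. \<Sum>j<m. (M t $$ (i, j) * q' j + M' i j * q t $ j) * c i) =
     (\<Sum>i<m. \<Sum>j<m. q' j * (M t $$ (i, j) * c i)) + (\<Sum>i<m. \<Sum>j<m. M' i j * q t $ j * c i)"
    by (simp only: sum.distrib[symmetric] ring_distribs mult_ac)
  also have "(\<Sum>i<m. \<Sum>j<m. q' j * (M t $$ (i, j) * c i)) = (\<Sum>j<m. \<Sum>i<m. q' j * (M t $$ (i, j) * c i))"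
    by (rule sum.swap)
  also have "\<dots> = (\<Sum>j<m. q' j * (complex_of_real (\<mu> t) * c j))"
    by (intro sum.cong refl) (simp add: Mc flip: sum_distrib_left)
  also have "\<dots> = complex_of_real (\<mu> t) * (\<Sum>i<m. q' i * c i)"
    by (simp add: sum_distrib_left mult_ac)
  finally have main: "(\<Sum>i<m. \<Sum>j<m. M' i j * q t $ j * c i) = complex_of_real l' * (\<Sum>i<m. q t $ i * c i)"
    using eq by simp
  have D: "mat_deriv M t \<in> carrier_mat m m" using Mt by (auto simp: mat_deriv_def)
  have "(mat_deriv M t *\<^sub>v q t) \<bullet>c q t = (\<Sum>i<m. \<Sum>j<m. M' i j * q t $ j * c i)"
    unfolding quad_form_sum[OF D qt] using Mt
    by (intro sum.cong refl) (auto simp: mat_deriv_def M'_def c_def)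
  thus ?thesis using main qt by (simp add: cscalar_sum[of _ m] c_def)
qed

text \<open>
  With \<open>X = H\<^sup>1\<^sup>/\<^sup>2\<close> and \<open>q = X P\<close>, the equation \<open>K P = \<mu> H P\<close> becomes \<open>M q = \<mu> q\<close> for
  \<open>M = X\<^sup>-\<^sup>1 K X\<^sup>-\<^sup>1\<close>. The lemma \<open>hellmann_feynman\<close> applies to this standard eigenvalue problem, and
  \<open>(q, q) = (H P, P)\<close>.
\<close>
lemma pencil_derivative:
  fixes H K :: "real \<Rightarrow> complex mat" and P :: "real \<Rightarrow> complex vec" and \<mu> :: "real \<Rightarrow> real"
  assumes H: "\<And>s. H s \<in> carrier_mat m m" and K: "\<And>s. K s \<in> carrier_mat m m" and P: "\<And>s. P s \<in> carrier_vec m"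
    and pd: "\<forall>\<^sub>F s in nhds t. pos_def (H s)" and Kh: "mat_adjoint (K t) = K t"
    and dH: "\<And>i j. i < m \<Longrightarrow> j < m \<Longrightarrow> (\<lambda>s. H s $$ (i, j)) differentiable (at t)"
    and dK: "\<And>i j. i < m \<Longrightarrow> j < m \<Longrightarrow> (\<lambda>s. K s $$ (i, j)) differentiable (at t)"
    and dP: "\<And>i. i < m \<Longrightarrow> (\<lambda>s. P s $ i) differentiable (at t)"
    and eigen: "\<forall>\<^sub>F s in nhds t. K s *\<^sub>v P s = complex_of_real (\<mu> s) \<cdot>\<^sub>v (H s *\<^sub>v P s)"
    and dl: "(\<mu> has_real_derivative l') (at t)"
  shows "P t \<bullet>c ((pd_sqrt (H t) * mat_deriv (\<lambda>s. pd_inv_sqrt (H s) * K s * pd_inv_sqrt (H s)) t * pd_sqrt (H t)) *\<^sub>v P t)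
    = complex_of_real l' * ((H t *\<^sub>v P t) \<bullet>c P t)"
proof -
  define X where "X s = pd_sqrt (H s)" for s
  define R where "R s = pd_inv_sqrt (H s)" for s
  define M where "M s = R s * K s * R s" for s
  define q where "q s = X s *\<^sub>v P s" for s
  have pdt: "pos_def (H t)" using pd by (rule eventually_nhds_x_imp_x)
  have X: "X s \<in> carrier_mat m m" "X s * X s = H s" "mat_adjoint (X s) = X s"
    and R: "R s \<in> carrier_mat m m" "X s * R s = 1\<^sub>m m" "R s * X s = 1\<^sub>m m" "mat_adjoint (R s) = R s"
    if "pos_def (H s)" for s
    using pd_sqrt[OF H that] pd_inv_sqrt[OF H that] by (auto simp: X_def R_def pos_def_def)
  have dX: "(\<lambda>s. X s $$ (i, j)) differentiable (at t)" if "i < m" "j < m" for i j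
    unfolding X_def by (rule pd_sqrt_differentiable[OF H pd dH that])
  have dR: "(\<lambda>s. R s $$ (i, j)) differentiable (at t)" if "i < m" "j < m" for i j
    by (rule inverse_differentiable[where M = X and m = m]) (use that dX X R in \<open>auto intro: eventually_mono[OF pd]\<close>)
  have dRK: "(\<lambda>s. (R s * K s) $$ (i, j)) differentiable (at t)" if "i < m" "j < m" for i j
    by (rule mult_differentiable[where m = m]) (use that dR dK R K in \<open>auto intro: eventually_mono[OF pd]\<close>)
  have dM: "(\<lambda>s. M s $$ (i, j)) differentiable (at t)" if "i < m" "j < m" for i j
    unfolding M_def by (rule mult_differentiable[where m = m]) (use that dR dRK R K in \<open>auto intro: eventually_mono[OF pd]\<close>)
  have dq: "(\<lambda>s. q s $ i) differentiable (at t)" if "i < m" for i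
    unfolding q_def by (rule mult_vec_differentiable[where m = m]) (use that dX dP X P in \<open>auto intro: eventually_mono[OF pd]\<close>)
  have Mc: "M s \<in> carrier_mat m m" and qc: "q s \<in> carrier_vec m" if "pos_def (H s)" for s
    using X[OF that] R[OF that] K P by (auto simp: M_def q_def)
  have eig: "\<forall>\<^sub>F s in nhds t. M s *\<^sub>v q s = complex_of_real (\<mu> s) \<cdot>\<^sub>v q s"
    using pd eigen
  proof eventually_elim
    case (elim s)
    note X = X[OF elim(1)] and R = R[OF elim(1)]
    have "M s *\<^sub>v q s = R s *\<^sub>v (K s *\<^sub>v ((R s * X s) *\<^sub>v P s))"
      using X(1) R(1) K[of s] P[of s] by (simp add: M_def q_def assoc_mult_mat_vec[of _ m m _ m])
    also have "\<dots> = R s *\<^sub>v (complex_of_real (\<mu> s) \<cdot>\<^sub>v ((X s * X s) *\<^sub>v P s))"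
      using elim(2) R(3) X(2) P[of s] by simp
    also have "\<dots> = complex_of_real (\<mu> s) \<cdot>\<^sub>v ((R s * X s) *\<^sub>v (X s *\<^sub>v P s))"
      using X(1) R(1) P[of s] by (simp add: assoc_mult_mat_vec[of _ m m _ m] mult_mat_vec[of _ m m] del: X(2))
    also have "\<dots> = complex_of_real (\<mu> s) \<cdot>\<^sub>v q s"
      using R(3) X(1) P[of s] by (simp add: q_def)
    finally show ?case .
  qed
  have Mh: "mat_adjoint (M t) = M t"
    using R[OF pdt] K[of t] Kh by (simp add: M_def adjoint_mult[of _ m m _ m] assoc_mult_mat[of _ m m _ m _ m])
  have HF: "(mat_deriv M t *\<^sub>v q t) \<bullet>c q t = complex_of_real l' * (q t \<bullet>c q t)"
    by (rule hellmann_feynman[where m = m, OF _ dM dq Mh eig dl]) (use Mc qc in \<open>auto intro: eventually_mono[OF pd]\<close>)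
  let ?D = "mat_deriv M t"
  have D: "?D \<in> carrier_mat m m" using Mc[OF pdt] by (auto simp: mat_deriv_def)
  note X = X[OF pdt] and q = qc[OF pdt]
  have "P t \<bullet>c ((X t * ?D * X t) *\<^sub>v P t) = P t \<bullet>c (X t *\<^sub>v (?D *\<^sub>v q t))"
    using X(1) D P[of t] by (simp add: q_def assoc_mult_mat_vec[of _ m m _ m])
  also have "\<dots> = q t \<bullet>c (?D *\<^sub>v q t)"
    using adjoint_swap[OF X(1) P, of "?D *\<^sub>v q t"] D q X(3) by (auto simp: q_def)
  also have "\<dots> = cnj ((?D *\<^sub>v q t) \<bullet>c q t)"
  proof -
    have Dq: "?D *\<^sub>v q t \<in> carrier_vec m" using D by auto
    show ?thesis unfolding cscalar_sum[OF q Dq] cscalar_sum[OF Dq q] by (simp add: mult.commute)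
  qed
  also have "q t \<bullet>c q t = complex_of_real (\<Sum>i<m. (cmod (q t $ i))\<^sup>2)" by (rule cscalar_self[OF q])
  hence "cnj ((?D *\<^sub>v q t) \<bullet>c q t) = complex_of_real l' * (q t \<bullet>c q t)" unfolding HF by simp
  also have "q t \<bullet>c q t = P t \<bullet>c (X t *\<^sub>v q t)"
    using adjoint_swap[OF X(1) P q] X(3) by (simp add: q_def)
  also have "X t *\<^sub>v q t = H t *\<^sub>v P t"
    using X P[of t] by (simp add: q_def flip: assoc_mult_mat_vec[of _ m m _ m])
  also have "P t \<bullet>c (H t *\<^sub>v P t) = (H t *\<^sub>v P t) \<bullet>c P t"
    using adjoint_swap[OF H[of t] P[of t] P[of t]] pdt by (simp add: pos_def_def)
  finally show ?thesis unfolding X_def M_def R_def .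
qed

section \<open>The argument of a Cayley transform\<close>

text \<open>
  Every other branch \<open>\<phi>\<close> that is differentiable at \<open>t\<close> has the same derivative: both
  \<open>cis \<phi>\<close> and \<open>cis \<theta>\<close> agree with \<open>\<eta>\<close> near \<open>t\<close>, and \<open>(cis \<phi>)' = i \<phi>' \<eta>\<close>.
\<close>
lemma arg_deriv_unit:
  fixes \<eta> :: "real \<Rightarrow> complex"
  assumes unit: "\<forall>\<^sub>F s in nhds t. \<eta> s = cis (\<theta> s)" and d: "(\<theta> has_real_derivative d) (at t)"
  shows "arg_deriv \<eta> t = d"
  unfolding arg_deriv_def
proof (rule the_equality)
  show "\<exists>\<theta>. (\<forall>\<^sub>F s in nhds t. is_Arg (\<eta> s) (\<theta> s)) \<and> (\<theta> has_real_derivative d) (at t)"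
    using d by (intro exI[of _ \<theta>] conjI eventually_mono[OF unit]) (auto simp: is_Arg_def cis_conv_exp)
next
  fix e assume "\<exists>\<theta>. (\<forall>\<^sub>F s in nhds t. is_Arg (\<eta> s) (\<theta> s)) \<and> (\<theta> has_real_derivative e) (at t)"
  then obtain \<phi> where phi: "\<forall>\<^sub>F s in nhds t. is_Arg (\<eta> s) (\<phi> s)" "(\<phi> has_real_derivative e) (at t)" by blast
  have eq: "\<forall>\<^sub>F s in nhds t. cis (\<phi> s) = cis (\<theta> s)"
    using phi(1) unit by eventually_elim (auto simp: is_Arg_def cis_conv_exp)
  have dcis: "((\<lambda>s. cis (f s)) has_vector_derivative f' *\<^sub>R (\<i> * cis (f t))) (at t)"
    if "(f has_real_derivative f') (at t)" for f f'
  proof -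
    have "((\<lambda>s. \<i> * complex_of_real (f s)) has_vector_derivative \<i> * complex_of_real f') (at t)"
      using that by (intro has_vector_derivative_mult_right has_vector_derivative_of_real)
        (simp add: has_real_derivative_iff_has_vector_derivative)
    from field_vector_diff_chain_at[OF this DERIV_exp]
    show ?thesis by (simp add: o_def cis_conv_exp scaleR_conv_of_real mult_ac)
  qed
  have "((\<lambda>s. cis (\<theta> s)) has_vector_derivative e *\<^sub>R (\<i> * cis (\<phi> t))) (at t)"
    by (rule has_vector_derivative_transform_nhds[OF dcis[OF phi(2)] eq])
  with dcis[OF d] have "e *\<^sub>R (\<i> * cis (\<phi> t)) = d *\<^sub>R (\<i> * cis (\<theta> t))"
    using vector_derivative_unique_at by blast
  thus "e = d" using eventually_nhds_x_imp_x[OF eq] by simp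
qed

lemma cayley_cis:
  "(complex_of_real x + \<i>) / (complex_of_real x - \<i>) = cis (pi - 2 * arctan x)"
proof -
  have c: "cis (arctan x) = (1 + \<i> * complex_of_real x) / complex_of_real (sqrt (1 + x\<^sup>2))"
    by (simp add: complex_eq_iff cos_arctan sin_arctan)
  have pos: "1 + x\<^sup>2 > 0" by (simp add: add_pos_nonneg)
  have "cis (2 * arctan x) = cis (arctan x) * cis (arctan x)" by (simp add: cis_mult)
  also have "\<dots> = (1 + \<i> * complex_of_real x)\<^sup>2 / complex_of_real (1 + x\<^sup>2)"
    unfolding c using pos by (simp add: power2_eq_square flip: of_real_mult)
  finally have c2: "cis (2 * arctan x) = (1 + \<i> * complex_of_real x)\<^sup>2 / complex_of_real (1 + x\<^sup>2)" .
  have f: "complex_of_real (1 + x\<^sup>2) = (1 + \<i> * complex_of_real x) * (1 - \<i> * complex_of_real x)"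
    by (simp add: algebra_simps power2_eq_square)
  have nz: "1 + \<i> * complex_of_real x \<noteq> 0" "1 - \<i> * complex_of_real x \<noteq> 0" by (simp_all add: complex_eq_iff)
  have "cis (pi - 2 * arctan x) = - inverse (cis (2 * arctan x))"
    by (simp add: cis_divide[symmetric] divide_inverse)
  also have "\<dots> = - ((1 - \<i> * complex_of_real x) / (1 + \<i> * complex_of_real x))"
    unfolding c2 f using nz by (simp add: power2_eq_square)
  also have "\<dots> = (\<i> * (complex_of_real x + \<i>)) / (\<i> * (complex_of_real x - \<i>))"
    by (simp add: algebra_simps minus_divide_left)
  finally show ?thesis by simp
qed

lemma arg_deriv_cayley:
  fixes \<eta> :: "real \<Rightarrow> complex" and \<mu> :: "real \<Rightarrow> real"
  assumes z: "cmod \<zeta> = 1" and e: "\<forall>\<^sub>F s in nhds t. \<eta> s = \<zeta> * ((complex_of_real (\<mu> s) + \<i>) / (complex_of_real (\<mu> s) - \<i>))"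
    and d: "(\<mu> has_real_derivative l') (at t)"
  shows "arg_deriv \<eta> t = - 2 * l' / (1 + (\<mu> t)\<^sup>2)"
proof (rule arg_deriv_unit)
  have zc: "cis (Arg \<zeta>) = \<zeta>" using z cis_Arg[of \<zeta>] by (cases "\<zeta> = 0") (auto simp: sgn_eq)
  show "\<forall>\<^sub>F s in nhds t. \<eta> s = cis (Arg \<zeta> + (pi - 2 * arctan (\<mu> s)))"
    using e by (rule eventually_mono) (use z in \<open>simp only: cayley_cis cis_mult[symmetric] zc\<close>)
  show "((\<lambda>s. Arg \<zeta> + (pi - 2 * arctan (\<mu> s))) has_real_derivative - 2 * l' / (1 + (\<mu> t)\<^sup>2)) (at t)"
    using d by (auto intro!: derivative_eq_intros simp: divide_inverse)
qed

section \<open>Motion of the eigenvalues\<close>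

theorem corollary3p1:
  fixes n :: nat
    and \<alpha> :: "nat \<Rightarrow> real \<Rightarrow> complex" and \<tau>n :: "real \<Rightarrow> complex"
    and \<zeta> w :: complex and p0 :: real
    and \<eta> :: "real \<Rightarrow> complex" and t :: real
    and G :: "real \<Rightarrow> complex mat" and S :: "real \<Rightarrow> complex set" and U :: "real set"
    and b :: "real \<Rightarrow> nat \<Rightarrow> complex"
    and H K :: "real \<Rightarrow> complex mat" and p :: "complex vec"
  defines "G \<equiv> \<lambda>s. G_mat n (\<lambda>j. \<alpha> j s) (\<tau>n s)"
    and "S \<equiv> \<lambda>s. spectrum (G s)"
    and "U \<equiv> {s. \<zeta> \<notin> S s}"
    and "b \<equiv> \<lambda>s. beta n (\<lambda>j. \<alpha> j s) (\<tau>n s) \<zeta> w"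
    and "H \<equiv> \<lambda>s. toeplitz_H (A_mat n (b s) w)"
    and "K \<equiv> \<lambda>s. toeplitz_K (A_mat n (b s) w)"
    and "p \<equiv> vec (n + 1) (\<lambda>j. poly (p_poly (b t) p0 j) (\<eta> t))"
  assumes "1 \<le> n"
    and "\<And>s j. j < n \<Longrightarrow> cmod (\<alpha> j s) < 1"
    and "\<And>s. cmod (\<tau>n s) = 1"
    and "\<And>s i j. i < n + 1 \<Longrightarrow> j < n + 1 \<Longrightarrow> (\<lambda>r. G r $$ (i, j)) differentiable (at s)"
    and "cmod \<zeta> = 1" and "w\<^sup>2 = \<zeta>" and "p0 \<noteq> 0"
    and "t \<in> U"
    and "\<forall>\<^sub>F s in nhds t. \<eta> s \<in> S s"
    and "\<eta> differentiable (at t)"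
  shows "arg_deriv \<eta> t > 0 \<longleftrightarrow>
         p \<bullet>c ((pd_sqrt (H t)
                * mat_deriv (\<lambda>s. pd_inv_sqrt (H s) * K s * pd_inv_sqrt (H s)) t
                * pd_sqrt (H t)) *\<^sub>v p) < 0"
proof -
  note alpha = assms(9) and tau = assms(10) and dG = assms(11) and zeta = assms(12) and w = assms(13)
    and p0 = assms(14) and tU = assms(15) and etaS = assms(16) and deta = assms(17)
  have V: "verblunsky n (\<lambda>j. \<alpha> j s) (\<tau>n s) \<zeta> w" for s
    using alpha tau zeta w by unfold_locales auto
  have row: "(\<lambda>s. G_mat n (\<lambda>j. \<alpha> j s) (\<tau>n s) $$ (0, j)) differentiable (at t)" if "j \<le> n" for j
    using dG[of 0 j t] that by (simp add: G_def)
  have da: "\<And>j. j < n \<Longrightarrow> \<alpha> j differentiable (at t)" and dt: "\<tau>n differentiable (at t)"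
    using parameters_differentiable[OF alpha row] by blast+
  have zt: "\<zeta> \<notin> spectrum (G_mat n (\<lambda>j. \<alpha> j t) (\<tau>n t))" using tU by (simp add: U_def S_def G_def)
  have dT: "(\<lambda>s. tau n (\<lambda>j. \<alpha> j s) (\<tau>n s) \<zeta> 0 * \<zeta>) differentiable (at t)"
    using tau_differentiable[OF V da dt, of 0] by simp
  \<comment> \<open>Regularity is an open condition, so it holds near \<open>t\<close> as soon as it holds at \<open>t\<close>.\<close>
  have "\<forall>\<^sub>F s in nhds t. tau n (\<lambda>j. \<alpha> j s) (\<tau>n s) \<zeta> 0 * \<zeta> \<noteq> 1"
    by (rule eventually_nhds_neq[OF dT verblunsky.not_eigenvalue_imp_regular[OF V zt]])
  hence reg: "\<forall>\<^sub>F s in nhds t. verblunsky_regular n (\<lambda>j. \<alpha> j s) (\<tau>n s) \<zeta> w"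
    by (rule eventually_mono) (auto intro!: verblunsky_regular.intro V simp: verblunsky_regular_axioms_def)
  have db: "(\<lambda>s. b s j) differentiable (at t)" if "j \<le> n" for j
    unfolding b_def by (rule beta_differentiable[OF V eventually_nhds_x_imp_x[OF reg] da dt that])
  define P where "P s = vec (Suc n) (\<lambda>j. poly (p_poly (b s) p0 j) (\<eta> s))" for s
  have Pc: "P s \<in> carrier_vec (Suc n)" for s by (simp add: P_def)
  have dP: "(\<lambda>s. P s $ i) differentiable (at t)" if "i < Suc n" for i
    using p_poly_differentiable[where n = n and j = i and ?p0.0 = p0, OF db deta] that by (simp add: P_def)
  have Hc: "H s \<in> carrier_mat (Suc n) (Suc n)" and Kc: "K s \<in> carrier_mat (Suc n) (Suc n)" for s
    unfolding H_def K_def by (rule toeplitz_carrier)+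
  have Hh: "mat_adjoint (H s) = H s" and Kh: "mat_adjoint (K s) = K s" for s
    unfolding H_def K_def by (rule toeplitz_adjoint)+
  have dH: "(\<lambda>s. H s $$ (i, j)) differentiable (at t)" and dK: "(\<lambda>s. K s $$ (i, j)) differentiable (at t)"
    if "i < Suc n" "j < Suc n" for i j
    unfolding H_def K_def using toeplitz_differentiable[OF db that] by auto
  have pd: "\<forall>\<^sub>F s in nhds t. pos_def (H s)"
    using reg by (rule eventually_mono) (auto simp: H_def b_def intro: verblunsky_regular.toeplitz_H_pos_def)
  have "\<eta> t \<noteq> \<zeta>" using eventually_nhds_x_imp_x[OF etaS] zt by (auto simp: S_def G_def)
  hence neq: "\<forall>\<^sub>F s in nhds t. \<eta> s \<noteq> \<zeta>" by (rule eventually_nhds_neq[OF deta])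
  define l where "l s = \<i> * (\<eta> s + \<zeta>) / (\<eta> s - \<zeta>)" for s
  define \<mu> where "\<mu> s = Re (l s)" for s
  have pencil: "\<forall>\<^sub>F s in nhds t. K s *\<^sub>v P s = l s \<cdot>\<^sub>v (H s *\<^sub>v P s)"
    using reg neq etaS
  proof eventually_elim
    case (elim s)
    from verblunsky_regular.toeplitz_pencil[OF elim(1), of "\<eta> s" p0] elim
    show ?case unfolding K_def H_def P_def l_def b_def S_def G_def by blast
  qed
  have Ppos: "0 < Re ((H s *\<^sub>v P s) \<bullet>c P s)" if "pos_def (H s)" for s
  proof -
    have "P s $ 0 = complex_of_real p0" by (simp add: P_def)
    hence "P s \<noteq> 0\<^sub>v (Suc n)" using p0 by auto
    hence "0 < (H s *\<^sub>v P s) \<bullet>c P s" using that Pc[of s] Hc[of s] by (auto simp: pos_def_def)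
    thus ?thesis by (simp add: less_complex_def)
  qed
  \<comment> \<open>The pencil equation tested with \<open>P\<close> exhibits \<open>l s\<close> as a quotient of two real numbers.\<close>
  have real: "\<forall>\<^sub>F s in nhds t. l s = complex_of_real (\<mu> s)"
    using pencil pd
  proof eventually_elim
    case (elim s)
    define h where "h = Re ((H s *\<^sub>v P s) \<bullet>c P s)"
    define k where "k = Re ((K s *\<^sub>v P s) \<bullet>c P s)"
    have h: "h > 0" using Ppos[OF elim(2)] by (simp add: h_def)
    have HP: "H s *\<^sub>v P s \<in> carrier_vec (Suc n)" using Hc Pc by auto
    have "complex_of_real k = (K s *\<^sub>v P s) \<bullet>c P s"
      unfolding k_def by (rule hermitian_form_real[OF Kc Kh Pc, symmetric])
    also have "\<dots> = l s * ((H s *\<^sub>v P s) \<bullet>c P s)"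
      unfolding elim(1) using HP Pc[of s] by (subst smult_scalar_prod_distrib[of _ "Suc n"]) auto
    also have "(H s *\<^sub>v P s) \<bullet>c P s = complex_of_real h"
      unfolding h_def by (rule hermitian_form_real[OF Hc Hh Pc])
    finally have "l s = complex_of_real (k / h)" using h by (simp add: field_simps)
    thus ?case by (simp add: \<mu>_def)
  qed
  have "\<eta> t - \<zeta> \<noteq> 0" using \<open>\<eta> t \<noteq> \<zeta>\<close> by simp
  hence "l differentiable (at t)" unfolding l_def using deta by simp
  from differentiable_compose[OF bounded_linear_imp_differentiable[OF bounded_linear_Re] this]
  have "\<mu> differentiable (at t)" unfolding \<mu>_def .
  then obtain l' where l': "(\<mu> has_real_derivative l') (at t)" using real_differentiable_def by blast
  \<comment> \<open>Solving \<open>\<mu> = i (\<eta> + \<zeta>) / (\<eta> - \<zeta>)\<close> for \<open>\<eta>\<close>.\<close>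
  have cayley: "\<forall>\<^sub>F s in nhds t. \<eta> s = \<zeta> * ((complex_of_real (\<mu> s) + \<i>) / (complex_of_real (\<mu> s) - \<i>))"
    using real neq
  proof eventually_elim
    case (elim s)
    have "complex_of_real (\<mu> s) * (\<eta> s - \<zeta>) = \<i> * (\<eta> s + \<zeta>)"
      using elim unfolding elim(1)[symmetric] by (simp add: l_def)
    hence "\<eta> s * (complex_of_real (\<mu> s) - \<i>) = \<zeta> * (complex_of_real (\<mu> s) + \<i>)"
      by (simp add: algebra_simps)
    moreover have "complex_of_real (\<mu> s) - \<i> \<noteq> 0" by (simp add: complex_eq_iff)
    ultimately show ?case by (simp add: eq_divide_eq)
  qed
  have arg: "arg_deriv \<eta> t = - 2 * l' / (1 + (\<mu> t)\<^sup>2)"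
    by (rule arg_deriv_cayley[OF zeta cayley l'])
  have eig: "\<forall>\<^sub>F s in nhds t. K s *\<^sub>v P s = complex_of_real (\<mu> s) \<cdot>\<^sub>v (H s *\<^sub>v P s)"
    using pencil real by eventually_elim simp
  define h where "h = Re ((H t *\<^sub>v P t) \<bullet>c P t)"
  have h: "h > 0" unfolding h_def by (rule Ppos[OF eventually_nhds_x_imp_x[OF pd]])
  have "P t \<bullet>c ((pd_sqrt (H t) * mat_deriv (\<lambda>s. pd_inv_sqrt (H s) * K s * pd_inv_sqrt (H s)) t * pd_sqrt (H t)) *\<^sub>v P t)
      = complex_of_real l' * ((H t *\<^sub>v P t) \<bullet>c P t)"
    by (rule pencil_derivative[OF Hc Kc Pc pd Kh dH dK dP eig l'])
  also have "\<dots> = complex_of_real (l' * h)"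
    unfolding h_def using hermitian_form_real[OF Hc Hh Pc, of t] by simp
  finally have val: "p \<bullet>c ((pd_sqrt (H t) * mat_deriv (\<lambda>s. pd_inv_sqrt (H s) * K s * pd_inv_sqrt (H s)) t * pd_sqrt (H t)) *\<^sub>v p)
      = complex_of_real (l' * h)"
    by (simp add: p_def P_def)
  have "1 + (\<mu> t)\<^sup>2 > 0" by (simp add: add_pos_nonneg)
  hence "arg_deriv \<eta> t > 0 \<longleftrightarrow> l' < 0"
    unfolding arg by (auto simp: zero_less_divide_iff divide_less_0_iff)
  also have "\<dots> \<longleftrightarrow> complex_of_real (l' * h) < 0"
    using h by (auto simp: less_complex_def mult_less_0_iff)
  finally show ?thesis unfolding val .
qed

end
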